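(* Let $M_{g-1}$ be the quasi-polarised superspecial Dieudonné module at the top of a polarised flag type quotient (PFTQ) of Dieudonné modules of genus $g$ over $W(k)$. (i) If $g$ is odd, there is a basis $e_1,f_1,\dots,e_g,f_g$ of $M_{g-1}$ as a free $W(k)$-module such that $$Fe_i=f_i,\quad Ve_i=-f_i,\quad Ff_i=-pe_i,\quad Vf_i=pe_i,$$ and the quasi-polarisation $M_{g-1}^t\times M_{g-1}^t\to W(k)$ with respect to the dual basis $e_1^*,f_1^*,\dots,e_g^*,f_g^*$ is given by the block diagonal matrix with $g$ identical blocks $$\begin{pmatrix}0&p^{\frac{g-1}{2}}\\-p^{\frac{g-1}{2}}&0\end{pmatrix}.$$ (ii) If $g$ is even, there is a basis $e_1,f_1,\dots,e_g,f_g$ of $M_{g-1}$ as a free $W(k)$-module such that $$Fe_i=f_i,\quad Ve_i=f_i,\quad Ff_i=pe_i,\quad Vf_i=pe_i,$$ and the quasi-polarisation $M_{g-1}^t\times M_{g-1}^t\to W(k)$ with respect to the dual basis is given by the block diagonal matrix with $g/2$ identical blocks $$\begin{pmatrix}0&0&p^{\frac g2}&0\\0&0&0&p^{\frac g2-1}\\-p^{\frac g2}&0&0&0\\0&-p^{\frac g2-1}&0&0\end{pmatrix}.$$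
   Context: $k$ is an algebraically closed field of characteristic $p$, $W(k)$ its ring of Witt vectors with Frobenius $\sigma$. A Dieudonné module is a left module over the ring $\mathcal D_k$ generated over $W(k)$ by $F,V$ with $Fw=\sigma(w)F$, $wV=V\sigma(w)$ for $w\in W(k)$, $FV=VF=p$. Here all are free of finite rank over $W(k)$; the genus is half the rank. $A_{1,1}=\mathcal D_k/\mathcal D_k(F-V)$. A Dieudonné module is supersingular (superspecial) if it is the contravariant Dieudonné module of the $p$-divisible group of a supersingular (superspecial) abelian variety, i.e. one isogenous (isomorphic) to a product of supersingular elliptic curves. A quasi-polarised Dieudonné module is a Dieudonné module $M$ with a non-degenerate alternating $W(k)$-bilinear form $\langle\cdot,\cdot\rangle:M\times M\to\mathrm{Frac}(W(k))$ with $\langle Fx,y\rangle=\sigma(\langle x,Vy\rangle)$. The dual module $M^t=\mathrm{Hom}_{W(k)}(M,W(k))$ is identified with $\{y\in M\otimes\mathrm{Frac}(W(k)):\langle M,y\rangle\subseteq W(k)\}$ by sending $b\in M^t$ to the unique $y_b$ with $b(m)=\langle m,y_b\rangle$ for all $m\in M$; in the PFTQ setting $M^t\subseteq M$. The quasi-polarisation on $M^t$ is $\langle a,b\rangle=\langle y_a,y_b\rangle=b(y_a)$. A PFTQ of Dieudonné modules of genus $g$ over $W(k)$ is a filtration $M_{g-1}\supseteq\dots\supseteq M_0$ of quasi-polarised supersingular Dieudonné modules of genus $g$ (forms by restriction) such that (i) $M_{g-1}\cong A_{1,1}^{\oplus g}$ and $M_{g-1}^t=F^{g-1}M_{g-1}$;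 (ii) $(F,V)M_i\subseteq M_{i-1}$ and $\dim_k(M_i/M_{i-1})=i$ for $1\le i\le g-1$; (iii) $F^{i-j}V^jM_i\subseteq M_i^t$ for all $0\le j\le\lfloor i/2\rfloor$. *)

theory Defs
  imports
    "HOL-Library.Poly_Mapping"
    "HOL-Library.Product_Plus"
    "HOL-Library.Function_Algebras"
    "HOL-Computational_Algebra.Computational_Algebra"
    "Jordan_Normal_Form.Matrix"
begin

type_synonym 'v ipoly = "('v \<Rightarrow>\<^sub>0 nat) \<Rightarrow>\<^sub>0 int"

definition ipoly_var :: "'v \<Rightarrow> 'v ipoly" where
  "ipoly_var v = Poly_Mapping.single (Poly_Mapping.single v 1) 1"

definition monom_eval :: "('v \<Rightarrow> 'a::comm_ring_1) \<Rightarrow> ('v \<Rightarrow>\<^sub>0 nat) \<Rightarrow> 'a" where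
  "monom_eval x m = (\<Prod>v\<in>Poly_Mapping.keys m. x v ^ Poly_Mapping.lookup m v)"

definition ipoly_eval :: "('v \<Rightarrow> 'a::comm_ring_1) \<Rightarrow> 'v ipoly \<Rightarrow> 'a" where
  "ipoly_eval x f = (\<Sum>m\<in>Poly_Mapping.keys f. of_int (Poly_Mapping.lookup f m) * monom_eval x m)"

lemma monom_eval_superset:
  assumes "finite K" "Poly_Mapping.keys m \<subseteq> K"
  shows "monom_eval x m = (\<Prod>v\<in>K. x v ^ Poly_Mapping.lookup m v)"
  unfolding monom_eval_def
  by (rule prod.mono_neutral_left) (use assms in \<open>auto simp: in_keys_iff\<close>)

lemma monom_eval_0 [simp]: "monom_eval x 0 = 1"
  by (simp add: monom_eval_def)

lemma monom_eval_add: "monom_eval x (m + n) = monom_eval x m * monom_eval x n"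
proof -
  let ?K = "Poly_Mapping.keys m \<union> Poly_Mapping.keys n"
  have "monom_eval x (m + n) = (\<Prod>v\<in>?K. x v ^ Poly_Mapping.lookup (m + n) v)"
    by (rule monom_eval_superset) (auto simp: Poly_Mapping.keys_add)
  also have "\<dots> = (\<Prod>v\<in>?K. x v ^ Poly_Mapping.lookup m v) * (\<Prod>v\<in>?K. x v ^ Poly_Mapping.lookup n v)"
    by (simp add: lookup_add power_add prod.distrib)
  also have "\<dots> = monom_eval x m * monom_eval x n"
    by (subst (1 2) monom_eval_superset[of ?K]) auto
  finally show ?thesis .
qed

lemma ipoly_eval_superset:
  assumes "finite K" "Poly_Mapping.keys f \<subseteq> K"
  shows "ipoly_eval x f = (\<Sum>m\<in>K. of_int (Poly_Mapping.lookup f m) * monom_eval x m)"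
  unfolding ipoly_eval_def
  by (rule sum.mono_neutral_left) (use assms in \<open>auto simp: in_keys_iff\<close>)

lemma ipoly_eval_0 [simp]: "ipoly_eval x 0 = 0"
  by (simp add: ipoly_eval_def)

lemma ipoly_eval_single: "ipoly_eval x (Poly_Mapping.single m c) = of_int c * monom_eval x m"
  by (subst ipoly_eval_superset[of "{m}"]) auto

lemma ipoly_eval_frag [simp]: "ipoly_eval x (frag_of m) = monom_eval x m"
  by (simp add: ipoly_eval_single)

lemma ipoly_eval_1 [simp]: "ipoly_eval x 1 = 1"
  using ipoly_eval_single[of x 0 1] by simp

lemma ipoly_eval_var [simp]: "ipoly_eval x (ipoly_var v) = x v"
  by (simp add: ipoly_var_def ipoly_eval_single monom_eval_def)

lemma ipoly_eval_add [simp]: "ipoly_eval x (f + g) = ipoly_eval x f + ipoly_eval x g"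
proof -
  let ?K = "Poly_Mapping.keys f \<union> Poly_Mapping.keys g"
  have "ipoly_eval x (f + g) = (\<Sum>m\<in>?K. of_int (Poly_Mapping.lookup (f + g) m) * monom_eval x m)"
    by (rule ipoly_eval_superset) (auto simp: Poly_Mapping.keys_add)
  also have "\<dots> = (\<Sum>m\<in>?K. of_int (Poly_Mapping.lookup f m) * monom_eval x m)
      + (\<Sum>m\<in>?K. of_int (Poly_Mapping.lookup g m) * monom_eval x m)"
    by (simp add: lookup_add ring_distribs sum.distrib)
  also have "\<dots> = ipoly_eval x f + ipoly_eval x g"
    by (subst (1 2) ipoly_eval_superset[of ?K]) auto
  finally show ?thesis .
qed

lemma ipoly_eval_diff [simp]: "ipoly_eval x (f - g) = ipoly_eval x f - ipoly_eval x g"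
  using ipoly_eval_add[of x "f - g" g] by (simp add: algebra_simps)

lemma ipoly_eval_uminus [simp]: "ipoly_eval x (- f) = - ipoly_eval x f"
  using ipoly_eval_diff[of x 0 f] by simp

lemma ipoly_induct [case_names zero monom diff]:
  fixes f :: "'v ipoly"
  assumes "P 0" "\<And>m. P (frag_of m)" "\<And>f g. P f \<Longrightarrow> P g \<Longrightarrow> P (f - g)"
  shows "P f"
  by (rule frag_induction[of f UNIV P]) (use assms in auto)

lemma frag_of_mult:
  "frag_of m * frag_of n = (frag_of (m + n) :: 'a::monoid_add \<Rightarrow>\<^sub>0 int)"
  by (simp add: mult_single)

lemma ipoly_eval_mult [simp]: "ipoly_eval x (f * g) = ipoly_eval x f * ipoly_eval x g"
proof (induction f rule: ipoly_induct)
  case (monom m)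
  show ?case
    by (induction g rule: ipoly_induct)
      (simp_all add: frag_of_mult monom_eval_add algebra_simps)
qed (simp_all add: algebra_simps)

lemma ipoly_eval_power [simp]: "ipoly_eval x (f ^ n) = ipoly_eval x f ^ n"
  by (induction n) simp_all

lemma ipoly_eval_sum [simp]: "ipoly_eval x (sum h A) = (\<Sum>a\<in>A. ipoly_eval x (h a))"
  by (induction A rule: infinite_finite_induct) simp_all

lemma ipoly_eval_prod [simp]: "ipoly_eval x (prod h A) = (\<Prod>a\<in>A. ipoly_eval x (h a))"
  by (induction A rule: infinite_finite_induct) simp_all

lemma ipoly_eval_of_nat [simp]: "ipoly_eval x (of_nat n) = of_nat n"
  by (induction n) simp_all

lemma ipoly_eval_eval:
  "ipoly_eval x (ipoly_eval s f) = ipoly_eval (\<lambda>v. ipoly_eval x (s v)) f"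
  by (induction f rule: ipoly_induct) (simp_all add: monom_eval_def)

lemma monom_eval_var: "monom_eval ipoly_var m = (frag_of m :: 'v ipoly)"
proof (induction m rule: update_induct)
  case const
  show ?case by simp
next
  case (update f a b)
  have *: "monom_eval ipoly_var (Poly_Mapping.single a b) = (frag_of (Poly_Mapping.single a b) :: 'v ipoly)"
  proof -
    have "(ipoly_var a :: 'v ipoly) ^ b = frag_of (Poly_Mapping.single a b)"
      by (induction b) (simp_all add: ipoly_var_def mult_single flip: single_add)
    thus ?thesis
      by (subst monom_eval_superset[of "{a}"]) auto
  qed
  have "Poly_Mapping.update a b f = f + Poly_Mapping.single a b"
    using update by (intro poly_mapping_eqI)
      (auto simp: lookup_update lookup_add lookup_single in_keys_iff when_def)
  with update * show ?case by (simp add: monom_eval_add frag_of_mult)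
qed

lemma ipoly_eval_id [simp]: "ipoly_eval ipoly_var f = f"
  by (induction f rule: ipoly_induct) (simp_all add: monom_eval_var)

lemma lookup_of_nat_mult:
  "Poly_Mapping.lookup (of_nat c * (f :: 'v ipoly)) m = int c * Poly_Mapping.lookup f m"
  by (induction c) (simp_all add: algebra_simps lookup_add)

lemma ipoly_of_nat_cancel:
  assumes "of_nat c * (f :: 'v ipoly) = of_nat c * g" "c \<noteq> 0"
  shows "f = g"
proof (rule poly_mapping_eqI)
  fix m
  have "int c * Poly_Mapping.lookup f m = int c * Poly_Mapping.lookup g m"
    by (metis assms(1) lookup_of_nat_mult)
  thus "Poly_Mapping.lookup f m = Poly_Mapping.lookup g m" using assms(2) by simp
qed

lemma ipoly_of_nat_power_cancel:
  assumes "of_nat c ^ n * (f :: 'v ipoly) = of_nat c ^ n * g" "c \<noteq> 0"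
  shows "f = g"
  using ipoly_of_nat_cancel[of "c ^ n" f g] assms by simp

definition ghost :: "nat \<Rightarrow> nat \<Rightarrow> (nat \<Rightarrow> 'a::comm_ring_1) \<Rightarrow> 'a" where
  "ghost p n x = (\<Sum>i\<le>n. of_nat p ^ i * x i ^ (p ^ (n - i)))"

lemma ghost_inj:
  fixes s t :: "nat \<Rightarrow> 'v ipoly"
  assumes "p \<noteq> 0" "\<And>n. ghost p n s = ghost p n t"
  shows "s = t"
proof
  fix n show "s n = t n"
  proof (induction n rule: less_induct)
    case (less n)
    have *: "ghost p n u = of_nat p ^ n * u n + (\<Sum>i<n. of_nat p ^ i * u i ^ (p ^ (n - i)))"
      for u :: "nat \<Rightarrow> 'v ipoly"
      by (simp add: ghost_def flip: lessThan_Suc_atMost)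
    have "(\<Sum>i<n. of_nat p ^ i * s i ^ (p ^ (n - i))) = (\<Sum>i<n. of_nat p ^ i * t i ^ (p ^ (n - i)))"
      using less by (intro sum.cong) auto
    with assms(2)[of n] have "of_nat p ^ n * s n = of_nat p ^ n * t n" by (simp add: *)
    thus ?case using assms(1) ipoly_of_nat_power_cancel by blast
  qed
qed

lemma prime_dvd_binomial_power:
  fixes a b :: "'a::comm_ring_1"
  assumes "prime p"
  shows "of_nat p dvd (a + b) ^ p - a ^ p - b ^ p"
proof -
  have p: "p > 0" using assms prime_gt_0_nat by blast
  have "(a + b) ^ p = (\<Sum>k\<le>p. of_nat (p choose k) * a ^ k * b ^ (p - k))"
    by (rule binomial_ring)
  also have "{..p} = insert 0 (insert p {0<..<p})" using p by auto
  also have "(\<Sum>k\<in>\<dots>. of_nat (p choose k) * a ^ k * b ^ (p - k)) =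
      b ^ p + (a ^ p + (\<Sum>k\<in>{0<..<p}. of_nat (p choose k) * a ^ k * b ^ (p - k)))"
    using p by simp
  finally have "(a + b) ^ p - a ^ p - b ^ p =
      (\<Sum>k\<in>{0<..<p}. of_nat (p choose k) * a ^ k * b ^ (p - k))" by simp
  moreover have "of_nat p dvd (of_nat (p choose k) * a ^ k * b ^ (p - k) :: 'a)"
    if "k \<in> {0<..<p}" for k
  proof -
    have "p dvd (p choose k)" using that assms by (intro dvd_choose_prime) auto
    then obtain q where "p choose k = p * q" by (elim dvdE)
    thus ?thesis by (simp add: mult.assoc)
  qed
  ultimately show ?thesis by (auto intro!: dvd_sum)
qed

lemma power_prime_cong:
  fixes a b :: "'a::comm_ring_1"
  assumes "of_nat p ^ Suc k dvd a - b"
  shows "of_nat p ^ Suc (Suc k) dvd a ^ p - b ^ p"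
proof -
  have "(of_nat p :: 'a) dvd of_nat p ^ Suc k" by simp
  with assms have ab: "of_nat p dvd a - b" by (rule dvd_trans[rotated])
  have eq: "a ^ p - b ^ p = (a - b) * (\<Sum>i<p. b ^ (p - Suc i) * a ^ i)"
    by (rule power_diff_sumr2)
  have "of_nat p dvd (\<Sum>i<p. b ^ (p - Suc i) * a ^ i)"
  proof -
    have "of_nat p dvd b ^ (p - Suc i) * (a ^ i - b ^ i)" for i
      using ab by (metis dvd_mult dvd_trans dvd_triv_left power_diff_sumr2)
    hence "of_nat p dvd (\<Sum>i<p. b ^ (p - Suc i) * (a ^ i - b ^ i))"
      by (intro dvd_sum) auto
    also have "(\<Sum>i<p. b ^ (p - Suc i) * (a ^ i - b ^ i)) =
        (\<Sum>i<p. b ^ (p - Suc i) * a ^ i - b ^ (p - 1))"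
      by (intro sum.cong) (auto simp: right_diff_distrib simp flip: power_add)
    also have "\<dots> = (\<Sum>i<p. b ^ (p - Suc i) * a ^ i) - of_nat p * b ^ (p - 1)"
      by (simp add: sum_subtractf)
    finally show ?thesis by (metis diff_add_cancel dvd_add dvd_triv_left)
  qed
  from mult_dvd_mono[OF assms this] show ?thesis
    by (simp add: eq mult_ac)
qed

lemma power_prime_power_cong:
  fixes a b :: "'a::comm_ring_1"
  assumes "of_nat p dvd a - b"
  shows "of_nat p ^ Suc k dvd a ^ (p ^ k) - b ^ (p ^ k)"
proof (induction k)
  case 0
  thus ?case using assms by simp
next
  case (Suc k)
  have *: "c ^ (p ^ Suc k) = (c ^ (p ^ k)) ^ p" for c :: 'a
    by (simp add: mult.commute flip: power_mult)
  from power_prime_cong[OF Suc.IH] show ?case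
    by (simp only: *)
qed

lemma ipoly_frobenius_cong:
  fixes f :: "'v ipoly"
  assumes p: "prime p"
  shows "of_nat p dvd f ^ p - ipoly_eval (\<lambda>v. ipoly_var v ^ p) f"
proof (induction f rule: ipoly_induct)
  case zero
  show ?case using p by (simp add: prime_gt_0_nat power_0_left)
next
  case (monom m)
  have "monom_eval (\<lambda>v. ipoly_var v ^ p) m = (monom_eval ipoly_var m :: 'v ipoly) ^ p"
    by (simp add: monom_eval_def prod_power_distrib mult.commute flip: power_mult)
  thus ?case by (simp add: monom_eval_var)
next
  case (diff f g)
  let ?\<psi> = "ipoly_eval (\<lambda>v. ipoly_var v ^ p) :: 'v ipoly \<Rightarrow> _"
  have "of_nat p dvd ((f - g) + g) ^ p - (f - g) ^ p - g ^ p"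
    by (rule prime_dvd_binomial_power[OF p])
  from dvd_diff[OF dvd_diff[OF diff.IH] this] show ?case
    by (simp add: algebra_simps)
qed

lemma ghost_Suc_cong:
  fixes s :: "nat \<Rightarrow> 'v ipoly"
  assumes p: "prime p"
  shows "of_nat p ^ Suc n dvd ghost p (Suc n) s - ipoly_eval (\<lambda>v. ipoly_var v ^ p) (ghost p n s)"
proof -
  let ?\<psi> = "ipoly_eval (\<lambda>v. ipoly_var v ^ p) :: 'v ipoly \<Rightarrow> _"
  have "ghost p (Suc n) s - ?\<psi> (ghost p n s) = of_nat p ^ Suc n * s (Suc n) +
      (\<Sum>i\<le>n. of_nat p ^ i * ((s i ^ p) ^ (p ^ (n - i)) - ?\<psi> (s i) ^ (p ^ (n - i))))"
    by (simp add: ghost_def Suc_diff_le algebra_simps sum_subtractf flip: power_mult)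
  moreover have "of_nat p ^ Suc n dvd
      of_nat p ^ i * ((s i ^ p) ^ (p ^ (n - i)) - ?\<psi> (s i) ^ (p ^ (n - i)))" if "i \<le> n" for i
  proof -
    have "of_nat p ^ Suc n = of_nat p ^ i * (of_nat p ^ Suc (n - i) :: 'v ipoly)"
      using that by (metis Suc_diff_le add_diff_cancel_left' le_Suc_eq le_add_diff_inverse power_add)
    thus ?thesis
      using power_prime_power_cong[OF ipoly_frobenius_cong[OF p, of "s i"]]
      by (metis dvd_refl mult_dvd_mono)
  qed
  ultimately show ?thesis by (auto intro!: dvd_add dvd_sum)
qed

lemma dwork:
  fixes \<phi> :: "nat \<Rightarrow> 'v ipoly"
  assumes p: "prime p"
    and cong: "\<And>n. of_nat p ^ Suc n dvd \<phi> (Suc n) - ipoly_eval (\<lambda>v. ipoly_var v ^ p) (\<phi> n)"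
  shows "\<exists>s. \<forall>n. ghost p n s = \<phi> n"
proof -
  let ?\<psi> = "ipoly_eval (\<lambda>v. ipoly_var v ^ p) :: 'v ipoly \<Rightarrow> _"
  have ext: "\<exists>s'. (\<forall>k\<le>Suc n. ghost p k s' = \<phi> k) \<and> (\<forall>k\<le>n. s' k = s k)"
    if s: "\<forall>k\<le>n. ghost p k s = \<phi> k" for s n
  proof -
    let ?s0 = "s(Suc n := 0)"
    have g0: "ghost p k (s(Suc n := t)) = \<phi> k" if "k \<le> n" for k t
      using s that by (auto simp: ghost_def)
    have gS: "ghost p (Suc n) (s(Suc n := t)) = ghost p (Suc n) ?s0 + of_nat p ^ Suc n * t" for t
      by (auto simp: ghost_def intro!: sum.cong)
    have "of_nat p ^ Suc n dvd ghost p (Suc n) ?s0 - ?\<psi> (\<phi> n)"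
      using ghost_Suc_cong[OF p, of n ?s0] g0[of n 0] by simp
    from dvd_diff[OF cong[of n] this]
    obtain t where "\<phi> (Suc n) - ghost p (Suc n) ?s0 = of_nat p ^ Suc n * t"
      by (auto elim!: dvdE)
    hence "ghost p (Suc n) (s(Suc n := t)) = \<phi> (Suc n)"
      using gS[of t] by (simp add: algebra_simps)
    thus ?thesis using g0 by (intro exI[of _ "s(Suc n := t)"]) (auto simp: le_Suc_eq)
  qed
  have "\<exists>f. \<forall>n. (\<forall>k\<le>n. ghost p k (f n) = \<phi> k) \<and> (\<forall>k\<le>n. f (Suc n) k = (f n k :: 'v ipoly))"
  proof (rule dependent_nat_choice)
    show "\<exists>s. \<forall>k\<le>0. ghost p k s = \<phi> k"
      by (intro exI[of _ "\<lambda>_. \<phi> 0"]) (auto simp: ghost_def)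
  qed (use ext in auto)
  then obtain f where f: "\<And>n k. k \<le> n \<Longrightarrow> ghost p k (f n) = \<phi> k"
    "\<And>n k. k \<le> n \<Longrightarrow> f (Suc n) k = f n k" by blast
  have stab: "f n k = f k k" if "k \<le> n" for n k
    using that
  proof (induction n rule: dec_induct)
    case (step n)
    show ?case by (rule trans[OF f(2)[OF step.hyps(1)] step.IH])
  qed (rule refl)
  have "ghost p n (\<lambda>k. f k k) = \<phi> n" for n
  proof -
    have "ghost p n (\<lambda>k. f k k) = ghost p n (f n)"
      unfolding ghost_def
    proof (rule sum.cong)
      fix i assume "i \<in> {..n}"
      hence "f n i = f i i" by (intro stab) simp
      thus "of_nat p ^ i * f i i ^ (p ^ (n - i)) = of_nat p ^ i * f n i ^ (p ^ (n - i))"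
        by (simp only:)
    qed simp
    also have "\<dots> = \<phi> n" by (rule f(1)) simp
    finally show ?thesis .
  qed
  thus ?thesis by blast
qed

text \<open>By \<open>dwork\<close> and \<open>ghost_inj\<close> the description is proper for the sum, product and negation
  polynomials of Witt vectors.\<close>

definition witt_polys :: "nat \<Rightarrow> (nat \<Rightarrow> 'v ipoly) \<Rightarrow> nat \<Rightarrow> 'v ipoly" where
  "witt_polys p \<phi> = (THE s. \<forall>n. ghost p n s = \<phi> n)"

definition witt_add_polys :: "nat \<Rightarrow> nat \<Rightarrow> (nat + nat) ipoly" where
  "witt_add_polys p = witt_polys p
     (\<lambda>n. ghost p n (\<lambda>i. ipoly_var (Inl i)) + ghost p n (\<lambda>i. ipoly_var (Inr i)))"

definition witt_mult_polys :: "nat \<Rightarrow> nat \<Rightarrow> (nat + nat) ipoly" where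
  "witt_mult_polys p = witt_polys p
     (\<lambda>n. ghost p n (\<lambda>i. ipoly_var (Inl i)) * ghost p n (\<lambda>i. ipoly_var (Inr i)))"

definition witt_neg_polys :: "nat \<Rightarrow> nat \<Rightarrow> nat ipoly" where
  "witt_neg_polys p = witt_polys p (\<lambda>n. - ghost p n ipoly_var)"

lemma witt_polys:
  fixes \<phi> :: "nat \<Rightarrow> 'v ipoly"
  assumes p: "prime p"
    and "\<And>n. of_nat p ^ Suc n dvd \<phi> (Suc n) - ipoly_eval (\<lambda>v. ipoly_var v ^ p) (\<phi> n)"
  shows "ghost p n (witt_polys p \<phi>) = \<phi> n"
proof -
  obtain s where s: "\<forall>n. ghost p n s = \<phi> n" using dwork[OF assms] by blast
  have "witt_polys p \<phi> = s" unfolding witt_polys_def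
    by (rule the_equality) (use s p in \<open>auto intro!: ghost_inj[of p] simp: prime_gt_0_nat\<close>)
  thus ?thesis using s by simp
qed

lemma cong_mult_ring:
  fixes a b c d :: "'a::comm_ring_1"
  assumes "m dvd a - b" "m dvd c - d"
  shows "m dvd a * c - b * d"
proof -
  have "a * c - b * d = (a - b) * c + b * (c - d)" by (simp add: algebra_simps)
  thus ?thesis using assms by simp
qed

lemma ghost_witt_add_polys:
  assumes p: "prime p"
  shows "ghost p n (witt_add_polys p) =
    ghost p n (\<lambda>i. ipoly_var (Inl i)) + ghost p n (\<lambda>i. ipoly_var (Inr i))"
  unfolding witt_add_polys_def
proof (rule witt_polys[OF p])
  fix n
  show "of_nat p ^ Suc n dvd
      ghost p (Suc n) (\<lambda>i. ipoly_var (Inl i)) + ghost p (Suc n) (\<lambda>i. ipoly_var (Inr i)) -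
      ipoly_eval (\<lambda>v::nat+nat. ipoly_var v ^ p)
        (ghost p n (\<lambda>i. ipoly_var (Inl i)) + ghost p n (\<lambda>i. ipoly_var (Inr i)))"
    using dvd_add[OF ghost_Suc_cong[OF p, of n "\<lambda>i. ipoly_var (Inl i)"]
        ghost_Suc_cong[OF p, of n "\<lambda>i. ipoly_var (Inr i)"]]
    by (simp only: ipoly_eval_add algebra_simps)
qed

lemma ghost_witt_mult_polys:
  assumes p: "prime p"
  shows "ghost p n (witt_mult_polys p) =
    ghost p n (\<lambda>i. ipoly_var (Inl i)) * ghost p n (\<lambda>i. ipoly_var (Inr i))"
  unfolding witt_mult_polys_def
  by (rule witt_polys[OF p])
    (simp only: ipoly_eval_mult, intro cong_mult_ring ghost_Suc_cong[OF p])

lemma ghost_witt_neg_polys: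
  assumes p: "prime p"
  shows "ghost p n (witt_neg_polys p) = - ghost p n ipoly_var"
  unfolding witt_neg_polys_def
proof (rule witt_polys[OF p])
  fix n
  let ?\<psi> = "ipoly_eval (\<lambda>v::nat. ipoly_var v ^ p)"
  have "- ghost p (Suc n) ipoly_var - ?\<psi> (- ghost p n ipoly_var) =
      - (ghost p (Suc n) ipoly_var - ?\<psi> (ghost p n ipoly_var))"
    by (simp only: ipoly_eval_uminus) simp
  thus "of_nat p ^ Suc n dvd - ghost p (Suc n) ipoly_var - ?\<psi> (- ghost p n ipoly_var)"
    using ghost_Suc_cong[OF p, of n ipoly_var] by (simp only: dvd_minus_iff)
qed

lemma ghost_eval:
  "ghost p n (\<lambda>i. ipoly_eval x (s i)) = ipoly_eval x (ghost p n s)"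
  by (simp add: ghost_def)

text \<open>In the class \<open>comm_ring_prime_char\<close> the characteristic \<open>CHAR('k)\<close> is a prime; it is the
  prime of the Witt vectors over \<open>'k\<close>.\<close>

datatype 'k witt = Witt (wcoeff: "nat \<Rightarrow> 'k")

lemma witt_eqI: "(\<And>n. wcoeff x n = wcoeff y n) \<Longrightarrow> x = y"
  by (cases x; cases y) auto

instantiation witt :: (comm_ring_prime_char) "{zero, one, plus, minus, uminus, times}"
begin

definition "0 = Witt (\<lambda>n. 0 :: 'a)"

definition "1 = Witt (\<lambda>n. if n = 0 then 1 else 0 :: 'a)"

definition "x + y = Witt (\<lambda>n. ipoly_eval (case_sum (wcoeff x) (wcoeff y))
                                 (witt_add_polys CHAR('a) n) :: 'a)"

definition "x * y = Witt (\<lambda>n. ipoly_eval (case_sum (wcoeff x) (wcoeff y))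
                                 (witt_mult_polys CHAR('a) n) :: 'a)"

definition "- x = Witt (\<lambda>n. ipoly_eval (wcoeff x) (witt_neg_polys CHAR('a) n) :: 'a)"

definition "x - y = x + - (y :: 'a witt)"

instance ..

end

context
  fixes e :: "'v \<Rightarrow> 'k::comm_ring_prime_char"
begin

private definition "\<Phi> s = Witt (\<lambda>n. ipoly_eval e (s n))"

private definition "gh n s = ghost CHAR('k) n (s :: nat \<Rightarrow> 'v ipoly)"

private lemma p: "prime CHAR('k)"
  using CHAR_pos CHAR_prime by blast

private lemma gh_inj: "(\<And>n. gh n s = gh n t) \<Longrightarrow> s = t"
  using p by (intro ghost_inj[of "CHAR('k)"]) (auto simp: gh_def)

private lemma add_ex: "\<exists>u. (\<forall>n. gh n u = gh n s + gh n t) \<and> \<Phi> u = \<Phi> s + \<Phi> t"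
proof (intro exI conjI allI)
  let ?u = "\<lambda>i. ipoly_eval (case_sum s t) (witt_add_polys CHAR('k) i)"
  show "gh n ?u = gh n s + gh n t" for n
    unfolding gh_def ghost_eval ghost_witt_add_polys[OF p] ipoly_eval_add
    by (simp flip: ghost_eval)
  have *: "(\<lambda>v. ipoly_eval e (case_sum s t v)) =
      case_sum (\<lambda>n. ipoly_eval e (s n)) (\<lambda>n. ipoly_eval e (t n))"
    by (auto simp: fun_eq_iff split: sum.splits)
  show "\<Phi> ?u = \<Phi> s + \<Phi> t"
    by (simp add: \<Phi>_def plus_witt_def ipoly_eval_eval *)
qed

private lemma mult_ex: "\<exists>u. (\<forall>n. gh n u = gh n s * gh n t) \<and> \<Phi> u = \<Phi> s * \<Phi> t"
proof (intro exI conjI allI)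
  let ?u = "\<lambda>i. ipoly_eval (case_sum s t) (witt_mult_polys CHAR('k) i)"
  show "gh n ?u = gh n s * gh n t" for n
    unfolding gh_def ghost_eval ghost_witt_mult_polys[OF p] ipoly_eval_mult
    by (simp flip: ghost_eval)
  have *: "(\<lambda>v. ipoly_eval e (case_sum s t v)) =
      case_sum (\<lambda>n. ipoly_eval e (s n)) (\<lambda>n. ipoly_eval e (t n))"
    by (auto simp: fun_eq_iff split: sum.splits)
  show "\<Phi> ?u = \<Phi> s * \<Phi> t"
    by (simp add: \<Phi>_def times_witt_def ipoly_eval_eval *)
qed

private lemma neg_ex: "\<exists>u. (\<forall>n. gh n u = - gh n s) \<and> \<Phi> u = - \<Phi> s"
proof (intro exI conjI allI)
  let ?u = "\<lambda>i. ipoly_eval s (witt_neg_polys CHAR('k) i)"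
  show "gh n ?u = - gh n s" for n
    unfolding gh_def ghost_eval ghost_witt_neg_polys[OF p] ipoly_eval_uminus
    by (simp flip: ghost_eval)
  show "\<Phi> ?u = - \<Phi> s"
    by (simp add: \<Phi>_def uminus_witt_def ipoly_eval_eval)
qed

private lemma zero_ex: "\<exists>u. (\<forall>n. gh n u = 0) \<and> \<Phi> u = 0"
  by (intro exI[of _ "\<lambda>_. 0"])
    (use p in \<open>auto simp: gh_def ghost_def \<Phi>_def zero_witt_def power_0_left\<close>)

private lemma one_ex: "\<exists>u. (\<forall>n. gh n u = 1) \<and> \<Phi> u = 1"
proof (intro exI conjI allI)
  let ?u = "\<lambda>n. if n = 0 then 1 else 0 :: 'v ipoly"
  show "gh n ?u = 1" for n
  proof -
    have "gh n ?u = (\<Sum>i\<le>n. if i = 0 then 1 else 0)"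
      unfolding gh_def ghost_def by (intro sum.cong) (use p in \<open>auto simp: power_0_left\<close>)
    thus ?thesis by simp
  qed
  show "\<Phi> ?u = 1" by (auto simp: \<Phi>_def one_witt_def fun_eq_iff)
qed

lemma witt_ring_laws:
  fixes s t u :: "nat \<Rightarrow> 'v"
  defines "x \<equiv> Witt (\<lambda>n. e (s n))" and "y \<equiv> Witt (\<lambda>n. e (t n))" and "z \<equiv> Witt (\<lambda>n. e (u n))"
  shows "x + y + z = x + (y + z)" "x + y = y + x" "0 + x = x" "- x + x = 0"
    "x * y * z = x * (y * z)" "x * y = y * x" "1 * x = x" "(x + y) * z = x * z + y * z"
proof -
  define X Y Z where "X = (\<lambda>n. ipoly_var (s n))" and "Y = (\<lambda>n. ipoly_var (t n))"
    and "Z = (\<lambda>n. ipoly_var (u n))"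
  have \<Phi>: "x = \<Phi> X" "y = \<Phi> Y" "z = \<Phi> Z"
    by (auto simp: x_def y_def z_def X_def Y_def Z_def \<Phi>_def)
  show "x + y + z = x + (y + z)"
  proof -
    obtain a where a: "\<And>n. gh n a = gh n X + gh n Y" "\<Phi> a = \<Phi> X + \<Phi> Y" using add_ex by metis
    obtain b where b: "\<And>n. gh n b = gh n a + gh n Z" "\<Phi> b = \<Phi> a + \<Phi> Z" using add_ex by metis
    obtain c where c: "\<And>n. gh n c = gh n Y + gh n Z" "\<Phi> c = \<Phi> Y + \<Phi> Z" using add_ex by metis
    obtain d where d: "\<And>n. gh n d = gh n X + gh n c" "\<Phi> d = \<Phi> X + \<Phi> c" using add_ex by metis
    have "b = d" by (rule gh_inj) (simp add: a b c d add.assoc)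
    thus ?thesis using a b c d by (simp add: \<Phi>)
  qed
  show "x + y = y + x"
  proof -
    obtain a where a: "\<And>n. gh n a = gh n X + gh n Y" "\<Phi> a = \<Phi> X + \<Phi> Y" using add_ex by metis
    obtain b where b: "\<And>n. gh n b = gh n Y + gh n X" "\<Phi> b = \<Phi> Y + \<Phi> X" using add_ex by metis
    have "a = b" by (rule gh_inj) (simp add: a b add.commute)
    thus ?thesis using a b by (simp add: \<Phi>)
  qed
  show "0 + x = x"
  proof -
    obtain a where a: "\<And>n. gh n a = 0" "\<Phi> a = 0" using zero_ex by metis
    obtain b where b: "\<And>n. gh n b = gh n a + gh n X" "\<Phi> b = \<Phi> a + \<Phi> X" using add_ex by metis
    have "b = X" by (rule gh_inj) (simp add: a b)
    thus ?thesis using a b by (simp add: \<Phi>)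
  qed
  show "- x + x = 0"
  proof -
    obtain w where w: "\<And>n. gh n w = 0" "\<Phi> w = 0" using zero_ex by metis
    obtain a where a: "\<And>n. gh n a = - gh n X" "\<Phi> a = - \<Phi> X" using neg_ex by metis
    obtain b where b: "\<And>n. gh n b = gh n a + gh n X" "\<Phi> b = \<Phi> a + \<Phi> X" using add_ex by metis
    have "b = w" by (rule gh_inj) (simp add: a b w)
    thus ?thesis using a b w by (simp add: \<Phi>)
  qed
  show "x * y * z = x * (y * z)"
  proof -
    obtain a where a: "\<And>n. gh n a = gh n X * gh n Y" "\<Phi> a = \<Phi> X * \<Phi> Y" using mult_ex by metis
    obtain b where b: "\<And>n. gh n b = gh n a * gh n Z" "\<Phi> b = \<Phi> a * \<Phi> Z" using mult_ex by metis
    obtain c where c: "\<And>n. gh n c = gh n Y * gh n Z" "\<Phi> c = \<Phi> Y * \<Phi> Z" using mult_ex by metis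
    obtain d where d: "\<And>n. gh n d = gh n X * gh n c" "\<Phi> d = \<Phi> X * \<Phi> c" using mult_ex by metis
    have "b = d" by (rule gh_inj) (simp add: a b c d mult.assoc)
    thus ?thesis using a b c d by (simp add: \<Phi>)
  qed
  show "x * y = y * x"
  proof -
    obtain a where a: "\<And>n. gh n a = gh n X * gh n Y" "\<Phi> a = \<Phi> X * \<Phi> Y" using mult_ex by metis
    obtain b where b: "\<And>n. gh n b = gh n Y * gh n X" "\<Phi> b = \<Phi> Y * \<Phi> X" using mult_ex by metis
    have "a = b" by (rule gh_inj) (simp add: a b mult.commute)
    thus ?thesis using a b by (simp add: \<Phi>)
  qed
  show "1 * x = x"
  proof -
    obtain a where a: "\<And>n. gh n a = 1" "\<Phi> a = 1" using one_ex by metis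
    obtain b where b: "\<And>n. gh n b = gh n a * gh n X" "\<Phi> b = \<Phi> a * \<Phi> X" using mult_ex by metis
    have "b = X" by (rule gh_inj) (simp add: a b)
    thus ?thesis using a b by (simp add: \<Phi>)
  qed
  show "(x + y) * z = x * z + y * z"
  proof -
    obtain a where a: "\<And>n. gh n a = gh n X + gh n Y" "\<Phi> a = \<Phi> X + \<Phi> Y" using add_ex by metis
    obtain b where b: "\<And>n. gh n b = gh n a * gh n Z" "\<Phi> b = \<Phi> a * \<Phi> Z" using mult_ex by metis
    obtain c where c: "\<And>n. gh n c = gh n X * gh n Z" "\<Phi> c = \<Phi> X * \<Phi> Z" using mult_ex by metis
    obtain d where d: "\<And>n. gh n d = gh n Y * gh n Z" "\<Phi> d = \<Phi> Y * \<Phi> Z" using mult_ex by metis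
    obtain f where f: "\<And>n. gh n f = gh n c + gh n d" "\<Phi> f = \<Phi> c + \<Phi> d" using add_ex by metis
    have "b = f" by (rule gh_inj) (simp add: a b c d f ring_distribs)
    thus ?thesis using a b c d f by (simp add: \<Phi>)
  qed
qed

lemma witt_mult_verschiebung_aux:
  fixes s t :: "nat \<Rightarrow> 'v"
  shows "Witt (\<lambda>n. e (s n)) * Witt (\<lambda>n. case n of 0 \<Rightarrow> 0 | Suc m \<Rightarrow> e (t m)) =
    Witt (\<lambda>n. case n of 0 \<Rightarrow> 0 | Suc m \<Rightarrow>
      wcoeff (Witt (\<lambda>n. e (s n) ^ CHAR('k)) * Witt (\<lambda>n. e (t n))) m)"
proof -
  let ?p = "CHAR('k)"
  have p0: "?p \<noteq> 0" using p by auto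
  define X Y where "X = (\<lambda>n. ipoly_var (s n))" and "Y = (\<lambda>n. ipoly_var (t n))"
  define S where "S = (\<lambda>(x :: nat \<Rightarrow> 'v ipoly) n. case n of 0 \<Rightarrow> 0 | Suc m \<Rightarrow> x m)"
  have gS0: "gh 0 (S x) = 0" for x by (simp add: gh_def ghost_def S_def)
  have gS: "gh (Suc n) (S x) = of_nat ?p * gh n x" for n x
    unfolding gh_def ghost_def using p0
    by (subst sum.atMost_Suc_shift) (simp add: S_def sum_distrib_left power_0_left mult.assoc)
  have "\<exists>z. \<forall>n. ghost ?p n z = gh (Suc n) X"
  proof (rule dwork[OF p])
    fix n
    have "of_nat ?p ^ Suc n dvd (of_nat ?p ^ Suc (Suc n) :: 'v ipoly)" by simp
    also have "\<dots> dvd gh (Suc (Suc n)) X - ipoly_eval (\<lambda>v. ipoly_var v ^ ?p) (gh (Suc n) X)"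
      unfolding gh_def by (rule ghost_Suc_cong[OF p])
    finally show "of_nat ?p ^ Suc n dvd
        gh (Suc (Suc n)) X - ipoly_eval (\<lambda>v. ipoly_var v ^ ?p) (gh (Suc n) X)" .
  qed
  then obtain z where z: "\<And>n. gh n z = gh (Suc n) X" by (auto simp: gh_def)
  have zc: "of_nat ?p dvd z n - X n ^ ?p" for n
  proof (induction n rule: less_induct)
    case (less n)
    have "gh (Suc n) X = of_nat ?p ^ Suc n * X (Suc n) + (\<Sum>i\<le>n. of_nat ?p ^ i * (X i ^ ?p) ^ (?p ^ (n - i)))"
      by (simp add: gh_def ghost_def Suc_diff_le flip: power_mult)
    also have "(\<Sum>i\<le>n. of_nat ?p ^ i * (X i ^ ?p) ^ (?p ^ (n - i))) =
        of_nat ?p ^ n * X n ^ ?p + (\<Sum>i<n. of_nat ?p ^ i * (X i ^ ?p) ^ (?p ^ (n - i)))"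
      by (simp flip: lessThan_Suc_atMost)
    finally have 1: "gh (Suc n) X = of_nat ?p ^ Suc n * X (Suc n) + (of_nat ?p ^ n * X n ^ ?p
        + (\<Sum>i<n. of_nat ?p ^ i * (X i ^ ?p) ^ (?p ^ (n - i))))" .
    have 2: "gh n z = of_nat ?p ^ n * z n + (\<Sum>i<n. of_nat ?p ^ i * z i ^ (?p ^ (n - i)))"
      by (simp add: gh_def ghost_def flip: lessThan_Suc_atMost)
    have "of_nat ?p ^ Suc n dvd
        (\<Sum>i<n. of_nat ?p ^ i * (z i ^ (?p ^ (n - i)) - (X i ^ ?p) ^ (?p ^ (n - i))))"
    proof (rule dvd_sum)
      fix i assume "i \<in> {..<n}"
      hence i: "i < n" by simp
      have "of_nat ?p ^ Suc n = of_nat ?p ^ i * (of_nat ?p ^ Suc (n - i) :: 'v ipoly)"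
        using i by (metis Suc_diff_le add_diff_cancel_left' le_Suc_eq le_add_diff_inverse
            less_imp_le_nat power_add)
      thus "of_nat ?p ^ Suc n dvd
          of_nat ?p ^ i * (z i ^ (?p ^ (n - i)) - (X i ^ ?p) ^ (?p ^ (n - i)))"
        using power_prime_power_cong[OF less(1)[OF i]] by (metis dvd_refl mult_dvd_mono)
    qed
    then obtain c where "(\<Sum>i<n. of_nat ?p ^ i * (z i ^ (?p ^ (n - i)) - (X i ^ ?p) ^ (?p ^ (n - i))))
        = of_nat ?p ^ Suc n * c" by (elim dvdE)
    hence "of_nat ?p ^ n * (z n - X n ^ ?p) = of_nat ?p ^ n * (of_nat ?p * (X (Suc n) - c))"
      using z[of n] 1 2 by (simp add: algebra_simps sum_subtractf)
    from ipoly_of_nat_power_cancel[OF this p0] show ?case by simp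
  qed
  have \<Phi>z: "\<Phi> z = Witt (\<lambda>n. e (s n) ^ ?p)"
  proof (rule witt_eqI)
    fix n
    from zc[of n] obtain c where "z n - X n ^ ?p = of_nat ?p * c" by (elim dvdE)
    hence "ipoly_eval e (z n - X n ^ ?p) = ipoly_eval e (of_nat ?p * c)" by simp
    thus "wcoeff (\<Phi> z) n = wcoeff (Witt (\<lambda>n. e (s n) ^ ?p)) n"
      by (simp add: \<Phi>_def X_def)
  qed
  obtain a where a: "\<And>n. gh n a = gh n X * gh n (S Y)" "\<Phi> a = \<Phi> X * \<Phi> (S Y)"
    using mult_ex by metis
  obtain b where b: "\<And>n. gh n b = gh n z * gh n Y" "\<Phi> b = \<Phi> z * \<Phi> Y" using mult_ex by metis
  have "a = S b"
  proof (rule gh_inj)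
    fix n show "gh n a = gh n (S b)"
      by (cases n) (simp_all add: a b gS0 gS z mult_ac)
  qed
  hence 1: "\<Phi> X * \<Phi> (S Y) = \<Phi> (S b)" using a by simp
  have 2: "\<Phi> (S Y) = Witt (\<lambda>n. case n of 0 \<Rightarrow> 0 | Suc m \<Rightarrow> e (t m))"
    by (auto simp: \<Phi>_def S_def Y_def fun_eq_iff split: nat.splits)
  have 3: "\<Phi> (S b) = Witt (\<lambda>n. case n of 0 \<Rightarrow> 0 | Suc m \<Rightarrow> wcoeff (\<Phi> z * \<Phi> Y) m)"
    unfolding b(2)[symmetric] by (auto simp: \<Phi>_def S_def fun_eq_iff split: nat.splits)
  have 4: "\<Phi> X = Witt (\<lambda>n. e (s n))" and 5: "\<Phi> Y = Witt (\<lambda>n. e (t n))"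
    by (simp_all add: \<Phi>_def X_def Y_def)
  show ?thesis using 1 unfolding 2 3 unfolding 4 5 \<Phi>z .
qed

end

lemma witt_ring_laws':
  fixes x y z :: "'k::comm_ring_prime_char witt"
  shows "x + y + z = x + (y + z) \<and> x + y = y + x \<and> 0 + x = x \<and> - x + x = 0 \<and>
    x * y * z = x * (y * z) \<and> x * y = y * x \<and> 1 * x = x \<and> (x + y) * z = x * z + y * z"
proof -
  define e where "e = case_sum (wcoeff x) (case_sum (wcoeff y) (wcoeff z))"
  have "x = Witt (\<lambda>n. e (Inl n))" "y = Witt (\<lambda>n. e (Inr (Inl n)))" "z = Witt (\<lambda>n. e (Inr (Inr n)))"
    by (simp_all add: e_def)
  thus ?thesis by (simp only:) (intro conjI witt_ring_laws)
qed

instance witt :: (comm_ring_prime_char) comm_ring_1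
proof
  show "(0::'a witt) \<noteq> 1"
    by (auto simp: zero_witt_def one_witt_def fun_eq_iff)
qed (use witt_ring_laws' in \<open>blast intro: minus_witt_def\<close>)+

definition witt_frob :: "'k::comm_ring_prime_char witt \<Rightarrow> 'k witt" where
  "witt_frob x = Witt (\<lambda>n. wcoeff x n ^ CHAR('k))"

definition witt_verschiebung :: "'k::comm_ring_prime_char witt \<Rightarrow> 'k witt" where
  "witt_verschiebung x = Witt (\<lambda>n. case n of 0 \<Rightarrow> 0 | Suc m \<Rightarrow> wcoeff x m)"

lemma char_power_add:
  "(x + y) ^ CHAR('k) = x ^ CHAR('k) + (y :: 'k::comm_ring_prime_char) ^ CHAR('k)"
  by (rule freshmans_dream) auto

lemma char_power_uminus:
  "(- x) ^ CHAR('k) = - ((x :: 'k::comm_ring_prime_char) ^ CHAR('k))"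
proof -
  have "x ^ CHAR('k) + (- x) ^ CHAR('k) = (x + - x) ^ CHAR('k)" by (simp only: char_power_add)
  also have "\<dots> = 0" by (simp add: power_0_left)
  finally show ?thesis by (simp add: eq_neg_iff_add_eq_0 add.commute)
qed

lemma ipoly_eval_char_power:
  fixes x :: "'v \<Rightarrow> 'k::comm_ring_prime_char"
  shows "ipoly_eval (\<lambda>v. x v ^ CHAR('k)) f = ipoly_eval x f ^ CHAR('k)"
proof (induction f rule: ipoly_induct)
  case (monom m)
  show ?case
    by (simp add: monom_eval_def prod_power_distrib mult.commute flip: power_mult)
next
  case (diff f g)
  have "(a - b) ^ CHAR('k) = a ^ CHAR('k) - b ^ CHAR('k)" for a b :: 'k
    using char_power_add[of a "- b"] by (simp add: char_power_uminus)
  thus ?case using diff by simp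
qed (simp add: power_0_left)

lemma case_sum_power:
  "case_sum (\<lambda>n. a n ^ k) (\<lambda>n. b n ^ k) = (\<lambda>v. case_sum a b v ^ k)"
  by (auto simp: fun_eq_iff split: sum.splits)

lemma witt_frob_add [simp]: "witt_frob (x + y) = witt_frob x + witt_frob y"
  by (simp add: witt_frob_def plus_witt_def case_sum_power ipoly_eval_char_power)

lemma witt_frob_mult [simp]: "witt_frob (x * y) = witt_frob x * witt_frob y"
  by (simp add: witt_frob_def times_witt_def case_sum_power ipoly_eval_char_power)

lemma witt_frob_0 [simp]: "witt_frob 0 = 0"
  by (simp add: witt_frob_def zero_witt_def power_0_left)

lemma witt_frob_1 [simp]: "witt_frob 1 = 1"
  by (auto simp add: witt_frob_def one_witt_def power_0_left fun_eq_iff)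

lemma witt_frob_of_nat [simp]: "witt_frob (of_nat n) = of_nat n"
  by (induction n) simp_all

lemma witt_frob_inject [simp]:
  "witt_frob x = witt_frob y \<longleftrightarrow> x = (y :: 'k::idom_prime_char witt)"
proof
  assume eq: "witt_frob x = witt_frob y"
  show "x = y"
  proof (rule witt_eqI)
    fix n
    have "wcoeff x n ^ CHAR('k) = wcoeff y n ^ CHAR('k)"
      using eq by (simp add: witt_frob_def fun_eq_iff)
    hence "(wcoeff x n - wcoeff y n) ^ CHAR('k) = 0"
      using char_power_add[of "wcoeff x n" "- wcoeff y n"] by (simp add: char_power_uminus)
    thus "wcoeff x n = wcoeff y n" by simp
  qed
qed simp

lemma witt_mult_verschiebung:
  "x * witt_verschiebung y = witt_verschiebung (witt_frob x * y)"
  using witt_mult_verschiebung_aux[of "case_sum (wcoeff x) (wcoeff y)" Inl Inr]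
  unfolding witt_verschiebung_def witt_frob_def sum.case witt.collapse .

lemma witt_frob_verschiebung:
  "witt_frob (witt_verschiebung x) = witt_verschiebung (witt_frob x)"
  by (auto simp: witt_frob_def witt_verschiebung_def fun_eq_iff power_0_left split: nat.splits)

lemma wcoeff_0 [simp]: "wcoeff 0 n = 0"
  by (simp add: zero_witt_def)

lemma wcoeff_mult_0: "wcoeff (x * y) 0 = wcoeff x 0 * wcoeff (y :: 'k::comm_ring_prime_char witt) 0"
proof -
  have "prime CHAR('k)" using CHAR_pos CHAR_prime by blast
  from ghost_witt_mult_polys[OF this, of 0] show ?thesis
    by (simp add: times_witt_def ghost_def)
qed

lemma witt_verschiebung_power_factor:
  assumes "x \<noteq> (0 :: 'k::comm_ring_prime_char witt)"
  shows "\<exists>n y. x = (witt_verschiebung ^^ n) y \<and> wcoeff y 0 \<noteq> 0"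
proof -
  have "\<exists>n. wcoeff x n \<noteq> 0"
    using assms by (auto simp: zero_witt_def intro: witt_eqI)
  then obtain n where "wcoeff x n \<noteq> 0" "\<forall>i<n. wcoeff x i = 0"
    using exists_least_iff[of "\<lambda>n. wcoeff x n \<noteq> 0"] by blast
  thus ?thesis
  proof (induction n arbitrary: x)
    case 0
    thus ?case by (intro exI[of _ "0::nat"] exI[of _ x]) auto
  next
    case (Suc n)
    let ?y = "Witt (\<lambda>i. wcoeff x (Suc i))"
    have "x = witt_verschiebung ?y"
      using Suc.prems by (intro witt_eqI) (auto simp: witt_verschiebung_def split: nat.splits)
    moreover obtain m z where "?y = (witt_verschiebung ^^ m) z" "wcoeff z 0 \<noteq> 0"
      using Suc.IH[of ?y] Suc.prems by auto
    ultimately show ?case by (intro exI[of _ "Suc m"] exI[of _ z]) auto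
  qed
qed

instance witt :: (idom_prime_char) idom
proof
  fix x y :: "'a witt"
  assume "x \<noteq> 0" "y \<noteq> 0"
  then obtain m x' n y' where x: "x = (witt_verschiebung ^^ m) x'" "wcoeff x' 0 \<noteq> 0"
    and y: "y = (witt_verschiebung ^^ n) y'" "wcoeff y' 0 \<noteq> 0"
    using witt_verschiebung_power_factor by metis
  have V: "a * (witt_verschiebung ^^ k) b = (witt_verschiebung ^^ k) ((witt_frob ^^ k) a * b)"
    for a b :: "'a witt" and k
    by (induction k arbitrary: a) (simp_all add: witt_mult_verschiebung funpow_swap1[of witt_frob])
  have F0: "wcoeff ((witt_frob ^^ k) a) 0 \<noteq> 0" if "wcoeff a 0 \<noteq> 0" for a :: "'a witt" and k
    using that by (induction k) (simp_all add: witt_frob_def)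
  have FV: "(witt_frob ^^ k) ((witt_verschiebung ^^ l) a) = (witt_verschiebung ^^ l) ((witt_frob ^^ k) a)"
    for a :: "'a witt" and k l
  proof -
    have "witt_frob ((witt_verschiebung ^^ l) b) = (witt_verschiebung ^^ l) (witt_frob b)"
      for b :: "'a witt"
      by (induction l) (simp_all add: witt_frob_verschiebung)
    thus ?thesis by (induction k) simp_all
  qed
  let ?z = "(witt_frob ^^ m) y' * (witt_frob ^^ n) x'"
  have "x * y = (witt_verschiebung ^^ n) ((witt_frob ^^ n) ((witt_verschiebung ^^ m) x') * y')"
    unfolding x y by (rule V)
  also have "\<dots> = (witt_verschiebung ^^ n) (y' * (witt_verschiebung ^^ m) ((witt_frob ^^ n) x'))"
    by (simp only: FV mult.commute)
  also have "\<dots> = (witt_verschiebung ^^ n) ((witt_verschiebung ^^ m) ?z)"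
    by (simp only: V)
  finally have "x * y = (witt_verschiebung ^^ n) ((witt_verschiebung ^^ m) ?z)" .
  moreover have "wcoeff ?z 0 \<noteq> 0" using F0 x y by (simp add: wcoeff_mult_0)
  moreover have V0: "(witt_verschiebung ^^ k) a = 0 \<Longrightarrow> a = 0" for k and a :: "'a witt"
  proof (induction k arbitrary: a)
    case (Suc k)
    hence "witt_verschiebung a = 0" by (simp add: funpow_swap1)
    hence "wcoeff (witt_verschiebung a) (Suc i) = 0" for i by (simp add: zero_witt_def)
    thus ?case by (intro witt_eqI) (simp add: witt_verschiebung_def zero_witt_def)
  qed simp
  ultimately show "x * y \<noteq> 0" by (metis V0 wcoeff_0)
qed

lemma bij_witt_frob: "bij (witt_frob :: 'k::{alg_closed_field, field_prime_char} witt \<Rightarrow> _)"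
proof (rule bijI)
  show "surj (witt_frob :: 'k witt \<Rightarrow> _)"
  proof
    show "UNIV \<subseteq> range (witt_frob :: 'k witt \<Rightarrow> _)"
    proof
      fix y :: "'k witt"
      have "\<forall>n. \<exists>a. a ^ CHAR('k) = wcoeff y n"
        by (metis CHAR_pos nth_root_exists)
      then obtain a where "\<And>n. a n ^ CHAR('k) = wcoeff y n" by metis
      hence "y = witt_frob (Witt a)" by (auto simp: witt_frob_def intro: witt_eqI)
      thus "y \<in> range witt_frob" by blast
    qed
  qed simp
qed (auto intro: injI)

definition witt_frob_inv :: "'k::comm_ring_prime_char witt \<Rightarrow> 'k witt" where
  "witt_frob_inv = the_inv witt_frob"

lemma witt_frob_inv:
  fixes x y :: "'k::{alg_closed_field, field_prime_char} witt"
  shows "witt_frob (witt_frob_inv x) = x" "witt_frob_inv (witt_frob x) = x"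
    "witt_frob_inv (x + y) = witt_frob_inv x + witt_frob_inv y"
    "witt_frob_inv (x * y) = witt_frob_inv x * witt_frob_inv y"
    "witt_frob_inv (of_nat n :: 'k witt) = of_nat n"
proof -
  show 1: "witt_frob (witt_frob_inv x) = x" for x :: "'k witt"
    by (simp add: witt_frob_inv_def f_the_inv_into_f_bij_betw[OF bij_witt_frob])
  show 2: "witt_frob_inv (witt_frob x) = x" for x :: "'k witt"
    by (simp add: witt_frob_inv_def the_inv_f_f[OF bij_is_inj[OF bij_witt_frob]])
  have 3: "witt_frob u = v \<Longrightarrow> witt_frob_inv v = u" for u v :: "'k witt" using 2 by blast
  show "witt_frob_inv (x + y) = witt_frob_inv x + witt_frob_inv y" by (rule 3) (simp add: 1)
  show "witt_frob_inv (x * y) = witt_frob_inv x * witt_frob_inv y" by (rule 3) (simp add: 1)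
  show "witt_frob_inv (of_nat n :: 'k witt) = of_nat n" by (rule 3) simp
qed

definition fract_frob :: "'k::idom_prime_char witt fract \<Rightarrow> 'k witt fract" where
  "fract_frob q = (THE r. \<exists>a b. b \<noteq> 0 \<and> q = Fract a b \<and> r = Fract (witt_frob a) (witt_frob b))"

lemma witt_frob_eq_0_iff [simp]: "witt_frob x = 0 \<longleftrightarrow> x = (0 :: 'k::idom_prime_char witt)"
  using witt_frob_inject[of x 0] by simp

lemma fract_frob_Fract:
  assumes "b \<noteq> 0"
  shows "fract_frob (Fract a b) = Fract (witt_frob a) (witt_frob b)"
  unfolding fract_frob_def
proof (rule the_equality)
  fix r assume "\<exists>a' b'. b' \<noteq> 0 \<and> Fract a b = Fract a' b' \<and> r = Fract (witt_frob a') (witt_frob b')"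
  thus "r = Fract (witt_frob a) (witt_frob b)"
    using assms by (auto simp: eq_fract simp flip: witt_frob_mult)
qed (use assms in blast)

lemma fract_frob_to_fract: "fract_frob (to_fract w) = to_fract (witt_frob w)"
  by (simp add: to_fract_def fract_frob_Fract)

text \<open>A left module over the Dieudonne ring (the ring generated over \<open>W(k)\<close> by \<open>F\<close> and \<open>V\<close> with
  the usual relations) is given by the actions of the scalars and of the two generators.\<close>

locale dieudonne_module = Modules.module scale
  for scale :: "'k::{alg_closed_field, field_prime_char} witt \<Rightarrow> 'm::ab_group_add \<Rightarrow> 'm"
    (infixr "*s" 75) +
  fixes F V :: "'m \<Rightarrow> 'm"
  assumes F_add: "F (x + y) = F x + F y"
    and V_add: "V (x + y) = V x + V y"
    and F_scale: "F (w *s x) = witt_frob w *s F x"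
    and V_scale: "w *s V x = V (witt_frob w *s x)"
    and F_V: "F (V x) = of_nat CHAR('k) *s x"
    and V_F: "V (F x) = of_nat CHAR('k) *s x"

definition dieudonne_hom where
  "dieudonne_hom scale F V L scale' F' V' L' \<phi> \<longleftrightarrow>
     \<phi> ` L \<subseteq> L' \<and>
     (\<forall>x\<in>L. \<forall>y\<in>L. \<phi> (x + y) = \<phi> x + \<phi> y) \<and>
     (\<forall>w. \<forall>x\<in>L. \<phi> (scale w x) = scale' w (\<phi> x)) \<and>
     (\<forall>x\<in>L. \<phi> (F x) = F' (\<phi> x)) \<and>
     (\<forall>x\<in>L. \<phi> (V x) = V' (\<phi> x))"

text \<open>\<open>A\<^sub>1\<^sub>,\<^sub>1\<close> is the quotient of the Dieudonne ring by the left ideal generated by \<open>F - V\<close>.  The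
  classes of \<open>1\<close> and \<open>F\<close> form a basis over the Witt vectors, and \<open>(a, b)\<close> stands for the class
  of \<open>a + b F\<close>.  Lemma \<open>A11_universal\<close> below is the universal property of the quotient.\<close>

definition A11_scale :: "'k::comm_ring_prime_char witt \<Rightarrow> 'k witt \<times> 'k witt \<Rightarrow> 'k witt \<times> 'k witt" where
  "A11_scale w x = (w * fst x, w * snd x)"

definition A11_F :: "'k::comm_ring_prime_char witt \<times> 'k witt \<Rightarrow> 'k witt \<times> 'k witt" where
  "A11_F x = (of_nat CHAR('k) * witt_frob (snd x), witt_frob (fst x))"

definition A11_V :: "'k::comm_ring_prime_char witt \<times> 'k witt \<Rightarrow> 'k witt \<times> 'k witt" where
  "A11_V x = (of_nat CHAR('k) * witt_frob_inv (snd x), witt_frob_inv (fst x))"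

lemma dieudonne_module_A11:
  "dieudonne_module (A11_scale :: 'k::{alg_closed_field, field_prime_char} witt \<Rightarrow> _) A11_F A11_V"
  by unfold_locales
    (auto simp: A11_scale_def A11_F_def A11_V_def witt_frob_inv algebra_simps)

lemma (in dieudonne_module) A11_universal:
  shows "A11_F (1, 0) = (A11_V (1, 0) :: 'k witt \<times> 'k witt)"
    and "F x = V x \<Longrightarrow>
      \<exists>!\<phi>. dieudonne_hom A11_scale A11_F A11_V UNIV scale F V UNIV \<phi> \<and> \<phi> (1, 0) = x"
proof -
  show "A11_F (1, 0) = (A11_V (1, 0) :: 'k witt \<times> 'k witt)"
    using witt_frob_inv(5)[of 0, where 'k = 'k] witt_frob_inv(5)[of 1, where 'k = 'k]
    by (simp add: A11_F_def A11_V_def)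
next
  assume FV: "F x = V x"
  have FF: "F (F x) = of_nat CHAR('k) *s x" by (simp only: FV F_V)
  have VFx: "V (w *s y) = witt_frob_inv w *s V y" for w y
    using V_scale[of "witt_frob_inv w" y] by (simp add: witt_frob_inv)
  let ?\<phi> = "\<lambda>c. fst c *s x + snd c *s F x"
  show "\<exists>!\<phi>. dieudonne_hom A11_scale A11_F A11_V UNIV scale F V UNIV \<phi> \<and> \<phi> (1, 0) = x"
  proof (rule ex1I)
    show "dieudonne_hom A11_scale A11_F A11_V UNIV scale F V UNIV ?\<phi> \<and> ?\<phi> (1, 0) = x"
      by (auto simp: dieudonne_hom_def A11_scale_def A11_F_def A11_V_def scale_left_distrib
          scale_right_distrib F_add V_add F_scale VFx FF V_F mult.commute simp flip: FV)
  next
    fix \<phi>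
    assume \<phi>: "dieudonne_hom A11_scale A11_F A11_V UNIV scale F V UNIV \<phi> \<and> \<phi> (1, 0) = x"
    show "\<phi> = ?\<phi>"
    proof
      fix c :: "'k witt \<times> 'k witt"
      have "c = A11_scale (fst c) (1, 0) + A11_scale (snd c) (A11_F (1, 0))"
        by (simp add: A11_scale_def A11_F_def prod_eq_iff)
      hence "\<phi> c = \<phi> (A11_scale (fst c) (1, 0) + A11_scale (snd c) (A11_F (1, 0)))" by simp
      moreover have "\<And>a b. \<phi> (a + b) = \<phi> a + \<phi> b" "\<And>w a. \<phi> (A11_scale w a) = w *s \<phi> a"
        "\<And>a. \<phi> (A11_F a) = F (\<phi> a)" "\<phi> (1, 0) = x"
        using \<phi> unfolding dieudonne_hom_def by blast+
      ultimately show "\<phi> c = ?\<phi> c" by (simp only:)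
    qed
  qed
qed

text \<open>The direct sum of \<open>g\<close> copies, inside the sequences with componentwise operations.\<close>

definition A11_pow :: "nat \<Rightarrow> (nat \<Rightarrow> 'k::comm_ring_prime_char witt \<times> 'k witt) set" where
  "A11_pow g = {x. \<forall>i\<ge>g. x i = 0}"

context dieudonne_module
begin

definition hom_to_A11_pow :: "nat \<Rightarrow> 'm set \<Rightarrow> ('m \<Rightarrow> nat \<Rightarrow> 'k witt \<times> 'k witt) \<Rightarrow> bool" where
  "hom_to_A11_pow g L \<phi> \<longleftrightarrow> dieudonne_hom scale F V L
     (\<lambda>w x i. A11_scale w (x i)) (\<lambda>x i. A11_F (x i)) (\<lambda>x i. A11_V (x i)) (A11_pow g) \<phi>"

definition list_basis :: "'m list \<Rightarrow> 'm set \<Rightarrow> bool" where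
  "list_basis bs L \<longleftrightarrow> distinct bs \<and> independent (set bs) \<and> span (set bs) = L"

definition free_dieudonne_submodule :: "nat \<Rightarrow> 'm set \<Rightarrow> bool" where
  "free_dieudonne_submodule n L \<longleftrightarrow>
     F ` L \<subseteq> L \<and> V ` L \<subseteq> L \<and> (\<exists>bs. list_basis bs L \<and> length bs = n)"

definition superspecial :: "nat \<Rightarrow> 'm set \<Rightarrow> bool" where
  "superspecial g L \<longleftrightarrow> (\<exists>\<phi>. hom_to_A11_pow g L \<phi> \<and> bij_betw \<phi> L (A11_pow g))"

text \<open>The Dieudonne module of a supersingular elliptic curve over \<open>k\<close> is \<open>A\<^sub>1\<^sub>,\<^sub>1\<close>, so that
  supersingular means isogenous to a power of \<open>A\<^sub>1\<^sub>,\<^sub>1\<close>: there is an injective homomorphism whose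
  cokernel is killed by a power of \<open>p\<close>.\<close>

definition supersingular :: "nat \<Rightarrow> 'm set \<Rightarrow> bool" where
  "supersingular g L \<longleftrightarrow> free_dieudonne_submodule (2 * g) L \<and>
     (\<exists>\<phi> n. hom_to_A11_pow g L \<phi> \<and> inj_on \<phi> L \<and>
        (\<forall>x\<in>A11_pow g. (\<lambda>i. A11_scale (of_nat CHAR('k) ^ n) (x i)) \<in> \<phi> ` L))"

definition quasi_polarisation :: "'m set \<Rightarrow> ('m \<Rightarrow> 'm \<Rightarrow> 'k witt fract) \<Rightarrow> bool" where
  "quasi_polarisation L B \<longleftrightarrow>
     (\<forall>x\<in>L. \<forall>y\<in>L. \<forall>z\<in>L. B (x + y) z = B x z + B y z \<and> B x (y + z) = B x y + B x z) \<and>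
     (\<forall>w. \<forall>x\<in>L. \<forall>y\<in>L. B (w *s x) y = to_fract w * B x y \<and> B x (w *s y) = to_fract w * B x y) \<and>
     (\<forall>x\<in>L. B x x = 0) \<and>
     (\<forall>x\<in>L. (\<forall>y\<in>L. B x y = 0) \<longrightarrow> x = 0) \<and>
     (\<forall>x\<in>L. \<forall>y\<in>L. B (F x) y = fract_frob (B x (V y)))"

text \<open>\<open>L\<^sup>t\<close>; functionals are extended by zero outside \<open>L\<close>.\<close>

definition dual :: "'m set \<Rightarrow> ('m \<Rightarrow> 'k witt) set" where
  "dual L = {b. (\<forall>x\<in>L. \<forall>y\<in>L. b (x + y) = b x + b y) \<and>
                (\<forall>w. \<forall>x\<in>L. b (w *s x) = w * b x) \<and> (\<forall>x. x \<notin> L \<longrightarrow> b x = 0)}"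

text \<open>For a lattice \<open>L\<close> with non-degenerate form, \<open>y \<mapsto> \<langle>-, y\<rangle>\<close> identifies \<open>L \<otimes> Frac W\<close> with the
  \<open>Frac W\<close>-valued linear functionals on \<open>L\<close>, and the lattice \<open>{y. \<langle>L, y\<rangle> \<subseteq> W}\<close> with the integral
  ones.  Inclusions and equalities between submodules of \<open>L\<close> and \<open>L\<^sup>t\<close> inside \<open>L \<otimes> Frac W\<close> are
  expressed in this space of functionals.\<close>

definition form_functional :: "('m \<Rightarrow> 'm \<Rightarrow> 'k witt fract) \<Rightarrow> 'm set \<Rightarrow> 'm \<Rightarrow> 'm \<Rightarrow> 'k witt fract" where
  "form_functional B L y = (\<lambda>m. if m \<in> L then B m y else 0)"

definition dual_lattice :: "'m set \<Rightarrow> ('m \<Rightarrow> 'k witt fract) set" where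
  "dual_lattice L = (\<lambda>b m. to_fract (b m)) ` dual L"

text \<open>The element \<open>y\<^sub>b\<close> for a functional \<open>b\<close>; it is meaningful if \<open>L\<^sup>t \<subseteq> L\<close>, as for the top module
  of a PFTQ (lemma \<open>dual_vec\<close> below).\<close>

definition dual_vec :: "('m \<Rightarrow> 'm \<Rightarrow> 'k witt fract) \<Rightarrow> 'm set \<Rightarrow> ('m \<Rightarrow> 'k witt) \<Rightarrow> 'm" where
  "dual_vec B L b = (THE y. y \<in> L \<and> (\<forall>m\<in>L. to_fract (b m) = B m y))"

definition dual_form ::
    "('m \<Rightarrow> 'm \<Rightarrow> 'k witt fract) \<Rightarrow> 'm set \<Rightarrow> ('m \<Rightarrow> 'k witt) \<Rightarrow> ('m \<Rightarrow> 'k witt) \<Rightarrow> 'k witt" where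
  "dual_form B L a b = b (dual_vec B L a)"

definition dual_basis :: "'m set \<Rightarrow> 'm list \<Rightarrow> nat \<Rightarrow> 'm \<Rightarrow> 'k witt" where
  "dual_basis L bs r =
     (THE b. b \<in> dual L \<and> (\<forall>s<length bs. b (bs ! s) = (if s = r then 1 else 0)))"

definition dual_gram_matrix ::
    "('m \<Rightarrow> 'm \<Rightarrow> 'k witt fract) \<Rightarrow> 'm set \<Rightarrow> 'm list \<Rightarrow> 'k witt mat" where
  "dual_gram_matrix B L bs = mat (length bs) (length bs)
     (\<lambda>(r, s). dual_form B L (dual_basis L bs r) (dual_basis L bs s))"

text \<open>A quotient of \<open>L\<close> by \<open>N\<close> that is killed by \<open>p\<close> is a vector space over the residue field
  \<open>k\<close>; the residue class of a Witt vector is its component of index \<open>0\<close>.  The classes of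
  \<open>b 0, \<dots>, b (n - 1)\<close> form a basis.\<close>

definition quotient_dim :: "'m set \<Rightarrow> 'm set \<Rightarrow> nat \<Rightarrow> bool" where
  "quotient_dim L N n \<longleftrightarrow>
     (\<forall>x\<in>L. of_nat CHAR('k) *s x \<in> N) \<and>
     (\<exists>b. (\<forall>j<n. b j \<in> L) \<and>
          (\<forall>x\<in>L. \<exists>c. x - (\<Sum>j<n. c j *s b j) \<in> N) \<and>
          (\<forall>c. (\<Sum>j<n. c j *s b j) \<in> N \<longrightarrow> (\<forall>j<n. wcoeff (c j) 0 = 0)))"

end

text \<open>All modules of the flag are submodules of one left module over the Dieudonne ring.\<close>

locale pftq = dieudonne_module scale F V
  for scale :: "'k::{alg_closed_field, field_prime_char} witt \<Rightarrow> 'm::ab_group_add \<Rightarrow> 'm"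
    (infixr "*s" 75) and F V +
  fixes g :: nat and M :: "nat \<Rightarrow> 'm set" and B :: "'m \<Rightarrow> 'm \<Rightarrow> 'k witt fract"
  assumes genus: "g \<ge> 1"
    and supersingular: "i < g \<Longrightarrow> supersingular g (M i)"
    and quasi_polarisation: "i < g \<Longrightarrow> quasi_polarisation (M i) B"
    and filtration: "1 \<le> i \<Longrightarrow> i < g \<Longrightarrow> M (i - 1) \<subseteq> M i"
    and top_superspecial: "superspecial g (M (g - 1))"
    and top_dual: "dual_lattice (M (g - 1)) =
          form_functional B (M (g - 1)) ` (F ^^ (g - 1)) ` M (g - 1)"
    and F_V_step: "1 \<le> i \<Longrightarrow> i < g \<Longrightarrow> F ` M i \<union> V ` M i \<subseteq> M (i - 1)"
    and dim_step: "1 \<le> i \<Longrightarrow> i < g \<Longrightarrow> quotient_dim (M i) (M (i - 1)) i"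
    and dual_step: "i < g \<Longrightarrow> j \<le> i div 2 \<Longrightarrow>
          form_functional B (M i) ` (F ^^ (i - j)) ` (V ^^ j) ` M i \<subseteq> dual_lattice (M i)"

lemma (in pftq) dual_vec:
  fixes a b :: "'m \<Rightarrow> 'k witt"
  defines "L \<equiv> M (g - 1)"
  assumes a: "a \<in> dual L"
  shows "dual_vec B L a \<in> L" and "m \<in> L \<Longrightarrow> to_fract (a m) = B m (dual_vec B L a)"
    and "b \<in> dual L \<Longrightarrow> to_fract (dual_form B L a b) = B (dual_vec B L a) (dual_vec B L b)"
proof -
  have g: "g - 1 < g" using genus by simp
  note qp = quasi_polarisation[OF g, folded L_def, unfolded quasi_polarisation_def]
  obtain bs where FL: "F ` L \<subseteq> L" and "span (set bs) = L"
    using supersingular[OF g] unfolding supersingular_def free_dieudonne_submodule_def list_basis_def L_def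
    by blast
  hence sub: "subspace L" using subspace_span by blast
  have Fn: "(F ^^ n) y \<in> L" if "y \<in> L" for n y
    using that FL by (induction n) auto
  have ex: "\<exists>!y. y \<in> L \<and> (\<forall>m\<in>L. to_fract (c m) = B m y)" if c: "c \<in> dual L" for c
  proof -
    have "(\<lambda>m. to_fract (c m)) \<in> dual_lattice L" using c by (auto simp: dual_lattice_def)
    then obtain y where y: "y \<in> L" "(\<lambda>m. to_fract (c m)) = form_functional B L y"
      using top_dual Fn unfolding L_def[symmetric] by (auto simp del: One_nat_def)
    have y': "\<forall>m\<in>L. to_fract (c m) = B m y"
      using fun_cong[OF y(2)] by (auto simp: form_functional_def)
    show ?thesis
    proof (rule ex1I[of _ y])
      fix z assume z: "z \<in> L \<and> (\<forall>m\<in>L. to_fract (c m) = B m z)"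
      have neg: "(- 1) *s y \<in> L" using sub y(1) by (rule subspace_scale)
      have d: "z + (- 1) *s y \<in> L" using subspace_add[OF sub _ neg] z by blast
      have 0: "B m (z + (- 1) *s y) = 0" if m: "m \<in> L" for m
      proof -
        have "B m (z + (- 1) *s y) = B m z + B m ((- 1) *s y)" using qp m z neg by blast
        also have "B m ((- 1) *s y) = to_fract (- 1) * B m y" using qp m y(1) by blast
        finally show ?thesis using z y' m by simp
      qed
      have skew: "B u v = - B v u" if "u \<in> L" "v \<in> L" for u v
      proof -
        have uv: "u + v \<in> L" using sub that by (simp add: subspace_add)
        have "B (u + v) (u + v) = (B u u + B u v) + (B v u + B v v)"
          using qp that uv by metis
        thus ?thesis using qp that uv by (simp add: eq_neg_iff_add_eq_0)
      qed
      have "\<forall>m\<in>L. B (z + (- 1) *s y) m = 0" using 0 skew[OF d] by simp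
      hence "z + (- 1) *s y = 0" using qp d by blast
      thus "z = y" by simp
    qed (use y y' in blast)
  qed
  have vec: "dual_vec B L c \<in> L \<and> (\<forall>m\<in>L. to_fract (c m) = B m (dual_vec B L c))"
    if "c \<in> dual L" for c
    unfolding dual_vec_def by (rule theI'[OF ex[OF that]])
  show "dual_vec B L a \<in> L" and "m \<in> L \<Longrightarrow> to_fract (a m) = B m (dual_vec B L a)"
    using vec[OF a] by blast+
  show "to_fract (dual_form B L a b) = B (dual_vec B L a) (dual_vec B L b)" if "b \<in> dual L"
    unfolding dual_form_def using vec[OF a] vec[OF that] by blast
qed

end

theory Submission
  imports Defs "HOL-Combinatorics.Transposition"
begin

text \<open>Let \<open>M\<close> be the top module, \<open>W = W(k)\<close>, and let \<open>b\<close> be the quasi-polarisation multiplied by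
  \<open>p\<^sup>h\<close> with \<open>h = \<lfloor>g / 2\<rfloor>\<close>.  Then \<open>b\<close> has values in \<open>W\<close>, and \<open>M\<^sup>t = F\<^sup>g\<^sup>-\<^sup>1 M\<close> says that \<open>b\<close> is a
  perfect pairing on \<open>M\<close> if \<open>g\<close> is odd, and that \<open>{x. b(x, M) \<subseteq> p W} = F M\<close> if \<open>g\<close> is even
  (\<open>odd_lattice_top\<close>, \<open>even_lattice_top\<close>).

  Put \<open>\<epsilon> = - 1\<close> if \<open>g\<close> is odd and \<open>\<epsilon> = 1\<close> if \<open>g\<close> is even.  Since \<open>M\<close> is a power of \<open>A\<^sub>1\<^sub>,\<^sub>1\<close>, it has
  a basis of the form \<open>y\<^sub>i, F y\<^sub>i\<close> with \<open>y\<^sub>i\<close> in the skeleton \<open>{x. V x = \<epsilon> F x}\<close>; for \<open>\<epsilon> = - 1\<close> one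
  rescales the obvious generators by a unit \<open>w\<close> with \<open>\<sigma>\<^sup>2(w) = - w\<close>.  On the skeleton
  \<open>F\<^sup>2 = \<epsilon> p\<close>, and \<open>b\<close> takes values in the ring of elements fixed by \<open>\<sigma>\<^sup>2\<close>, which is \<open>W(k\<^sub>2)\<close> for the
  subfield \<open>k\<^sub>2\<close> of \<open>k\<close> with \<open>p\<^sup>2\<close> elements.  So the skeleton is a module over the maximal order
  \<open>W(k\<^sub>2)[F]\<close> of the quaternion division algebra over the \<open>p\<close>-adic numbers, and the pair
  \<open>b(x, y)\<close>, \<open>b(x, F y)\<close> amounts to a hermitian form over this order.  The theorem is the
  Gram-Schmidt process for it, started from the reduction modulo \<open>F\<close>, where one half of the form
  survives.

  For odd \<open>g\<close> this half is \<open>b(x, F y)\<close>, on the skeleton modulo \<open>F\<close> a non-degenerate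
  hermitian form for \<open>k\<^sub>2\<close> over the prime field.  Surjectivity of the trace gives a vector \<open>y\<close> with
  \<open>b(y, F y)\<close> a unit, surjectivity of the norm makes this unit \<open>1\<close>, and \<open>y, F y\<close> split off
  (\<open>odd_unit_diagonal\<close>, \<open>odd_step\<close>).  For even \<open>g\<close> it is \<open>b(x, y)\<close>, residually a
  symplectic form.  A pair with \<open>b(e\<^sub>1, e\<^sub>2)\<close> a unit is corrected by multiples of
  \<open>F e\<^sub>1, F e\<^sub>2\<close> until all \<open>b(e\<^sub>i, F e\<^sub>j)\<close> vanish and \<open>b(e\<^sub>1, e\<^sub>2) = 1\<close>, and it splits off
  (\<open>even_pair\<close>, \<open>even_step\<close>).

  The scalars for these steps come from norm, trace and Artin-Schreier equations in \<open>W\<close>, all of the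
  form \<open>A t \<sigma>(t) + B \<sigma>(t) + C t + D = 0\<close>.  Modulo \<open>p\<close> this is a
  polynomial equation over the algebraically closed field \<open>k\<close>, and a residual solution lifts by Newton iteration (\<open>frob_bilinear_solvable\<close>).  Scalars
  that multiply skeleton vectors have to lie in \<open>W(k\<^sub>2)\<close>, and the solutions used for this purpose do so
  by themselves: applying \<open>\<sigma>\<close> to the equation shows that \<open>\<sigma>\<^sup>2(t)\<close> and \<open>t\<close> satisfy the same linear
  equation.  The iteration needs that \<open>W\<close> is \<open>p\<close>-adically complete with residue
  field \<open>k\<close>, which follows from \<open>p = V(1)\<close> (\<open>witt_p_eq\<close>, \<open>wp_power_dvd_diff_iff\<close>).

  At the end \<open>b\<close> has a monomial Gram matrix on the \<open>2 g\<close> vectors \<open>y\<^sub>i, F y\<^sub>i\<close>.  Its entries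
  divide the corresponding rows of \<open>b\<close>, so the vectors form a basis, and the dual basis and its Gram matrix can be read off (\<open>block_normal_form\<close>).\<close>

section \<open>Witt vectors modulo powers of p\<close>

abbreviation wp :: "'k::comm_ring_prime_char witt" where
  "wp \<equiv> of_nat CHAR('k)"

lemma prime_CHAR: "prime CHAR('k::comm_ring_prime_char)"
  using CHAR_pos CHAR_prime by blast

text \<open>Identities between Witt vectors are proved in the universal case, for sequences of integer
  polynomials, where ghost components determine a sequence, and are then specialised along \<open>e\<close>.\<close>

lemma witt_add_ghost:
  fixes e :: "'v \<Rightarrow> 'k::comm_ring_prime_char" and s t u :: "nat \<Rightarrow> 'v ipoly"
  assumes "\<And>n. ghost CHAR('k) n u = ghost CHAR('k) n s + ghost CHAR('k) n t"
  shows "Witt (\<lambda>n. ipoly_eval e (u n)) =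
           Witt (\<lambda>n. ipoly_eval e (s n)) + Witt (\<lambda>n. ipoly_eval e (t n))"
proof -
  let ?u = "\<lambda>i. ipoly_eval (case_sum s t) (witt_add_polys CHAR('k) i)"
  have "ghost CHAR('k) n ?u = ghost CHAR('k) n s + ghost CHAR('k) n t" for n
    unfolding ghost_eval ghost_witt_add_polys[OF prime_CHAR] ipoly_eval_add
    by (simp flip: ghost_eval)
  hence u: "u = ?u"
    using assms prime_CHAR by (intro ghost_inj[of "CHAR('k)"]) auto
  have "(\<lambda>v. ipoly_eval e (case_sum s t v)) =
      case_sum (\<lambda>n. ipoly_eval e (s n)) (\<lambda>n. ipoly_eval e (t n))"
    by (auto simp: fun_eq_iff split: sum.splits)
  hence "Witt (\<lambda>n. ipoly_eval e (?u n)) =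
           Witt (\<lambda>n. ipoly_eval e (s n)) + Witt (\<lambda>n. ipoly_eval e (t n))"
    by (simp add: plus_witt_def ipoly_eval_eval)
  thus ?thesis by (simp only: u)
qed

text \<open>Every natural number has a universal representative, identified by its ghost components.\<close>

lemma witt_of_nat_ghost:
  fixes e :: "'v \<Rightarrow> 'k::comm_ring_prime_char"
  shows "\<exists>s :: nat \<Rightarrow> 'v ipoly. (\<forall>n. ghost CHAR('k) n s = of_nat m) \<and>
           Witt (\<lambda>n. ipoly_eval e (s n)) = of_nat m"
proof (induction m)
  case 0
  show ?case
    by (intro exI[of _ "\<lambda>_. 0"])
      (use prime_CHAR in \<open>auto simp: ghost_def zero_witt_def power_0_left\<close>)
next
  case (Suc m)
  then obtain s :: "nat \<Rightarrow> 'v ipoly" where s: "\<And>n. ghost CHAR('k) n s = of_nat m"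
    "Witt (\<lambda>n. ipoly_eval e (s n)) = of_nat m" by blast
  let ?o = "\<lambda>n. if n = 0 then 1 else 0 :: 'v ipoly"
  have o: "ghost CHAR('k) n ?o = 1" for n
  proof -
    have "ghost CHAR('k) n ?o = (\<Sum>i\<le>n. if i = 0 then 1 else 0)"
      unfolding ghost_def by (intro sum.cong) (use prime_CHAR in \<open>auto simp: power_0_left\<close>)
    thus ?thesis by simp
  qed
  have o': "Witt (\<lambda>n. ipoly_eval e (?o n)) = 1" by (auto simp: one_witt_def fun_eq_iff)
  let ?u = "\<lambda>i. ipoly_eval (case_sum ?o s) (witt_add_polys CHAR('k) i)"
  have u: "ghost CHAR('k) n ?u = ghost CHAR('k) n ?o + ghost CHAR('k) n s" for n
    unfolding ghost_eval ghost_witt_add_polys[OF prime_CHAR] ipoly_eval_add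
    by (simp flip: ghost_eval)
  from witt_add_ghost[OF u, of e] show ?case
    by (intro exI[of _ ?u]) (use u o o' s in auto)
qed

text \<open>If the earlier components agree modulo \<open>p\<close>, their contributions to the \<open>n\<close>-th ghost component agree
  modulo \<open>p\<^sup>n\<^sup>+\<^sup>1\<close>, so the congruence of the ghost components passes to the last summands
  \<open>p\<^sup>n s\<^sub>n\<close> and \<open>p\<^sup>n t\<^sub>n\<close>.\<close>

lemma ghost_cong_imp_cong:
  fixes s t :: "nat \<Rightarrow> 'v ipoly"
  assumes p: "prime p"
    and cong: "\<And>n. of_nat p ^ Suc n dvd ghost p n s - ghost p n t"
  shows "of_nat p dvd s n - t n"
proof (induction n rule: less_induct)
  case (less n)
  have g: "ghost p n u = of_nat p ^ n * u n + (\<Sum>i<n. of_nat p ^ i * u i ^ (p ^ (n - i)))"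
    for u :: "nat \<Rightarrow> 'v ipoly"
    by (simp add: ghost_def flip: lessThan_Suc_atMost)
  have "of_nat p ^ Suc n dvd
      (\<Sum>i<n. of_nat p ^ i * (s i ^ (p ^ (n - i)) - t i ^ (p ^ (n - i))))"
  proof (rule dvd_sum)
    fix i assume "i \<in> {..<n}"
    hence i: "i < n" by simp
    have "of_nat p ^ Suc n = of_nat p ^ i * (of_nat p ^ Suc (n - i) :: 'v ipoly)"
      using i by (metis Suc_diff_le add_diff_cancel_left' le_Suc_eq le_add_diff_inverse
          less_imp_le_nat power_add)
    thus "of_nat p ^ Suc n dvd of_nat p ^ i * (s i ^ (p ^ (n - i)) - t i ^ (p ^ (n - i)))"
      using power_prime_power_cong[OF less(1)[OF i]] by (metis dvd_refl mult_dvd_mono)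
  qed
  from dvd_diff[OF cong[of n] this]
  have "of_nat p ^ Suc n dvd of_nat p ^ n * (s n - t n)"
    by (simp add: g algebra_simps sum_subtractf)
  then obtain c where "of_nat p ^ n * (s n - t n) = of_nat p ^ Suc n * c" by (elim dvdE)
  hence "of_nat p ^ n * (s n - t n) = of_nat p ^ n * (of_nat p * c)" by (simp add: mult_ac)
  from ipoly_of_nat_power_cancel[OF this] p show ?case by auto
qed

text \<open>The ghost components of the integer \<open>p\<close> are \<open>p, p, p, \<dots>\<close> and those of \<open>V(1)\<close> are
  \<open>0, p, p, \<dots>\<close>.  They agree up to the precision required by \<open>ghost_cong_imp_cong\<close>, so the two
  Witt vectors agree over every ring in which \<open>p = 0\<close>.\<close>

lemma witt_p_eq: "(wp :: 'k::comm_ring_prime_char witt) = witt_verschiebung 1"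
proof -
  let ?p = "CHAR('k)"
  define e :: "nat \<Rightarrow> 'k" where "e = (\<lambda>_. 0)"
  obtain s :: "nat \<Rightarrow> nat ipoly" where s: "\<And>n. ghost ?p n s = of_nat ?p"
    "Witt (\<lambda>n. ipoly_eval e (s n)) = wp" using witt_of_nat_ghost[of "?p"] by metis
  define t :: "nat \<Rightarrow> nat ipoly" where "t = (\<lambda>n. if n = 1 then 1 else 0)"
  have t: "ghost ?p n t = (if n = 0 then 0 else of_nat ?p)" for n
  proof -
    have "ghost ?p n t = (\<Sum>i\<le>n. if i = 1 then of_nat ?p else 0)"
      unfolding ghost_def t_def by (intro sum.cong) (use prime_CHAR in \<open>auto simp: power_0_left\<close>)
    thus ?thesis by (auto simp: sum.delta)
  qed
  have *: "of_nat ?p dvd s n - t n" for n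
    by (rule ghost_cong_imp_cong[OF prime_CHAR]) (simp add: s t)
  have "ipoly_eval e (s n) = ipoly_eval e (t n)" for n
  proof -
    obtain c where "s n - t n = of_nat ?p * c" using *[of n] by (elim dvdE)
    hence "ipoly_eval e (s n - t n) = ipoly_eval e (of_nat ?p * c)" by simp
    thus ?thesis by simp
  qed
  with s(2) have "wp = Witt (\<lambda>n. ipoly_eval e (t n))" by simp
  also have "\<dots> = witt_verschiebung 1"
    by (auto simp: t_def witt_verschiebung_def one_witt_def fun_eq_iff split: nat.splits)
  finally show ?thesis .
qed

lemma witt_mult_p: "x * wp = witt_verschiebung (witt_frob x)"
  by (simp add: witt_p_eq witt_mult_verschiebung)

text \<open>Addition of Witt vectors with disjoint supports is componentwise, because the ghost components
  are sums over the components.\<close>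

lemma witt_split_add:
  fixes x :: "'k::comm_ring_prime_char witt"
  shows "x = Witt (\<lambda>i. if i < n then wcoeff x i else 0) + Witt (\<lambda>i. if i < n then 0 else wcoeff x i)"
proof -
  let ?s = "\<lambda>i. if i < n then ipoly_var i else 0 :: nat ipoly"
  let ?t = "\<lambda>i. if i < n then 0 else ipoly_var i :: nat ipoly"
  have "ghost CHAR('k) m ipoly_var = ghost CHAR('k) m ?s + ghost CHAR('k) m ?t" for m
    unfolding ghost_def sum.distrib[symmetric]
    by (rule sum.cong) (use prime_CHAR[where 'k = 'k] in \<open>auto simp: power_0_left\<close>)
  from witt_add_ghost[OF this, of "wcoeff x"] show ?thesis
    by (simp add: if_distrib cong: if_cong)
qed

lemma wcoeff_verschiebung:
  "wcoeff (witt_verschiebung x) i = (case i of 0 \<Rightarrow> 0 | Suc m \<Rightarrow> wcoeff x m)"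
  by (simp add: witt_verschiebung_def)

lemma wcoeff_verschiebung_funpow:
  "wcoeff ((witt_verschiebung ^^ n) x) i = (if i < n then 0 else wcoeff x (i - n))"
proof (induction n arbitrary: i)
  case (Suc n)
  show ?case by (auto simp: wcoeff_verschiebung Suc split: nat.splits)
qed simp

lemma witt_verschiebung_inv:
  "witt_verschiebung x = wp * witt_frob_inv (x :: 'k::{alg_closed_field, field_prime_char} witt)"
  using witt_mult_p[of "witt_frob_inv x"] by (simp add: witt_frob_inv mult.commute)

lemma witt_verschiebung_funpow:
  "(witt_verschiebung ^^ n) x = wp ^ n * (witt_frob_inv ^^ n) (x :: 'k::{alg_closed_field, field_prime_char} witt)"
proof (induction n)
  case (Suc n)
  have "witt_frob_inv (wp ^ m * y) = wp ^ m * witt_frob_inv y" for m and y :: "'k witt"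
    using witt_frob_inv(5)[of "CHAR('k) ^ m", where 'k = 'k] by (simp add: witt_frob_inv)
  hence "witt_frob_inv ((witt_verschiebung ^^ n) x) = wp ^ n * (witt_frob_inv ^^ Suc n) x"
    by (simp only: Suc funpow.simps o_apply)
  thus ?case by (simp add: witt_verschiebung_inv[of "(witt_verschiebung ^^ n) x"] mult.assoc)
qed simp

lemma wp_power_mult:
  "wp ^ n * (x :: 'k::{alg_closed_field, field_prime_char} witt) = (witt_verschiebung ^^ n) ((witt_frob ^^ n) x)"
proof -
  have "(witt_frob_inv ^^ n) ((witt_frob ^^ n) x) = x" for x :: "'k witt"
    by (induction n arbitrary: x) (simp_all add: funpow_swap1[of witt_frob] funpow_swap1[of witt_frob_inv] witt_frob_inv)
  thus ?thesis by (simp add: witt_verschiebung_funpow)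
qed

text \<open>By \<open>wp_power_mult\<close> the multiples of \<open>p\<^sup>n\<close> are the \<open>n\<close>-fold shifts, so that \<open>witt_split_add\<close>
  writes every \<open>x\<close> as its truncation \<open>T x\<close> plus a multiple of \<open>p\<^sup>n\<close>, in a unique way.  In particular
  \<open>W(k)\<close> is \<open>p\<close>-adically separated and complete, and its residue field is \<open>k\<close>.\<close>

lemma wp_power_dvd_diff_iff:
  fixes x y :: "'k::{alg_closed_field, field_prime_char} witt"
  shows "wp ^ n dvd x - y \<longleftrightarrow> (\<forall>i<n. wcoeff x i = wcoeff y i)"
proof -
  define T where "T = (\<lambda>x :: 'k witt. Witt (\<lambda>i. if i < n then wcoeff x i else 0))"
  have split: "\<exists>z. x = T x + wp ^ n * z" for x
  proof -
    have "Witt (\<lambda>i. if i < n then 0 else wcoeff x i) = (witt_verschiebung ^^ n) (Witt (\<lambda>i. wcoeff x (i + n)))"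
      by (rule witt_eqI) (simp add: wcoeff_verschiebung_funpow)
    thus ?thesis using witt_split_add[of x n] unfolding T_def witt_verschiebung_funpow by metis
  qed
  have T: "T (T x + wp ^ n * z) = T x" for x z
  proof -
    let ?Z = "(witt_frob ^^ n) z"
    let ?w = "Witt (\<lambda>i. if i < n then wcoeff x i else wcoeff ?Z (i - n))"
    have "T x = Witt (\<lambda>i. if i < n then wcoeff ?w i else 0)"
      by (auto simp: T_def fun_eq_iff)
    moreover have "wp ^ n * z = Witt (\<lambda>i. if i < n then 0 else wcoeff ?w i)"
      by (rule witt_eqI) (simp add: wp_power_mult wcoeff_verschiebung_funpow)
    ultimately have "T x + wp ^ n * z = ?w" using witt_split_add[of ?w n] by simp
    thus ?thesis by (auto simp: T_def fun_eq_iff)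
  qed
  have "wp ^ n dvd x - y \<longleftrightarrow> T x = T y"
  proof
    assume "wp ^ n dvd x - y"
    then obtain c where c: "x = y + wp ^ n * c" by (metis add.commute diff_add_cancel dvdE)
    obtain z where z: "y = T y + wp ^ n * z" using split by blast
    have "x = T y + wp ^ n * (z + c)" using c z by (simp add: ring_distribs)
    thus "T x = T y" using T by metis
  next
    assume "T x = T y"
    thus "wp ^ n dvd x - y" using split[of x] split[of y]
      by (metis add_diff_cancel_left dvd_triv_left right_diff_distrib)
  qed
  also have "\<dots> \<longleftrightarrow> (\<forall>i<n. wcoeff x i = wcoeff y i)"
    by (auto simp: T_def fun_eq_iff)
  finally show ?thesis .
qed

lemma wp_dvd_iff: "wp dvd (x :: 'k::{alg_closed_field, field_prime_char} witt) \<longleftrightarrow> wcoeff x 0 = 0"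
  using wp_power_dvd_diff_iff[of 1 x 0] by simp

lemma wp_nonzero [simp]: "(wp :: 'k::comm_ring_prime_char witt) \<noteq> 0"
proof
  assume "(wp :: 'k witt) = 0"
  hence "wcoeff (witt_verschiebung (1 :: 'k witt)) 1 = wcoeff 0 1" by (simp add: witt_p_eq)
  thus False by (simp add: witt_verschiebung_def one_witt_def)
qed

lemma witt_eq_0_if_dvd:
  fixes x :: "'k::{alg_closed_field, field_prime_char} witt"
  assumes "\<And>n. wp ^ n dvd x"
  shows "x = 0"
proof (rule witt_eqI)
  fix n
  show "wcoeff x n = wcoeff 0 n" using wp_power_dvd_diff_iff[of "Suc n" x 0] assms[of "Suc n"] by simp
qed

lemma wcoeff_add_0: "wcoeff (x + y) 0 = wcoeff x 0 + wcoeff (y :: 'k::comm_ring_prime_char witt) 0"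
  using ghost_witt_add_polys[OF prime_CHAR[where 'k = 'k], of 0] by (simp add: plus_witt_def ghost_def)

lemma wcoeff_minus_0: "wcoeff (- x) 0 = - wcoeff (x :: 'k::comm_ring_prime_char witt) 0"
  using wcoeff_add_0[of x "- x"] by (simp add: eq_neg_iff_add_eq_0 add.commute)

lemma wcoeff_diff_0:
  "wcoeff (x - y) 0 = wcoeff x 0 - wcoeff (y :: 'k::comm_ring_prime_char witt) 0"
  using wcoeff_add_0[of x "- y"] by (simp add: wcoeff_minus_0)

lemma wcoeff_1_0: "wcoeff (1 :: 'k::comm_ring_prime_char witt) 0 = 1"
  by (simp add: one_witt_def)

lemma wcoeff_frob_0: "wcoeff (witt_frob x) 0 = wcoeff (x :: 'k::comm_ring_prime_char witt) 0 ^ CHAR('k)"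
  by (simp add: witt_frob_def)

lemma witt_frob_wp_power [simp]: "witt_frob (wp ^ n) = (wp ^ n :: 'k::comm_ring_prime_char witt)"
  by (induction n) simp_all

lemma witt_frob_uminus [simp]: "witt_frob (- x) = - witt_frob (x :: 'k::comm_ring_prime_char witt)"
  using witt_frob_add[of x "- x"] by (simp add: eq_neg_iff_add_eq_0 add.commute)

lemma witt_frob_diff [simp]:
  "witt_frob (x - y) = witt_frob x - witt_frob (y :: 'k::comm_ring_prime_char witt)"
  using witt_frob_add[of x "- y"] by simp

lemmas wcoeff0 = wcoeff_add_0 wcoeff_minus_0 wcoeff_diff_0 wcoeff_mult_0 wcoeff_1_0 wcoeff_frob_0

text \<open>Completeness in the form used below: an equation \<open>G x = 0\<close> can be solved if \<open>G\<close> respects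
  congruences and every solution modulo \<open>p\<^sup>n\<close> can be improved to one modulo \<open>p\<^sup>n\<^sup>+\<^sup>1\<close> without changing it
  modulo \<open>p\<^sup>n\<close>.\<close>

lemma witt_newton:
  fixes G :: "'k::{alg_closed_field, field_prime_char} witt \<Rightarrow> 'k witt"
  assumes cong: "\<And>n x y. wp ^ n dvd x - y \<Longrightarrow> wp ^ n dvd G x - G y"
    and lift: "\<And>n x. n \<ge> 1 \<Longrightarrow> wp dvd x - x0 \<Longrightarrow> wp ^ n dvd G x \<Longrightarrow>
                 \<exists>s. wp ^ Suc n dvd G (x + wp ^ n * s)"
    and start: "wp dvd G x0"
  shows "\<exists>x. wp dvd x - x0 \<and> G x = 0"
proof -
  have "\<exists>f. \<forall>n. (wp dvd f n - x0 \<and> wp ^ Suc n dvd G (f n)) \<and> wp ^ Suc n dvd f (Suc n) - f n"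
  proof (rule dependent_nat_choice)
    show "\<exists>x. wp dvd x - x0 \<and> wp ^ Suc 0 dvd G x"
      using start by (intro exI[of _ x0]) simp
  next
    fix x n assume x: "wp dvd x - x0 \<and> wp ^ Suc n dvd G x"
    obtain s where "wp ^ Suc (Suc n) dvd G (x + wp ^ Suc n * s)" using lift[of "Suc n" x] x by auto
    moreover have "wp dvd (x - x0) + wp ^ Suc n * s" using x by (intro dvd_add) auto
    ultimately show "\<exists>y. (wp dvd y - x0 \<and> wp ^ Suc (Suc n) dvd G y) \<and> wp ^ Suc n dvd y - x"
      by (intro exI[of _ "x + wp ^ Suc n * s"]) (auto simp: algebra_simps)
  qed
  then obtain f where f: "\<And>n. wp dvd f n - x0" "\<And>n. wp ^ Suc n dvd G (f n)"
    "\<And>n. wp ^ Suc n dvd f (Suc n) - f n" by blast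
  have stab: "wcoeff (f n) i = wcoeff (f i) i" if "i \<le> n" for i n
    using that
  proof (induction n rule: dec_induct)
    case (step n)
    thus ?case using f(3)[of n] by (simp add: wp_power_dvd_diff_iff del: power_Suc)
  qed simp
  define x where "x = Witt (\<lambda>i. wcoeff (f i) i)"
  have x: "wp ^ Suc n dvd x - f n" for n
    unfolding wp_power_dvd_diff_iff x_def using stab[of _ n, symmetric] by (auto simp: less_Suc_eq_le)
  have "wp ^ Suc n dvd G x" for n
    using dvd_add[OF cong[OF x[of n]] f(2)[of n]] by simp
  hence "wp ^ n dvd G x" for n by (rule power_le_dvd[OF _ le_SucI[OF order_refl]])
  hence "G x = 0" by (rule witt_eq_0_if_dvd)
  moreover have "wp dvd x - x0" using dvd_add[OF x[of 0, unfolded power_Suc0_right] f(1)[of 0]] by simp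
  ultimately show ?thesis by blast
qed

text \<open>The ring is local: an inverse of the residue class lifts to an inverse by Newton
  iteration.\<close>

lemma witt_unit_iff:
  fixes x :: "'k::{alg_closed_field, field_prime_char} witt"
  shows "x dvd 1 \<longleftrightarrow> \<not> wp dvd x"
proof
  assume "x dvd 1"
  then obtain y where "1 = x * y" by (elim dvdE)
  hence "wcoeff x 0 * wcoeff y 0 = 1" by (metis wcoeff_mult_0 wcoeff_1_0)
  thus "\<not> wp dvd x" by (auto simp: wp_dvd_iff)
next
  assume "\<not> wp dvd x"
  hence x0: "wcoeff x 0 \<noteq> 0" by (simp add: wp_dvd_iff)
  define y0 where "y0 = Witt (\<lambda>_. inverse (wcoeff x 0))"
  have start: "wp dvd x * y0 - 1"
    using x0 by (simp add: wp_dvd_iff y0_def wcoeff0 diff_conv_add_uminus del: add_uminus_conv_diff)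
  have "\<exists>y. wp dvd y - y0 \<and> x * y - 1 = 0"
  proof (rule witt_newton)
    show "wp ^ n dvd (x * y - 1) - (x * z - 1)" if "wp ^ n dvd y - z" for n y z
      using dvd_mult[OF that, of x] by (simp add: algebra_simps)
    show "wp dvd x * y0 - 1" by (rule start)
  next
    fix n y assume "wp ^ n dvd x * y - 1"
    then obtain r where r: "x * y - 1 = wp ^ n * r" by (elim dvdE)
    have "x * (y + wp ^ n * (- y0 * r)) - 1 = wp ^ n * (r - x * y0 * r)"
      using r by (simp add: algebra_simps)
    also have "\<dots> = wp ^ n * (- (x * y0 - 1) * r)" by (simp add: algebra_simps)
    finally show "\<exists>s. wp ^ Suc n dvd x * (y + wp ^ n * s) - 1"
      using start by (metis dvd_mult2 dvd_minus_iff mult_dvd_mono dvd_refl power_Suc2)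
  qed
  thus "x dvd 1" by (metis dvd_triv_left eq_iff_diff_eq_0)
qed

section \<open>Equations involving the Frobenius\<close>

lemma frob_power_eq_linear_root:
  "\<exists>x :: 'k::{alg_closed_field, field_prime_char}. x ^ CHAR('k) + a * x + b = 0"
proof -
  let ?q = "monom 1 CHAR('k) + [:b, a:]"
  have "CHAR('k) > 1" using prime_CHAR[where 'k = 'k] prime_gt_1_nat by blast
  hence "coeff ?q CHAR('k) = 1"
    by (auto simp: coeff_pCons split: nat.splits)
  hence "degree ?q \<ge> CHAR('k)" by (intro le_degree) (simp only: one_neq_zero not_False_eq_True)
  hence "degree ?q > 0" using \<open>CHAR('k) > 1\<close> by linarith
  then obtain x where "poly ?q x = 0"
    using alg_closed_imp_poly_has_root[of ?q] by blast
  thus ?thesis by (intro exI[of _ x]) (simp add: poly_monom algebra_simps)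
qed

text \<open>The common source of all solvability statements for the Frobenius: the norm and trace equations,
  Lang's theorem and an Artin-Schreier equation are special cases.  Replacing \<open>t\<close> by \<open>t + p\<^sup>n s\<close>
  changes the left-hand side by \<open>p\<^sup>n (a \<sigma>(s) + c s)\<close> modulo \<open>p\<^sup>n\<^sup>+\<^sup>1\<close>, where \<open>a = A t + B\<close> is a unit.
  So the correction \<open>s\<close> is found from a root of \<open>a\<^sub>0 X\<^sup>p + c\<^sub>0 X + r\<^sub>0\<close> in \<open>k\<close>, where the index \<open>0\<close>
  denotes residue classes.\<close>

lemma frob_bilinear_solvable:
  fixes A B C D t0 :: "'k::{alg_closed_field, field_prime_char} witt"
  assumes start: "wp dvd A * t0 * witt_frob t0 + B * witt_frob t0 + C * t0 + D"
    and unit: "\<not> wp dvd A * t0 + B"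
  shows "\<exists>t. wp dvd t - t0 \<and> A * t * witt_frob t + B * witt_frob t + C * t + D = 0"
proof (rule witt_newton[where G = "\<lambda>t. A * t * witt_frob t + B * witt_frob t + C * t + D",
      OF _ _ start])
  fix n and x y :: "'k witt" assume "wp ^ n dvd x - y"
  then obtain z where z: "x = y + wp ^ n * z" by (metis add.commute diff_add_cancel dvdE)
  have F: "witt_frob x = witt_frob y + wp ^ n * witt_frob z"
    by (simp add: z)
  have "A * x * witt_frob x + B * witt_frob x + C * x + D -
        (A * y * witt_frob y + B * witt_frob y + C * y + D) =
        wp ^ n * (A * z * witt_frob x + A * y * witt_frob z + B * witt_frob z + C * z)"
    unfolding F by (simp add: z algebra_simps)
  thus "wp ^ n dvd A * x * witt_frob x + B * witt_frob x + C * x + D -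
        (A * y * witt_frob y + B * witt_frob y + C * y + D)" by simp
next
  fix n and t :: "'k witt" assume n: "n \<ge> 1" and t: "wp dvd t - t0"
    and "wp ^ n dvd A * t * witt_frob t + B * witt_frob t + C * t + D"
  then obtain r where r: "A * t * witt_frob t + B * witt_frob t + C * t + D = wp ^ n * r"
    by (elim dvdE)
  define a c where "a = A * t + B" and "c = A * witt_frob t + C"
  have "\<not> wp dvd a"
  proof
    assume "wp dvd a"
    hence "wp dvd a - A * (t - t0)" using t by (intro dvd_diff) auto
    thus False using unit by (simp add: a_def algebra_simps)
  qed
  hence a0: "wcoeff a 0 \<noteq> 0" by (simp add: wp_dvd_iff)
  obtain s0 where "s0 ^ CHAR('k) + (wcoeff c 0 / wcoeff a 0) * s0 + wcoeff r 0 / wcoeff a 0 = 0"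
    using frob_power_eq_linear_root by blast
  hence s0: "wcoeff a 0 * s0 ^ CHAR('k) + wcoeff c 0 * s0 + wcoeff r 0 = 0"
    using a0 by (simp add: field_simps)
  define s where "s = Witt (\<lambda>_. s0)"
  have "wcoeff (a * witt_frob s + c * s + r) 0 = 0"
    using s0 by (simp add: s_def wcoeff0)
  hence 1: "wp dvd a * witt_frob s + c * s + r" by (simp add: wp_dvd_iff)
  have 2: "wp dvd (wp :: 'k witt) ^ n" using n by (simp add: dvd_power)
  have F: "witt_frob (t + wp ^ n * s) = witt_frob t + wp ^ n * witt_frob s"
    by simp
  have "A * (t + wp ^ n * s) * witt_frob (t + wp ^ n * s) + B * witt_frob (t + wp ^ n * s)
        + C * (t + wp ^ n * s) + D =
        (A * t * witt_frob t + B * witt_frob t + C * t + D) +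
        wp ^ n * (a * witt_frob s + c * s + wp ^ n * (A * s * witt_frob s))"
    unfolding F by (simp add: a_def c_def algebra_simps)
  also have "\<dots> = wp ^ n * ((a * witt_frob s + c * s + r) + wp ^ n * (A * s * witt_frob s))"
    unfolding r by (simp add: algebra_simps)
  also have "wp ^ Suc n dvd \<dots>"
    unfolding power_Suc2 by (rule mult_dvd_mono[OF dvd_refl dvd_add[OF 1 dvd_mult2[OF 2]]])
  finally show "\<exists>s. wp ^ Suc n dvd A * (t + wp ^ n * s) * witt_frob (t + wp ^ n * s)
      + B * witt_frob (t + wp ^ n * s) + C * (t + wp ^ n * s) + D" by blast
qed


lemma witt_unit_wcoeff:
  "x dvd 1 \<longleftrightarrow> wcoeff (x :: 'k::{alg_closed_field, field_prime_char} witt) 0 \<noteq> 0"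
  by (simp add: witt_unit_iff wp_dvd_iff)

lemma witt_norm_solvable:
  fixes a :: "'k::{alg_closed_field, field_prime_char} witt"
  assumes "a dvd 1"
  shows "\<exists>c. a * c * witt_frob c = 1"
proof -
  have a0: "wcoeff a 0 \<noteq> 0" using assms by (simp add: witt_unit_wcoeff)
  obtain x where x: "x ^ Suc CHAR('k) = inverse (wcoeff a 0)"
    using nth_root_exists[of "Suc CHAR('k)" "inverse (wcoeff a 0)"] by auto
  hence "x \<noteq> 0" using a0 by (auto simp: power_0_left)
  let ?c = "Witt (\<lambda>_. x) :: 'k witt"
  have "wcoeff (a * ?c * witt_frob ?c + 0 * witt_frob ?c + 0 * ?c + - 1) 0 = 0"
    using a0 x by (simp add: wcoeff0 mult.assoc)
  moreover have "\<not> wp dvd a * ?c + 0" using a0 \<open>x \<noteq> 0\<close> by (simp add: wp_dvd_iff wcoeff0)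
  ultimately have "\<exists>c. wp dvd c - ?c \<and> a * c * witt_frob c + 0 * witt_frob c + 0 * c + - 1 = 0"
    by (intro frob_bilinear_solvable) (simp_all only: wp_dvd_iff not_False_eq_True)
  thus ?thesis by auto
qed

text \<open>Lang's theorem for the multiplicative group: residually \<open>x\<^sup>p = u\<^sub>0 x\<close> has a nonzero solution.\<close>

lemma witt_lang:
  fixes u :: "'k::{alg_closed_field, field_prime_char} witt"
  assumes "u dvd 1"
  shows "\<exists>w. w dvd 1 \<and> witt_frob w = u * w"
proof -
  have u0: "wcoeff u 0 \<noteq> 0" using assms by (simp add: witt_unit_wcoeff)
  have p: "CHAR('k) > 1" using prime_CHAR[where 'k = 'k] prime_gt_1_nat by blast
  then obtain x where x: "x ^ (CHAR('k) - 1) = wcoeff u 0"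
    using nth_root_exists[of "CHAR('k) - 1" "wcoeff u 0"] by auto
  hence "x \<noteq> 0" using u0 p by (auto simp: power_0_left)
  have "CHAR('k) = Suc (CHAR('k) - 1)" using p by simp
  hence xp: "x ^ CHAR('k) = wcoeff u 0 * x" using x by (metis power_Suc2)
  let ?c = "Witt (\<lambda>_. x) :: 'k witt"
  have "wcoeff (0 * ?c * witt_frob ?c + 1 * witt_frob ?c + (- u) * ?c + 0) 0 = 0"
    using xp by (simp add: wcoeff0)
  moreover have "wcoeff (0 * ?c + (1 :: 'k witt)) 0 \<noteq> 0" by (simp add: wcoeff0)
  ultimately have "\<exists>c. wp dvd c - ?c \<and> 0 * c * witt_frob c + 1 * witt_frob c + (- u) * c + 0 = 0"
    by (intro frob_bilinear_solvable) (simp_all only: wp_dvd_iff not_False_eq_True)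
  then obtain c where c: "wp dvd c - ?c" "witt_frob c = u * c" by (auto simp: algebra_simps)
  have "wcoeff c 0 = x" using wp_power_dvd_diff_iff[of 1 c ?c] c by simp
  thus ?thesis using c \<open>x \<noteq> 0\<close> by (auto simp: witt_unit_wcoeff)
qed

text \<open>If \<open>u \<sigma>(u) = - 1\<close> and \<open>\<sigma>(w) = u w\<close>, then \<open>\<sigma>\<^sup>2(w) = \<sigma>(u) u w = - w\<close>.  The Teichmueller lift of a
  root of \<open>X\<^sup>q\<^sup>-\<^sup>1 = - 1\<close>, \<open>q = p\<^sup>2\<close>, would do only for odd \<open>p\<close>.\<close>

lemma witt_frob_twice_eq_minus:
  "\<exists>w :: 'k::{alg_closed_field, field_prime_char} witt. w dvd 1 \<and> witt_frob (witt_frob w) = - w"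
proof -
  obtain u :: "'k witt" where u: "(- 1) * u * witt_frob u = 1"
    using witt_norm_solvable[of "- 1 :: 'k witt"] by auto
  hence u': "u * witt_frob u = - 1" by (simp add: minus_equation_iff)
  have "1 = u * (- witt_frob u)" using u' by simp
  hence "u dvd 1" by (rule dvdI)
  then obtain w where "w dvd 1" "witt_frob w = u * w" using witt_lang by blast
  moreover from this have "witt_frob (witt_frob w) = (u * witt_frob u) * w" by (simp add: mult_ac)
  ultimately show ?thesis unfolding u' by auto
qed

text \<open>Such a \<open>d\<close> satisfies \<open>\<sigma>\<^sup>2(d) = d\<close>: it is an element of trace \<open>1\<close>, in every characteristic.\<close>

lemma witt_trace_one:
  "\<exists>d :: 'k::{alg_closed_field, field_prime_char} witt. d + witt_frob d = 1"
proof -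
  obtain x :: 'k where x: "x ^ CHAR('k) + 1 * x + (- 1) = 0"
    using frob_power_eq_linear_root by blast
  let ?c = "Witt (\<lambda>_. x) :: 'k witt"
  have "wcoeff (0 * ?c * witt_frob ?c + 1 * witt_frob ?c + 1 * ?c + - 1) 0 = 0"
    using x by (simp add: wcoeff0)
  moreover have "wcoeff (0 * ?c + (1 :: 'k witt)) 0 \<noteq> 0" by (simp add: wcoeff0)
  ultimately have "\<exists>c. wp dvd c - ?c \<and> 0 * c * witt_frob c + 1 * witt_frob c + 1 * c + - 1 = 0"
    by (intro frob_bilinear_solvable) (simp_all only: wp_dvd_iff not_False_eq_True)
  thus ?thesis by (auto simp: algebra_simps)
qed

text \<open>The coefficient of \<open>t \<sigma>(t)\<close> is divisible by \<open>p\<close>, so the residual equation is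
  \<open>X\<^sup>p - X + a\<^sub>0 = 0\<close>.\<close>

lemma witt_artin_schreier:
  fixes a b :: "'k::{alg_closed_field, field_prime_char} witt"
  shows "\<exists>t. witt_frob t - t + a - wp * b * t * witt_frob t = 0"
proof -
  obtain x :: 'k where x: "x ^ CHAR('k) + (- 1) * x + wcoeff a 0 = 0"
    using frob_power_eq_linear_root by blast
  let ?c = "Witt (\<lambda>_. x) :: 'k witt"
  have "wcoeff ((- wp * b) * ?c * witt_frob ?c + 1 * witt_frob ?c + (- 1) * ?c + a) 0 = 0"
    using x by (simp add: wcoeff0 wp_dvd_iff[THEN iffD1, OF dvd_refl])
  moreover have "wcoeff ((- wp * b) * ?c + 1) 0 \<noteq> 0"
    by (simp add: wcoeff0 wp_dvd_iff[THEN iffD1, OF dvd_refl])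
  ultimately have "\<exists>t. wp dvd t - ?c \<and>
      (- wp * b) * t * witt_frob t + 1 * witt_frob t + (- 1) * t + a = 0"
    by (intro frob_bilinear_solvable) (simp_all only: wp_dvd_iff not_False_eq_True)
  thus ?thesis by (auto simp: algebra_simps)
qed

lemma wp_dvd_mult_iff:
  "wp dvd x * y \<longleftrightarrow> wp dvd x \<or> wp dvd (y :: 'k::{alg_closed_field, field_prime_char} witt)"
  by (simp add: wp_dvd_iff wcoeff_mult_0)

lemma wp_dvd_frob_iff:
  "wp dvd witt_frob x \<longleftrightarrow> wp dvd (x :: 'k::{alg_closed_field, field_prime_char} witt)"
  by (simp add: wp_dvd_iff wcoeff_frob_0)

lemma wp_not_dvd_1: "\<not> wp dvd (1 :: 'k::{alg_closed_field, field_prime_char} witt)"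
  by (simp add: wp_dvd_iff wcoeff_1_0)

text \<open>The ring of Witt vectors of the field with \<open>p\<^sup>2\<close> elements, as the fixed ring of \<open>\<sigma>\<^sup>2\<close>.\<close>

definition frob2_fixed :: "'k::comm_ring_prime_char witt \<Rightarrow> bool" where
  "frob2_fixed c \<longleftrightarrow> witt_frob (witt_frob c) = c"

lemma frob2_fixed_simps [simp]:
  "frob2_fixed 0" "frob2_fixed 1"
  "frob2_fixed c \<Longrightarrow> frob2_fixed (- c)"
  "frob2_fixed c \<Longrightarrow> frob2_fixed (witt_frob c)"
  "frob2_fixed c \<Longrightarrow> frob2_fixed d \<Longrightarrow> frob2_fixed (c * d)"
  "frob2_fixed c \<Longrightarrow> frob2_fixed d \<Longrightarrow> frob2_fixed (c + d)"
  by (simp_all add: frob2_fixed_def)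

lemma frob2_fixed_frob: "frob2_fixed c \<Longrightarrow> witt_frob (witt_frob c) = c"
  by (simp add: frob2_fixed_def)

lemma frob2_fixed_cancel:
  fixes c :: "'k::idom_prime_char witt"
  assumes "frob2_fixed (a * c)" "frob2_fixed a" "a \<noteq> 0"
  shows "frob2_fixed c"
  using assms by (simp add: frob2_fixed_def)

lemma witt_unit_inverse_fixed:
  fixes u :: "'k::{alg_closed_field, field_prime_char} witt"
  assumes "\<not> wp dvd u" "frob2_fixed u"
  shows "\<exists>v. u * v = 1 \<and> v dvd 1 \<and> frob2_fixed v"
proof -
  from assms obtain v where v: "1 = u * v" by (auto simp flip: witt_unit_iff)
  have "frob2_fixed (u * v)" by (simp flip: v)
  moreover have "u \<noteq> 0" using v by auto
  ultimately have "frob2_fixed v" using assms(2) by (intro frob2_fixed_cancel[of u v])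
  moreover have "v dvd 1" using v by (intro dvdI[of 1 v u]) (simp add: mult.commute)
  ultimately show ?thesis using v by (intro exI[of _ v]) simp
qed

section \<open>The skeleton of a lattice with an alternating form\<close>

text \<open>An integral alternating form compatible with \<open>F\<close> and \<open>V\<close>.  The sign \<open>\<epsilon>\<close> selects the skeleton that is
  used, and \<open>F L = V L\<close> is the part of superspeciality that does not involve a choice of
  generators.\<close>

locale alternating_dieudonne = dieudonne_module scale F V
  for scale :: "'k::{alg_closed_field, field_prime_char} witt \<Rightarrow> 'm::ab_group_add \<Rightarrow> 'm"
    (infixr "*s" 75) and F V +
  fixes L :: "'m set" and g :: nat and b :: "'m \<Rightarrow> 'm \<Rightarrow> 'k witt" and \<epsilon> :: "'k witt"
  assumes L_subspace: "subspace L"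
    and F_L: "F ` L \<subseteq> L"
    and F_V_L: "F ` L = V ` L"
    and b_add: "x \<in> L \<Longrightarrow> y \<in> L \<Longrightarrow> z \<in> L \<Longrightarrow> b x (y + z) = b x y + b x z"
    and b_scale: "x \<in> L \<Longrightarrow> y \<in> L \<Longrightarrow> b x (w *s y) = w * b x y"
    and b_alt [simp]: "x \<in> L \<Longrightarrow> b x x = 0"
    and b_skew: "x \<in> L \<Longrightarrow> y \<in> L \<Longrightarrow> b x y = - b y x"
    and b_F_V: "x \<in> L \<Longrightarrow> y \<in> L \<Longrightarrow> b (F x) y = witt_frob (b x (V y))"
    and b_nondeg: "x \<in> L \<Longrightarrow> (\<And>y. y \<in> L \<Longrightarrow> b x y = 0) \<Longrightarrow> x = 0"
    and eps: "\<epsilon> = 1 \<or> \<epsilon> = - 1"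
begin

lemma eps_simps [simp]: "\<epsilon> * \<epsilon> = 1" "\<epsilon> * (\<epsilon> * w) = w" "witt_frob \<epsilon> = \<epsilon>" "frob2_fixed \<epsilon>"
  using eps by (auto simp: frob2_fixed_def)

lemma L_closed [simp]:
  "0 \<in> L" "x \<in> L \<Longrightarrow> y \<in> L \<Longrightarrow> x + y \<in> L" "x \<in> L \<Longrightarrow> w *s x \<in> L"
  "x \<in> L \<Longrightarrow> y \<in> L \<Longrightarrow> x - y \<in> L" "x \<in> L \<Longrightarrow> - x \<in> L" "x \<in> L \<Longrightarrow> F x \<in> L" "x \<in> L \<Longrightarrow> V x \<in> L"
  using L_subspace F_L F_V_L
  by (auto simp: subspace_0 subspace_add subspace_scale subspace_diff subspace_neg)

lemma F_0 [simp]: "F 0 = 0"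
  using F_add[of 0 0] by simp

lemma F_minus: "F (- x) = - F x"
  using F_add[of x "- x"] by (simp add: eq_neg_iff_add_eq_0 add.commute)

lemma F_diff: "F (x - y) = F x - F y"
  using F_add[of x "- y"] by (simp add: F_minus)

lemma b_simps:
  shows "x \<in> L \<Longrightarrow> y \<in> L \<Longrightarrow> z \<in> L \<Longrightarrow> b x (y + z) = b x y + b x z"
    "x \<in> L \<Longrightarrow> y \<in> L \<Longrightarrow> z \<in> L \<Longrightarrow> b (y + z) x = b y x + b z x"
    "x \<in> L \<Longrightarrow> y \<in> L \<Longrightarrow> b x (w *s y) = w * b x y"
    "x \<in> L \<Longrightarrow> y \<in> L \<Longrightarrow> b (w *s y) x = w * b y x"
    "x \<in> L \<Longrightarrow> y \<in> L \<Longrightarrow> b x (- y) = - b x y"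
    "x \<in> L \<Longrightarrow> y \<in> L \<Longrightarrow> b (- y) x = - b y x"
    "x \<in> L \<Longrightarrow> y \<in> L \<Longrightarrow> z \<in> L \<Longrightarrow> b x (y - z) = b x y - b x z"
    "x \<in> L \<Longrightarrow> y \<in> L \<Longrightarrow> z \<in> L \<Longrightarrow> b (y - z) x = b y x - b z x"
proof -
  note skew = b_skew[of _ x]
  show add: "x \<in> L \<Longrightarrow> y \<in> L \<Longrightarrow> z \<in> L \<Longrightarrow> b x (y + z) = b x y + b x z" for y z
    by (rule b_add)
  show scale: "x \<in> L \<Longrightarrow> y \<in> L \<Longrightarrow> b x (w *s y) = w * b x y" for w y
    by (rule b_scale)
  show neg: "x \<in> L \<Longrightarrow> y \<in> L \<Longrightarrow> b x (- y) = - b x y" for y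
    using scale[of y "- 1"] by simp
  show diff: "x \<in> L \<Longrightarrow> y \<in> L \<Longrightarrow> z \<in> L \<Longrightarrow> b x (y - z) = b x y - b x z"
    using add[of y "- z"] by (simp add: neg)
  show "x \<in> L \<Longrightarrow> y \<in> L \<Longrightarrow> z \<in> L \<Longrightarrow> b (y + z) x = b y x + b z x"
    by (simp add: skew add)
  show "x \<in> L \<Longrightarrow> y \<in> L \<Longrightarrow> b (w *s y) x = w * b y x"
    by (simp add: skew scale)
  show "x \<in> L \<Longrightarrow> y \<in> L \<Longrightarrow> b (- y) x = - b y x"
    by (simp add: skew neg)
  show "x \<in> L \<Longrightarrow> y \<in> L \<Longrightarrow> z \<in> L \<Longrightarrow> b (y - z) x = b y x - b z x"
    by (simp add: skew diff)
qed

lemma b_0 [simp]: "x \<in> L \<Longrightarrow> b x 0 = 0" "x \<in> L \<Longrightarrow> b 0 x = 0"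
  using b_simps(3)[of x 0 0] b_simps(4)[of x 0 0] by auto

lemma b_sum_right:
  assumes "x \<in> L" "\<And>i. i \<in> A \<Longrightarrow> y i \<in> L"
  shows "b x (sum y A) = (\<Sum>i\<in>A. b x (y i))"
proof -
  have "sum y A \<in> L \<and> b x (sum y A) = (\<Sum>i\<in>A. b x (y i))"
    using assms by (induction A rule: infinite_finite_induct) (auto simp: b_simps)
  thus ?thesis ..
qed

lemma b_F_F: "x \<in> L \<Longrightarrow> y \<in> L \<Longrightarrow> b (F x) (F y) = wp * witt_frob (b x y)"
  by (simp add: b_F_V V_F b_simps)

lemma torsion_free:
  assumes "x \<in> L" "w *s x = 0" "w \<noteq> 0"
  shows "x = 0"
proof (rule b_nondeg[OF assms(1)])
  fix y assume "y \<in> L"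
  hence "w * b x y = 0" using assms b_simps(4)[of y x w] by simp
  thus "b x y = 0" using assms by simp
qed

lemma F_inject: "x \<in> L \<Longrightarrow> y \<in> L \<Longrightarrow> F x = F y \<Longrightarrow> x = y"
proof -
  assume xy: "x \<in> L" "y \<in> L" "F x = F y"
  have "V (F x) = V (F y)" using xy by simp
  hence "wp *s (x - y) = 0" by (simp add: V_F scale_right_diff_distrib)
  thus "x = y" using torsion_free[of "x - y" wp] xy by simp
qed

text \<open>A module over \<open>W(k\<^sub>2)[F]\<close> with \<open>F\<^sup>2 = \<epsilon> p\<close>, by \<open>skeleton_closed\<close> and \<open>F_F_skeleton\<close>.\<close>

definition skeleton :: "'m set" where
  "skeleton = {x \<in> L. V x = \<epsilon> *s F x}"

lemma skeleton_L [simp]: "x \<in> skeleton \<Longrightarrow> x \<in> L"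
  unfolding skeleton_def by simp

lemma V_skeleton: "x \<in> skeleton \<Longrightarrow> V x = \<epsilon> *s F x"
  unfolding skeleton_def by simp

lemma F_F_skeleton: "x \<in> skeleton \<Longrightarrow> F (F x) = (\<epsilon> * wp) *s x"
proof -
  assume x: "x \<in> skeleton"
  have "\<epsilon> *s F (F x) = wp *s x"
    using F_V[of x] by (simp add: V_skeleton[OF x] F_scale)
  hence "\<epsilon> *s \<epsilon> *s F (F x) = \<epsilon> *s wp *s x" by simp
  thus ?thesis by simp
qed

lemma V_scale_fixed: "frob2_fixed c \<Longrightarrow> V (c *s x) = witt_frob c *s V x"
  using V_scale[of "witt_frob c" x] by (simp add: frob2_fixed_def)

lemma skeleton_closed [simp]:
  "0 \<in> skeleton" "x \<in> skeleton \<Longrightarrow> y \<in> skeleton \<Longrightarrow> x + y \<in> skeleton" "x \<in> skeleton \<Longrightarrow> frob2_fixed c \<Longrightarrow> c *s x \<in> skeleton"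
  "x \<in> skeleton \<Longrightarrow> F x \<in> skeleton"
proof -
  show "0 \<in> skeleton" unfolding skeleton_def using V_add[of 0 0] by simp
  show "x + y \<in> skeleton" if "x \<in> skeleton" "y \<in> skeleton"
    using that unfolding skeleton_def by (simp add: V_add F_add scale_right_distrib)
  show "c *s x \<in> skeleton" if "x \<in> skeleton" "frob2_fixed c"
    using that unfolding skeleton_def by (simp add: V_scale_fixed F_scale mult.commute)
  show "F x \<in> skeleton" if "x \<in> skeleton"
    using F_F_skeleton[OF that] skeleton_L[OF that] unfolding skeleton_def by (simp add: V_F)
qed

lemma skeleton_closed' [simp]: "x \<in> skeleton \<Longrightarrow> - x \<in> skeleton" "x \<in> skeleton \<Longrightarrow> y \<in> skeleton \<Longrightarrow> x - y \<in> skeleton"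
proof -
  show 1: "- x \<in> skeleton" if "x \<in> skeleton" for x using skeleton_closed(3)[OF that, of "- 1"] by simp
  show "x - y \<in> skeleton" if "x \<in> skeleton" "y \<in> skeleton" using skeleton_closed(2)[OF that(1) 1[OF that(2)]] by simp
qed

lemma b_F_left: "x \<in> L \<Longrightarrow> y \<in> skeleton \<Longrightarrow> b (F x) y = \<epsilon> * witt_frob (b x (F y))"
  by (simp add: b_F_V V_skeleton b_simps)

text \<open>So \<open>b(x, F y)\<close> is hermitian on the skeleton for \<open>\<epsilon> = - 1\<close> and skew-hermitian for \<open>\<epsilon> = 1\<close>.\<close>

lemma b_F_swap: "x \<in> skeleton \<Longrightarrow> y \<in> skeleton \<Longrightarrow> b x (F y) = - \<epsilon> * witt_frob (b y (F x))"
  using b_skew[of x "F y"] b_F_left[of y x] by simp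

text \<open>Compare \<open>b(F\<^sup>2 x, F\<^sup>2 y) = p\<^sup>2 \<sigma>\<^sup>2(b(x, y))\<close> with \<open>F\<^sup>2 = \<epsilon> p\<close>.\<close>

lemma frob2_fixed_b [simp]: "x \<in> skeleton \<Longrightarrow> y \<in> skeleton \<Longrightarrow> frob2_fixed (b x y)"
proof -
  assume xy: "x \<in> skeleton" "y \<in> skeleton"
  have "b (F (F x)) (F (F y)) = wp * wp * witt_frob (witt_frob (b x y))"
    using xy by (simp add: b_F_F mult.assoc)
  moreover have "b (F (F x)) (F (F y)) = wp * wp * b x y"
  proof -
    have "b (F (F x)) (F (F y)) = (\<epsilon> * wp) * ((\<epsilon> * wp) * b x y)"
      using xy by (simp only: F_F_skeleton b_simps skeleton_L L_closed)
    also have "\<dots> = (\<epsilon> * \<epsilon>) * (wp * wp * b x y)" by (simp only: mult_ac)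
    finally show ?thesis by simp
  qed
  ultimately show ?thesis by (simp add: frob2_fixed_def)
qed

text \<open>Orthogonality for the quaternionic form: it is a symmetric relation, and each \<open>perp e\<close> is a
  submodule over \<open>W(k\<^sub>2)[F]\<close>.\<close>

definition perp :: "'m \<Rightarrow> 'm set" where
  "perp e = {x \<in> skeleton. b e x = 0 \<and> b e (F x) = 0}"

lemma perpD: "x \<in> perp e \<Longrightarrow> x \<in> skeleton" "x \<in> perp e \<Longrightarrow> b e x = 0" "x \<in> perp e \<Longrightarrow> b e (F x) = 0"
  by (simp_all add: perp_def)

lemma perp_closed:
  assumes "e \<in> skeleton"
  shows "x \<in> perp e \<Longrightarrow> y \<in> perp e \<Longrightarrow> x + y \<in> perp e"
    "x \<in> perp e \<Longrightarrow> frob2_fixed c \<Longrightarrow> c *s x \<in> perp e" "x \<in> perp e \<Longrightarrow> F x \<in> perp e"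
  using assms by (auto simp: perp_def b_simps F_add F_scale F_F_skeleton)

lemma perp_sym: "e \<in> skeleton \<Longrightarrow> x \<in> perp e \<Longrightarrow> e \<in> perp x"
  using b_skew[of x e] b_F_swap[of x e] by (auto simp: perp_def)

text \<open>Skeleton vectors whose classes form a basis of \<open>L / F L\<close> over the residue field.  During the
  reduction only this residual information is tracked, which makes changes inside \<open>F L\<close>
  free; that the vectors and their images under \<open>F\<close> form a basis of \<open>L\<close> is recovered
  at the end from the Gram matrix.\<close>

definition frame :: "(nat \<Rightarrow> 'm) \<Rightarrow> bool" where
  "frame y \<longleftrightarrow> (\<forall>i<g. y i \<in> skeleton) \<and>
     (\<forall>x\<in>L. \<exists>a. x - (\<Sum>i<g. a i *s y i) \<in> F ` L) \<and>
     (\<forall>a. (\<Sum>i<g. a i *s y i) \<in> F ` L \<longrightarrow> (\<forall>i<g. wp dvd a i))"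

lemma frameD:
  assumes "frame y"
  shows "i < g \<Longrightarrow> y i \<in> skeleton"
    and "x \<in> L \<Longrightarrow> \<exists>a. x - (\<Sum>i<g. a i *s y i) \<in> F ` L"
    and "(\<Sum>i<g. a i *s y i) \<in> F ` L \<Longrightarrow> i < g \<Longrightarrow> wp dvd a i"
  using assms unfolding frame_def by blast+

lemma F_L_subspace: "subspace (F ` L)"
proof (rule subspaceI)
  show "0 \<in> F ` L" by (rule image_eqI[of _ _ 0]) auto
  show "x + y \<in> F ` L" if xy: "x \<in> F ` L" "y \<in> F ` L" for x y
  proof -
    obtain u v where "x = F u" "u \<in> L" "y = F v" "v \<in> L" using xy by blast
    thus ?thesis by (intro image_eqI[of _ _ "u + v"]) (auto simp: F_add)
  qed
  show "c *s x \<in> F ` L" if x: "x \<in> F ` L" for c x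
  proof -
    obtain u where "x = F u" "u \<in> L" using x by blast
    thus ?thesis
      by (intro image_eqI[of _ _ "witt_frob_inv c *s u"]) (auto simp: F_scale witt_frob_inv)
  qed
qed

lemmas F_L_closed = subspace_0[OF F_L_subspace] subspace_add[OF F_L_subspace]
  subspace_diff[OF F_L_subspace] subspace_scale[OF F_L_subspace] subspace_sum[OF F_L_subspace]
  subspace_neg[OF F_L_subspace]

text \<open>The reduction scales vectors by units and adds multiples of one pivot vector \<open>y m\<close> to the others.  Modulo
  \<open>F L\<close> this is an invertible change of basis: coefficients \<open>a\<close> for \<open>y'\<close> correspond to the
  coefficients \<open>a i * c i\<close> for \<open>y\<close>, with \<open>\<Sum> a j * d j\<close> added at the pivot.\<close>

lemma frame_change:
  assumes y: "frame y" and m: "m < g" and skeleton: "\<And>i. i < g \<Longrightarrow> y' i \<in> skeleton"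
    and c: "\<And>i. i < g \<Longrightarrow> c i dvd 1" and d: "d m = 0"
    and y': "\<And>i. i < g \<Longrightarrow> y' i - (c i *s y i + d i *s y m) \<in> F ` L"
  shows "frame y'"
proof -
  have transf: "(\<Sum>i<g. a i *s y' i) - (\<Sum>i<g. e i *s y i) \<in> F ` L"
    if e: "\<And>i. i < g \<Longrightarrow> e i = a i * c i + (if i = m then \<Sum>j<g. a j * d j else 0)" for a e
  proof -
    have "(\<Sum>i<g. e i *s y i) =
        (\<Sum>i<g. (a i * c i) *s y i) + (\<Sum>i<g. (if i = m then \<Sum>j<g. a j * d j else 0) *s y i)"
      by (simp add: e scale_left_distrib sum.distrib)
    also have "(\<Sum>i<g. (if i = m then \<Sum>j<g. a j * d j else 0) *s y i) =
        (\<Sum>i<g. if i = m then (\<Sum>j<g. a j * d j) *s y m else 0)"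
      by (intro sum.cong) auto
    also have "\<dots> = (\<Sum>j<g. (a j * d j) *s y m)" using m by (simp add: scale_sum_left)
    also have "(\<Sum>i<g. (a i * c i) *s y i) + (\<Sum>j<g. (a j * d j) *s y m) =
        (\<Sum>i<g. a i *s (c i *s y i + d i *s y m))"
      by (simp add: sum.distrib scale_right_distrib)
    finally have "(\<Sum>i<g. a i *s y' i) - (\<Sum>i<g. e i *s y i) =
        (\<Sum>i<g. a i *s (y' i - (c i *s y i + d i *s y m)))"
      by (simp add: sum_subtractf scale_right_diff_distrib)
    also have "\<dots> \<in> F ` L"
      by (intro subspace_sum[OF F_L_subspace] subspace_scale[OF F_L_subspace] y') simp
    finally show ?thesis .
  qed
  have "\<exists>a. x - (\<Sum>i<g. a i *s y' i) \<in> F ` L" if x: "x \<in> L" for x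
  proof -
    obtain e where e: "x - (\<Sum>i<g. e i *s y i) \<in> F ` L" using frameD(2)[OF y x] by blast
    have "\<exists>u. c i * u = 1" if "i < g" for i using c[OF that] by (metis dvdE)
    then obtain u where u: "\<And>i. i < g \<Longrightarrow> c i * u i = 1" by metis
    \<comment> \<open>the correspondence of coefficients inverted: first away from the pivot, then at it\<close>
    define a where "a = (\<lambda>i. if i = m then (e m - (\<Sum>j\<in>{..<g} - {m}. e j * u j * d j)) * u m else e i * u i)"
    have "(\<Sum>j<g. a j * d j) = (\<Sum>j\<in>{..<g} - {m}. a j * d j)"
      using m d by (subst sum.remove[of _ m]) auto
    also have "\<dots> = (\<Sum>j\<in>{..<g} - {m}. e j * u j * d j)"
      by (intro sum.cong) (auto simp: a_def)
    finally have ad: "(\<Sum>j<g. a j * d j) = (\<Sum>j\<in>{..<g} - {m}. e j * u j * d j)" .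
    have "e i = a i * c i + (if i = m then \<Sum>j<g. a j * d j else 0)" if "i < g" for i
      unfolding ad using u[OF that] by (auto simp: a_def mult.assoc mult.commute[of "u _"])
    from F_L_closed(3)[OF e transf[OF this]] show ?thesis
      by (intro exI[of _ a]) simp
  qed
  moreover have "\<forall>i<g. wp dvd a i" if a: "(\<Sum>i<g. a i *s y' i) \<in> F ` L" for a
  proof -
    define e where "e = (\<lambda>i. a i * c i + (if i = m then \<Sum>j<g. a j * d j else 0))"
    have "(\<Sum>i<g. e i *s y i) \<in> F ` L"
      using F_L_closed(3)[OF a transf[of e a]] by (simp add: e_def)
    hence e: "wp dvd e i" if "i < g" for i using frameD(3)[OF y _ that] by blast
    have c': "\<not> wp dvd c i" if "i < g" for i using c[OF that] by (simp add: witt_unit_iff)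
    have 1: "wp dvd a i" if "i < g" "i \<noteq> m" for i
      using e[OF that(1)] that c'[OF that(1)] by (simp add: e_def wp_dvd_mult_iff)
    hence "wp dvd (\<Sum>j<g. a j * d j)" using d by (intro dvd_sum) (metis dvd_0_right dvd_mult2 lessThan_iff mult_zero_right)
    hence "wp dvd a m * c m" using e[OF m] by (simp add: e_def dvd_add_left_iff)
    thus ?thesis using 1 c'[OF m] by (auto simp: wp_dvd_mult_iff)
  qed
  ultimately show ?thesis unfolding frame_def using skeleton by blast
qed

lemma frame_permute:
  assumes y: "frame y" and \<pi>: "bij_betw \<pi> {..<g} {..<g}"
  shows "frame (\<lambda>i. y (\<pi> i))"
proof -
  define \<rho> where "\<rho> = the_inv_into {..<g} \<pi>"
  have \<rho>: "\<rho> (\<pi> i) = i" if "i < g" for i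
    using that \<pi> by (simp add: \<rho>_def the_inv_into_f_f bij_betw_def)
  have \<pi>g: "\<pi> i < g" if "i < g" for i using \<pi> that by (auto simp: bij_betw_def)
  have sum: "(\<Sum>i<g. h (\<pi> i)) = (\<Sum>i<g. h i)" for h :: "nat \<Rightarrow> 'm"
    by (rule sum.reindex_bij_betw[OF \<pi>])
  have sum': "(\<Sum>i<g. a i *s y (\<pi> i)) = (\<Sum>i<g. a (\<rho> i) *s y i)" for a
    using sum[of "\<lambda>i. a (\<rho> i) *s y i"] by (simp add: \<rho>)
  show ?thesis unfolding frame_def
  proof (intro conjI allI ballI impI)
    show "y (\<pi> i) \<in> skeleton" if "i < g" for i by (rule frameD(1)[OF y \<pi>g[OF that]])
  next
    fix x assume "x \<in> L"
    then obtain a where "x - (\<Sum>i<g. a i *s y i) \<in> F ` L" using frameD(2)[OF y] by blast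
    thus "\<exists>a. x - (\<Sum>i<g. a i *s y (\<pi> i)) \<in> F ` L"
      using sum[of "\<lambda>i. a i *s y i"] by (intro exI[of _ "\<lambda>i. a (\<pi> i)"]) simp
  next
    fix a i assume "(\<Sum>i<g. a i *s y (\<pi> i)) \<in> F ` L" and i: "i < g"
    hence "\<forall>i<g. wp dvd a (\<rho> i)" unfolding sum' using frameD(3)[OF y, of "\<lambda>i. a (\<rho> i)"] by blast
    thus "wp dvd a i" using \<pi>g[OF i] \<rho>[OF i] by metis
  qed
qed

lemma frame_swap:
  assumes "frame y" "i < g" "j < g"
  shows "frame (\<lambda>k. y (transpose i j k))"
proof (rule frame_permute[OF assms(1)])
  show "bij_betw (transpose i j) {..<g} {..<g}"
    by (rule bij_betw_byWitness[of _ "transpose i j"])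
      (use assms in \<open>auto simp: transpose_def\<close>)
qed

lemma frame_not_F:
  assumes "frame y" "m < g"
  shows "y m \<notin> F ` L"
proof
  assume "y m \<in> F ` L"
  moreover have "(\<Sum>i<g. (if i = m then 1 else 0) *s y i) = (\<Sum>i<g. if i = m then y m else 0)"
    by (rule sum.cong) auto
  ultimately have "(\<Sum>i<g. (if i = m then 1 else 0) *s y i) \<in> F ` L" using assms by simp
  from frameD(3)[OF assms(1) this assms(2)] have "wp dvd (if m = m then 1 else 0 :: 'k witt)" .
  thus False by (simp add: wp_not_dvd_1)
qed

text \<open>The residual non-degeneracy argument, common to both parities of \<open>g\<close>.  The function \<open>h\<close> is
  \<open>b(y\<^sub>m, -)\<close> or \<open>b(y\<^sub>m, F(-))\<close>, and the last hypothesis says that its reduction can vanish identically only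
  if \<open>y\<^sub>m\<close> is residually zero.\<close>

lemma frame_detects:
  assumes y: "frame y" and m: "m < g"
    and h_add: "\<And>u v. u \<in> L \<Longrightarrow> v \<in> L \<Longrightarrow> h (u + v) = h u + h v"
    and h_scale: "\<And>w u. u \<in> L \<Longrightarrow> wp dvd h u \<Longrightarrow> wp dvd h (w *s u)"
    and h_F: "\<And>z. z \<in> L \<Longrightarrow> wp dvd h (F z)"
    and h_F_L: "(\<And>u. u \<in> L \<Longrightarrow> wp dvd h u) \<Longrightarrow> y m \<in> F ` L"
  shows "\<exists>j<g. \<not> wp dvd (h (y j) :: 'k witt)"
proof (rule ccontr)
  assume "\<not> ?thesis"
  hence j: "\<And>j. j < g \<Longrightarrow> wp dvd h (y j)" by blast
  have yL: "y i \<in> L" if "i < g" for i using frameD(1)[OF y that] by simp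
  have sum: "(\<Sum>i<n. a i *s y i) \<in> L \<and> wp dvd h (\<Sum>i<n. a i *s y i)" if "n \<le> g" for n a
    using that
  proof (induction n)
    case 0
    show ?case using h_F[of 0] by simp
  next
    case (Suc n)
    thus ?case using j[of n] yL[of n] by (simp add: h_add h_scale dvd_add)
  qed
  have "wp dvd h u" if u: "u \<in> L" for u
  proof -
    obtain a z where az: "u - (\<Sum>i<g. a i *s y i) = F z" "z \<in> L" using frameD(2)[OF y u] by blast
    hence "u = (\<Sum>i<g. a i *s y i) + F z" by (simp add: algebra_simps)
    hence "h u = h (\<Sum>i<g. a i *s y i) + h (F z)" using h_add sum[of g a] az by simp
    thus ?thesis using sum[of g a] h_F[of z] az by (simp add: dvd_add)
  qed
  from h_F_L[OF this] show False using frame_not_F[OF y m] by blast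
qed

text \<open>The state of the reduction after \<open>k\<close> vectors: their Gram matrix has the prescribed entries
  \<open>G i j = b(y\<^sub>i, y\<^sub>j)\<close> and \<open>H i j = b(y\<^sub>i, F y\<^sub>j)\<close>, and the remaining vectors are orthogonal to
  them.\<close>

definition reduced :: "(nat \<Rightarrow> nat \<Rightarrow> 'k witt) \<Rightarrow> (nat \<Rightarrow> nat \<Rightarrow> 'k witt) \<Rightarrow> nat \<Rightarrow> (nat \<Rightarrow> 'm) \<Rightarrow> bool" where
  "reduced G H k y \<longleftrightarrow> frame y \<and> k \<le> g \<and>
     (\<forall>i<k. \<forall>j<k. b (y i) (y j) = G i j \<and> b (y i) (F (y j)) = H i j) \<and>
     (\<forall>i<k. \<forall>j<g. k \<le> j \<longrightarrow> y j \<in> perp (y i))"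

definition complement :: "nat \<Rightarrow> (nat \<Rightarrow> 'm) \<Rightarrow> 'm set" where
  "complement k y = {x \<in> skeleton. \<forall>i<k. x \<in> perp (y i)}"

lemma complement_skeleton: "x \<in> complement k y \<Longrightarrow> x \<in> skeleton"
  by (simp add: complement_def)

lemma complement_closed:
  assumes "reduced G H k y"
  shows "x \<in> complement k y \<Longrightarrow> z \<in> complement k y \<Longrightarrow> x + z \<in> complement k y"
    "x \<in> complement k y \<Longrightarrow> frob2_fixed c \<Longrightarrow> c *s x \<in> complement k y"
    "x \<in> complement k y \<Longrightarrow> F x \<in> complement k y"
proof -
  have "y i \<in> skeleton" if "i < k" for i using assms that frameD(1)[of y i] unfolding reduced_def by auto
  thus "x \<in> complement k y \<Longrightarrow> z \<in> complement k y \<Longrightarrow> x + z \<in> complement k y"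
    "x \<in> complement k y \<Longrightarrow> frob2_fixed c \<Longrightarrow> c *s x \<in> complement k y"
    "x \<in> complement k y \<Longrightarrow> F x \<in> complement k y"
    by (auto simp: complement_def perp_closed)
qed

lemma complement_diff:
  assumes "reduced G H k y" "x \<in> complement k y" "z \<in> complement k y"
  shows "x - z \<in> complement k y"
  using complement_closed(1)[OF assms(1,2) complement_closed(2)[OF assms(1,3), of "- 1"]] by simp

text \<open>One step of the reduction.  It suffices to look at the new vectors \<open>y'\<^sub>k, \<dots>, y'\<^sub>l\<^sub>-\<^sub>1\<close> and the
  later ones, as long as everything takes place in the complement of the old vectors.\<close>

lemma reduced_extend:
  assumes y: "reduced G H k y" and y': "frame y'"
    and old: "\<And>i. i < k \<Longrightarrow> y' i = y i"
    and new: "\<And>j. k \<le> j \<Longrightarrow> j < g \<Longrightarrow> y' j \<in> complement k y"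
    and l: "k \<le> l" "l \<le> g"
    and gram: "\<And>i j. i \<in> {k..<l} \<Longrightarrow> j \<in> {k..<l} \<Longrightarrow>
                 b (y' i) (y' j) = G i j \<and> b (y' i) (F (y' j)) = H i j"
    and perp: "\<And>i j. i \<in> {k..<l} \<Longrightarrow> j \<in> {l..<g} \<Longrightarrow> y' j \<in> perp (y' i)"
    and GH0: "\<And>i j. i < k \<Longrightarrow> k \<le> j \<Longrightarrow> G i j = 0 \<and> H i j = 0 \<and> G j i = 0 \<and> H j i = 0"
  shows "reduced G H l y'"
proof -
  have cross: "y' j \<in> perp (y' i)" if "i < k" "k \<le> j" "j < g" for i j
    using new[OF that(2,3)] that(1) by (simp add: old complement_def)
  have skeleton: "y' i \<in> skeleton" if "i < g" for i by (rule frameD(1)[OF y' that])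
  have "b (y' i) (y' j) = G i j \<and> b (y' i) (F (y' j)) = H i j" if ij: "i < l" "j < l" for i j
  proof -
    consider "i < k" "j < k" | "i < k" "k \<le> j" | "k \<le> i" "j < k" | "k \<le> i" "k \<le> j" by linarith
    thus ?thesis
    proof cases
      case 1 thus ?thesis using y by (simp add: old reduced_def)
    next
      case 2
      hence "y' j \<in> perp (y' i)" using cross ij l by simp
      thus ?thesis using GH0[OF 2] by (simp add: perpD)
    next
      case 3
      hence "y' i \<in> perp (y' j)" using cross[of j i] ij l by simp
      hence "y' j \<in> perp (y' i)" by (rule perp_sym[rotated]) (use skeleton 3 ij l in simp)
      thus ?thesis using GH0[OF 3(2,1)] by (simp add: perpD)
    next
      case 4 thus ?thesis using gram ij by simp
    qed
  qed
  moreover have "y' j \<in> perp (y' i)" if "i < l" "l \<le> j" "j < g" for i j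
    using cross[of i j] perp[of i j] that l by (cases "i < k") simp_all
  ultimately show ?thesis using y' l by (simp add: reduced_def)
qed

lemma reducedD:
  assumes "reduced G H k y"
  shows "frame y" "k \<le> g" "i < k \<Longrightarrow> j < k \<Longrightarrow> b (y i) (y j) = G i j"
    "i < k \<Longrightarrow> j < k \<Longrightarrow> b (y i) (F (y j)) = H i j"
    "i < k \<Longrightarrow> k \<le> j \<Longrightarrow> j < g \<Longrightarrow> y j \<in> perp (y i)"
    "k \<le> j \<Longrightarrow> j < g \<Longrightarrow> y j \<in> complement k y"
  using assms frameD(1)[of y] unfolding reduced_def complement_def by blast+

lemma reduced_perp_sym:
  assumes "reduced G H k y" "i < k" "k \<le> j" "j < g"
  shows "y i \<in> perp (y j)"
  using perp_sym[OF frameD(1)[OF reducedD(1)[OF assms(1)]] reducedD(5)[OF assms]] assms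
    reducedD(2)[OF assms(1)] by simp

lemma reduced_swap:
  assumes y: "reduced G H k y" and ij: "k \<le> i" "i < g" "k \<le> j" "j < g"
  shows "reduced G H k (\<lambda>n. y (transpose i j n))"
proof -
  have old: "transpose i j n = n" if "n < k" for n using that ij by (auto simp: transpose_def)
  have new: "k \<le> transpose i j n \<and> transpose i j n < g" if "k \<le> n" "n < g" for n
    using that ij by (auto simp: transpose_def)
  show ?thesis unfolding reduced_def
    using frame_swap[OF reducedD(1)[OF y], of i j] reducedD[OF y] ij
    by (simp add: old new)
qed

lemma reduced_replace:
  assumes y: "reduced G H k y" and y': "frame y'"
    and old: "\<And>i. i < k \<Longrightarrow> y' i = y i"
    and new: "\<And>j. k \<le> j \<Longrightarrow> j < g \<Longrightarrow> y' j \<in> complement k y"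
    and GH0: "\<And>i j. i < k \<Longrightarrow> k \<le> j \<Longrightarrow> G i j = 0 \<and> H i j = 0 \<and> G j i = 0 \<and> H j i = 0"
  shows "reduced G H k y'"
  by (rule reduced_extend[OF y y' old new, where l = k])
    (use reducedD(2)[OF y] GH0 new in \<open>auto simp: complement_def old\<close>)

end

section \<open>Gram-Schmidt reduction for odd genus\<close>

locale odd_lattice = alternating_dieudonne +
  assumes eps_odd: "\<epsilon> = - 1"
    and odd_nondeg: "x \<in> L \<Longrightarrow> (\<And>m. m \<in> L \<Longrightarrow> wp dvd b x m) \<Longrightarrow> \<exists>z\<in>L. x = wp *s z"
begin

text \<open>The hermitian form \<open>b(x, F y)\<close> vanishes modulo \<open>p\<close> for \<open>y\<close> in \<open>F L\<close>.  If it vanishes modulo \<open>p\<close> for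
  \<open>x = y\<^sub>m\<close> and all \<open>y\<close>, then \<open>b(F y\<^sub>m, L) \<subseteq> p W\<close>, so \<open>F y\<^sub>m\<close> lies in \<open>p L = F V L\<close> and \<open>y\<^sub>m\<close> in
  \<open>V L = F L\<close>.\<close>

lemma odd_pairing:
  assumes y: "frame y" and m: "m < g"
  shows "\<exists>j<g. \<not> wp dvd b (y m) (F (y j))"
proof (rule frame_detects[OF y m])
  note ym = frameD(1)[OF y m]
  show "b (y m) (F (u + v)) = b (y m) (F u) + b (y m) (F v)" if "u \<in> L" "v \<in> L" for u v
    using that ym by (simp add: F_add b_simps)
  show "wp dvd b (y m) (F (w *s u))" if "u \<in> L" "wp dvd b (y m) (F u)" for w u
    using that ym by (simp add: F_scale b_simps)
  show "wp dvd b (y m) (F (F z))" if "z \<in> L" for z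
  proof -
    have "b (y m) (F (F z)) = - b (F (F z)) (y m)" using that ym by (intro b_skew) auto
    also have "\<dots> = - (witt_frob (\<epsilon> * (wp * witt_frob (b z (y m)))))"
      using that ym by (simp add: b_F_V[of "F z"] V_skeleton b_simps b_F_F)
    finally show ?thesis by simp
  qed
next
  note ym = frameD(1)[OF y m]
  assume dvd: "\<And>u. u \<in> L \<Longrightarrow> wp dvd b (y m) (F u)"
  have "\<exists>z\<in>L. F (y m) = wp *s z"
  proof (rule odd_nondeg)
    fix v assume v: "v \<in> L"
    then obtain u where "V v = F u" "u \<in> L" using F_V_L by blast
    thus "wp dvd b (F (y m)) v" using dvd ym v by (simp add: b_F_V wp_dvd_frob_iff)
  qed (use ym in simp)
  then obtain z where z: "z \<in> L" "F (y m) = wp *s z" by blast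
  hence "F (y m) = F (V z)" by (simp add: F_V)
  hence "y m = V z" using F_inject z ym by simp
  thus "y m \<in> F ` L" using z F_V_L by simp
qed

lemma herm: "x \<in> skeleton \<Longrightarrow> y \<in> skeleton \<Longrightarrow> b x (F y) = witt_frob (b y (F x))"
  using b_F_swap[of x y] by (simp add: eps_odd)

abbreviation "odd_G \<equiv> \<lambda>(i::nat) (j::nat). 0 :: 'a witt"
abbreviation "odd_H \<equiv> \<lambda>(i::nat) (j::nat). if i = j then 1 else 0 :: 'a witt"

text \<open>A non-degenerate hermitian form over a finite field has an anisotropic vector.  If \<open>x\<close> and \<open>y\<close> are
  residually isotropic and \<open>u = b(x, F y)\<close> is a unit, then the value at \<open>x + c y\<close> is residually the
  trace of \<open>\<sigma>(c) u\<close>, and \<open>c\<close> can be chosen such that this trace is \<open>1\<close>.\<close>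

lemma odd_unit_diagonal:
  assumes y: "reduced odd_G odd_H k y" and k: "k < g"
  shows "\<exists>y'. reduced odd_G odd_H k y' \<and> \<not> wp dvd b (y' k) (F (y' k))"
proof -
  obtain j where j: "j < g" "\<not> wp dvd b (y k) (F (y j))"
    using odd_pairing[OF reducedD(1)[OF y] k] by blast
  have kj: "k \<le> j"
  proof (rule ccontr)
    assume "\<not> k \<le> j"
    hence "y j \<in> perp (y k)" using reduced_perp_sym[OF y, of j k] k by simp
    thus False using j by (simp add: perpD)
  qed
  note yk = frameD(1)[OF reducedD(1)[OF y] k] and yj = frameD(1)[OF reducedD(1)[OF y] j(1)]
  consider "\<not> wp dvd b (y k) (F (y k))" | "\<not> wp dvd b (y j) (F (y j))"
    | "wp dvd b (y k) (F (y k))" "wp dvd b (y j) (F (y j))" by blast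
  thus ?thesis
  proof cases
    case 1
    thus ?thesis using y by blast
  next
    case 2
    have "reduced odd_G odd_H k (\<lambda>n. y (transpose k j n))"
      using y k j kj by (intro reduced_swap) auto
    thus ?thesis using 2 by (intro exI[of _ "\<lambda>n. y (transpose k j n)"]) simp
  next
    case 3
    hence jk: "j \<noteq> k" using j by auto
    define u where "u = b (y k) (F (y j))"
    have u: "frob2_fixed u" using yk yj by (simp add: u_def)
    obtain v where v: "u * v = 1" and vf: "frob2_fixed v"
      using witt_unit_inverse_fixed[OF j(2)[folded u_def] u] by blast
    obtain d :: "'a witt" where d: "d + witt_frob d = 1" using witt_trace_one by blast
    have "witt_frob d + witt_frob (witt_frob d) = 1" using arg_cong[OF d, of witt_frob] by simp
    hence "witt_frob d + witt_frob (witt_frob d) = witt_frob d + d" using d by (simp only: add.commute)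
    hence df: "frob2_fixed d" by (simp add: frob2_fixed_def)
    \<comment> \<open>chosen such that \<open>\<sigma>(c) u = d\<close>\<close>
    define c where "c = witt_frob (d * v)"
    have cf: "frob2_fixed c" using df vf by (simp add: c_def)
    have cu: "witt_frob c * u = d"
      using df vf v by (simp add: c_def frob2_fixed_frob mult.assoc mult.commute[of v])
    define x where "x = y k + c *s y j"
    have xS: "x \<in> skeleton" using yk yj cf by (simp add: x_def)
    have "b x (F x) = b (y k) (F (y k)) + witt_frob c * u + c * b (y j) (F (y k))
        + c * witt_frob c * b (y j) (F (y j))"
      using yk yj by (simp add: x_def F_add F_scale b_simps u_def algebra_simps)
    also have "b (y j) (F (y k)) = witt_frob u" unfolding u_def by (rule herm[OF yj yk])
    also have "c * witt_frob u = witt_frob d"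
      unfolding cu[symmetric] using cf by (simp add: frob2_fixed_frob)
    finally have "b x (F x) = b (y k) (F (y k)) + (d + witt_frob d) + c * witt_frob c * b (y j) (F (y j))"
      by (simp add: cu add.assoc)
    hence "1 = b x (F x) - b (y k) (F (y k)) - c * witt_frob c * b (y j) (F (y j))"
      by (simp add: d)
    hence x: "\<not> wp dvd b x (F x)" using 3 wp_not_dvd_1[where 'k = 'a] by (metis dvd_diff dvd_mult)
    let ?y = "y(k := x)"
    have "frame ?y"
    proof (rule frame_change[OF reducedD(1)[OF y] j(1), where c = "\<lambda>_. 1" and d = "\<lambda>i. if i = k then c else 0"])
      show "?y i \<in> skeleton" if "i < g" for i using xS frameD(1)[OF reducedD(1)[OF y] that] by simp
      show "(if j = k then c else 0) = 0" using jk by simp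
    qed (use F_L_closed(1) in \<open>auto simp: x_def\<close>)
    hence "reduced odd_G odd_H k ?y"
    proof (rule reduced_replace[OF y])
      fix i assume "k \<le> i" "i < g"
      moreover have "x \<in> complement k y" unfolding x_def
        using reducedD(6)[OF y, of k] reducedD(6)[OF y, of j] k j kj cf
        by (intro complement_closed[OF y]) auto
      ultimately show "?y i \<in> complement k y" using reducedD(6)[OF y] by simp
    qed auto
    thus ?thesis using x by (intro exI[of _ ?y]) simp
  qed
qed

text \<open>The value \<open>a = b(z\<^sub>k, F z\<^sub>k)\<close> is fixed by \<open>\<sigma>\<close>, and scaling \<open>z\<^sub>k\<close> by \<open>c\<close> multiplies it by \<open>c \<sigma>(c)\<close>.  A
  solution of \<open>a c \<sigma>(c) = 1\<close> satisfies \<open>\<sigma>\<^sup>2(c) = c\<close>, so \<open>e = c z\<^sub>k\<close> is again a skeleton vector, and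
  \<open>b(e, F e) = 1\<close> allows to project the later vectors to the complement of \<open>e\<close> and \<open>F e\<close>.\<close>

lemma odd_step:
  assumes y: "reduced odd_G odd_H k y" and k: "k < g"
  shows "\<exists>y'. reduced odd_G odd_H (Suc k) y'"
proof -
  obtain z where z: "reduced odd_G odd_H k z" and unit: "\<not> wp dvd b (z k) (F (z k))"
    using odd_unit_diagonal[OF y k] by blast
  note zS = frameD(1)[OF reducedD(1)[OF z]]
  define a where "a = b (z k) (F (z k))"
  have a: "witt_frob a = a" unfolding a_def by (rule herm[OF zS[OF k] zS[OF k], symmetric])
  have "a dvd 1" using unit by (simp add: a_def witt_unit_iff)
  then obtain c where c: "a * c * witt_frob c = 1" using witt_norm_solvable by blast
  hence nz: "a * witt_frob c \<noteq> 0" and "c dvd 1" by (auto intro: dvdI[of 1 c "a * witt_frob c"] simp: mult_ac)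
  have "a * witt_frob c * witt_frob (witt_frob c) = a * witt_frob c * c"
    using arg_cong[OF c, of witt_frob] c a by (simp add: mult_ac)
  hence cf: "frob2_fixed c" using nz by (simp add: frob2_fixed_def)
  define e where "e = c *s z k"
  have eS: "e \<in> skeleton" using zS[OF k] cf by (simp add: e_def)
  have ee: "b e (F e) = 1" using zS[OF k] c by (simp add: e_def F_scale b_simps a_def mult_ac)
  define \<alpha> \<beta> where "\<alpha> = (\<lambda>j. witt_frob (b e (F (z j))))" and "\<beta> = (\<lambda>j. b e (z j))"
  have fixed: "frob2_fixed (\<alpha> j)" "frob2_fixed (\<beta> j)" if "j < g" for j
    using eS zS[OF that] by (auto simp: \<alpha>_def \<beta>_def)
  define y' where "y' = (\<lambda>j. if j < k then z j else if j = k then e else z j - (\<alpha> j *s e + \<beta> j *s F e))"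
  have "frame y'"
  proof (rule frame_change[OF reducedD(1)[OF z] k, where c = "\<lambda>i. if i = k then c else 1"
        and d = "\<lambda>j. if j \<le> k then 0 else - \<alpha> j * c"])
    show "y' i \<in> skeleton" if "i < g" for i
      using that eS zS[OF that] fixed[OF that] by (simp add: y'_def)
    fix i assume i: "i < g"
    show "(if i = k then c else 1) dvd 1" using \<open>c dvd 1\<close> by simp
    show "y' i - ((if i = k then c else 1) *s z i + (if i \<le> k then 0 else - \<alpha> i * c) *s z k) \<in> F ` L"
    proof (cases "i > k")
      case True
      have "y' i - (z i + (- \<alpha> i * c) *s z k) = \<beta> i *s (F (- e))"
        using True by (simp add: y'_def e_def F_minus)
      also have "\<dots> \<in> F ` L" using eS by (intro subspace_scale[OF F_L_subspace] imageI) simp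
      finally show ?thesis using True by simp
    next
      case False
      thus ?thesis using F_L_closed(1) by (simp add: y'_def e_def)
    qed
  qed simp
  hence "reduced odd_G odd_H (Suc k) y'"
  proof (rule reduced_extend[OF z])
    show "y' j \<in> complement k z" if j: "k \<le> j" "j < g" for j
    proof -
      have zj: "z j \<in> complement k z" and e: "e \<in> complement k z"
        using reducedD(6)[OF z] j k cf unfolding e_def by (auto intro: complement_closed(2)[OF z])
      moreover have "\<alpha> j *s e + \<beta> j *s F e \<in> complement k z"
        using e fixed[OF j(2)] by (intro complement_closed[OF z])
      ultimately show ?thesis using j by (auto simp: y'_def intro: complement_diff[OF z])
    qed
    show "y' j \<in> perp (y' i)" if i: "i \<in> {k..<Suc k}" and j: "j \<in> {Suc k..<g}" for i j
    proof -
      have jg: "j < g" using j by simp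
      have FFe: "F (F e) = (- wp) *s e" using F_F_skeleton[OF eS] by (simp add: eps_odd)
      have "b e (z j - (\<alpha> j *s e + \<beta> j *s F e)) = 0"
        using eS zS[OF jg] ee by (simp add: b_simps \<beta>_def)
      moreover have "b e (F (z j - (\<alpha> j *s e + \<beta> j *s F e))) = 0"
        using eS zS[OF jg] ee
        by (simp add: b_simps F_diff F_add F_scale FFe \<alpha>_def frob2_fixed_frob)
      ultimately show ?thesis
        using i j eS zS[OF jg] fixed[OF jg] by (simp add: y'_def perp_def)
    qed
  qed (use k eS ee in \<open>auto simp: y'_def\<close>)
  thus ?thesis by blast
qed

lemma odd_normal_form:
  assumes "frame y"
  shows "\<exists>y. reduced odd_G odd_H g y"
proof -
  have "\<exists>y. reduced odd_G odd_H k y" if "k \<le> g" for k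
    using that
  proof (induction k)
    case 0
    show ?case using assms by (auto simp: reduced_def)
  next
    case (Suc k)
    thus ?case using odd_step by auto
  qed
  thus ?thesis by blast
qed

end

section \<open>Symplectic reduction for even genus\<close>

locale even_lattice = alternating_dieudonne +
  assumes eps_even: "\<epsilon> = 1"
    and even_F: "x \<in> L \<Longrightarrow> z \<in> L \<Longrightarrow> wp dvd b x (F z)"
    and even_nondeg: "x \<in> L \<Longrightarrow> (\<And>m. m \<in> L \<Longrightarrow> wp dvd b x m) \<Longrightarrow> x \<in> F ` L"
begin

lemma F_F_even: "x \<in> skeleton \<Longrightarrow> F (F x) = wp *s x"
  using F_F_skeleton[of x] by (simp add: eps_even)

lemma skew_herm: "x \<in> skeleton \<Longrightarrow> y \<in> skeleton \<Longrightarrow> b x (F y) = - witt_frob (b y (F x))"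
  using b_F_swap[of x y] by (simp add: eps_even)

lemma even_quotient:
  assumes "x \<in> skeleton" "y \<in> skeleton"
  shows "\<exists>q. b x (F y) = wp * q \<and> frob2_fixed q"
proof -
  obtain q where q: "b x (F y) = wp * q" using even_F[of x y] assms by (auto elim!: dvdE)
  have "frob2_fixed (wp * q)" using assms by (simp flip: q)
  hence "frob2_fixed q" by (rule frob2_fixed_cancel) (simp_all add: frob2_fixed_def)
  thus ?thesis using q by blast
qed

lemma even_diagonal:
  assumes "x \<in> skeleton"
  shows "\<exists>a. b x (F x) = wp * a \<and> witt_frob a = - a"
proof -
  obtain a where a: "b x (F x) = wp * a" using even_quotient[OF assms assms] by blast
  have "wp * a = - witt_frob (wp * a)"
    using skew_herm[OF assms assms] unfolding a .
  hence "wp * (witt_frob a + a) = 0" by (simp add: eq_neg_iff_add_eq_0 algebra_simps)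
  hence "witt_frob a = - a" by (simp add: eq_neg_iff_add_eq_0)
  thus ?thesis using a by blast
qed

text \<open>Within any submodule \<open>T\<close> of the skeleton, a pair with unit pairing can be normalised without changing
  it modulo \<open>F L\<close> except for a unit factor.  The three corrections remove
  \<open>b(e\<^sub>1, F e\<^sub>2)\<close>, \<open>b(e\<^sub>1, F e\<^sub>1)\<close> and \<open>b(e\<^sub>2, F e\<^sub>2)\<close> in this order, since each of them preserves what has been
  achieved before.\<close>

lemma even_pair:
  assumes T: "T \<subseteq> skeleton" "\<And>x y. x \<in> T \<Longrightarrow> y \<in> T \<Longrightarrow> x + y \<in> T"
      "\<And>c x. x \<in> T \<Longrightarrow> frob2_fixed c \<Longrightarrow> c *s x \<in> T" "\<And>x. x \<in> T \<Longrightarrow> F x \<in> T"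
    and e: "e1 \<in> T" "e2 \<in> T" and unit: "\<not> wp dvd b e1 e2"
  shows "\<exists>e1'\<in>T. \<exists>e2'\<in>T. \<exists>c. c dvd 1 \<and> e1' - e1 \<in> F ` L \<and> e2' - c *s e2 \<in> F ` L \<and>
    b e1' e2' = 1 \<and> b e1' (F e1') = 0 \<and> b e1' (F e2') = 0 \<and> b e2' (F e2') = 0"
proof -
  have eS: "e1 \<in> skeleton" "e2 \<in> skeleton" using e T by auto
  define u where "u = b e1 e2"
  have uf: "frob2_fixed u" using eS by (simp add: u_def)
  obtain q where q: "b e1 (F e2) = wp * q" "frob2_fixed q" using even_quotient eS by blast
  obtain v where v: "u * v = 1" "frob2_fixed v"
    using witt_unit_inverse_fixed[OF unit[folded u_def] uf] by blast
  \<comment> \<open>\<open>e2 + s F e2\<close> is orthogonal to \<open>F e1\<close> if \<open>\<sigma>(s) u = - q\<close>; then rescale to pairing \<open>1\<close>\<close>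
  define s where "s = witt_frob (- q * v)"
  have sf: "frob2_fixed s" using q v by (simp add: s_def)
  have "witt_frob s * u = - q * (u * v)"
    using q v frob2_fixed_frob[of "- q * v"] by (simp add: s_def mult_ac)
  hence s: "witt_frob s * u = - q" by (simp add: v)
  define x where "x = e2 + s *s F e2"
  have xT: "x \<in> T" using e sf T by (simp add: x_def)
  hence xS: "x \<in> skeleton" using T by blast
  have e1x: "b e1 x = u + wp * (s * q)"
    using eS by (simp add: x_def b_simps q u_def mult_ac)
  have e1Fx: "b e1 (F x) = 0"
  proof -
    have "b e1 (F x) = wp * (q + witt_frob s * u)"
      using eS by (simp add: x_def F_add F_scale F_F_even b_simps q u_def algebra_simps)
    thus ?thesis by (simp add: s)
  qed
  have "\<not> wp dvd b e1 x"
    using unit unfolding e1x u_def by (metis dvd_add_left_iff dvd_triv_left)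
  then obtain v' where v': "b e1 x * v' = 1" "v' dvd 1" "frob2_fixed v'"
    using witt_unit_inverse_fixed eS xS by (metis frob2_fixed_b)
  define x2 where "x2 = v' *s x"
  have x2T: "x2 \<in> T" using xT v' T by (simp add: x2_def)
  hence x2S: "x2 \<in> skeleton" using T by blast
  have e1x2: "b e1 x2 = 1" "b e1 (F x2) = 0"
    using eS xS v' e1Fx by (simp_all add: x2_def F_scale b_simps mult.commute)
  \<comment> \<open>the value \<open>b x (F x)\<close> at \<open>x = e1 + t F x2\<close> is \<open>p\<close> times \<open>\<sigma>(t) - t + a - p d t \<sigma>(t)\<close>\<close>
  obtain a where a: "b e1 (F e1) = wp * a" "witt_frob a = - a" using even_diagonal eS by blast
  obtain d where d: "b x2 (F x2) = wp * d" "witt_frob d = - d" using even_diagonal x2S by blast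
  obtain t where t: "witt_frob t - t + a - wp * d * t * witt_frob t = 0"
    using witt_artin_schreier by blast
  have tf: "frob2_fixed t"
  proof -
    have "witt_frob (witt_frob t - t + a - wp * d * t * witt_frob t) = 0" unfolding t by simp
    hence "witt_frob (witt_frob t) - witt_frob t - a
        + wp * d * witt_frob t * witt_frob (witt_frob t) = 0"
      using a d by (simp add: algebra_simps)
    \<comment> \<open>\<open>t\<close> itself satisfies the equation just derived for \<open>\<sigma>\<^sup>2(t)\<close>\<close>
    hence "(witt_frob (witt_frob t) - t) * (1 + wp * (d * witt_frob t)) = 0"
      using t by (simp add: algebra_simps)
    moreover have "1 + wp * (d * witt_frob t) \<noteq> 0"
    proof
      assume *: "1 + wp * (d * witt_frob t) = 0"
      have "wp dvd (1 + wp * (d * witt_frob t)) - wp * (d * witt_frob t)"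
        unfolding * by simp
      thus False using wp_not_dvd_1[where 'k = 'a] by simp
    qed
    ultimately show ?thesis by (simp add: frob2_fixed_def)
  qed
  define f1 where "f1 = e1 + t *s F x2"
  have f1T: "f1 \<in> T" using e x2T tf T by (simp add: f1_def)
  hence f1S: "f1 \<in> skeleton" using T by blast
  have x2e1: "b x2 e1 = - 1" and Fx2x2: "b (F x2) x2 = - (wp * d)"
    using b_skew[of x2 e1] b_skew[of "F x2" x2] x2S eS e1x2 d by auto
  have "b f1 (F f1) = wp * (witt_frob t - t + a - wp * d * t * witt_frob t)"
    using eS x2S
    by (simp add: f1_def F_add F_scale F_F_even b_simps b_F_F a e1x2 x2e1 Fx2x2 algebra_simps)
  hence f1f1: "b f1 (F f1) = 0" by (simp add: t)
  have f1x2: "b f1 x2 = 1 - wp * (t * d)" and f1Fx2: "b f1 (F x2) = 0"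
    using eS x2S by (simp_all add: f1_def b_simps e1x2 Fx2x2 mult_ac)
  have "\<not> wp dvd b f1 x2"
    using wp_not_dvd_1[where 'k = 'a] unfolding f1x2
    by (metis diff_add_cancel dvd_add dvd_triv_left)
  then obtain w where w: "b f1 x2 * w = 1" "w dvd 1" "frob2_fixed w"
    using witt_unit_inverse_fixed f1S x2S by (metis frob2_fixed_b)
  define x3 where "x3 = w *s x2"
  have x3T: "x3 \<in> T" using x2T w T by (simp add: x3_def)
  hence x3S: "x3 \<in> skeleton" using T by blast
  have f1x3: "b f1 x3 = 1" "b f1 (F x3) = 0"
    using f1S x2S w f1Fx2 by (simp_all add: x3_def F_scale b_simps mult.commute)
  \<comment> \<open>as before with the roles exchanged; now \<open>b f1 (F f1) = 0\<close> makes the equation linear\<close>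
  obtain d' where d': "b x3 (F x3) = wp * d'" "witt_frob d' = - d'" using even_diagonal x3S by blast
  obtain r where "witt_frob r - r + (- d') - wp * 0 * r * witt_frob r = 0"
    using witt_artin_schreier by blast
  hence r: "witt_frob r = r + d'" by (simp add: algebra_simps)
  hence rf: "frob2_fixed r" by (simp add: frob2_fixed_def d')
  define f2 where "f2 = x3 + r *s F f1"
  have f2T: "f2 \<in> T" using f1T x3T rf T by (simp add: f2_def)
  have x3f1: "b x3 f1 = - 1" and Ff1f1: "b (F f1) f1 = 0"
    using b_skew[of x3 f1] b_skew[of "F f1" f1] x3S f1S f1x3 f1f1 by auto
  have f2f2: "b f2 (F f2) = 0"
    using f1S x3S
    by (simp add: f2_def F_add F_scale F_F_even b_simps b_F_F d' f1x3 x3f1 Ff1f1 r algebra_simps)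
  have f1f2: "b f1 f2 = 1" "b f1 (F f2) = 0"
    using f1S x3S by (simp_all add: f2_def F_add F_scale F_F_even b_simps f1x3 f1f1)
  have "f1 - e1 \<in> F ` L"
    using x2S by (simp add: f1_def F_L_closed)
  moreover have "f2 - (w * v') *s e2 = (w * v' * s) *s F e2 + r *s F f1"
    by (simp add: f2_def x3_def x2_def x_def scale_right_distrib mult.assoc)
  hence "f2 - (w * v') *s e2 \<in> F ` L"
    using eS f1S by (simp add: F_L_closed)
  moreover have "w * v' dvd 1" using mult_dvd_mono[OF w(2) v'(2)] by simp
  ultimately show ?thesis using f1T f2T f1f1 f2f2 f1f2 by blast
qed

text \<open>The vectors with indices \<open>2 i\<close> and \<open>2 i + 1\<close> form hyperbolic pairs.\<close>

abbreviation "even_G \<equiv> \<lambda>(i::nat) (j::nat). if even i \<and> j = Suc i then 1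
  else if even j \<and> i = Suc j then - 1 else 0 :: 'a witt"
abbreviation "even_H \<equiv> \<lambda>(i::nat) (j::nat). 0 :: 'a witt"

lemma even_pairing:
  assumes y: "frame y" and m: "m < g"
  shows "\<exists>j<g. \<not> wp dvd b (y m) (y j)"
proof (rule frame_detects[OF y m])
  note ym = frameD(1)[OF y m]
  show "b (y m) (u + v) = b (y m) u + b (y m) v" if "u \<in> L" "v \<in> L" for u v
    using that ym by (simp add: b_simps)
  show "wp dvd b (y m) (w *s u)" if "u \<in> L" "wp dvd b (y m) u" for w u
    using that ym by (simp add: b_simps)
  show "wp dvd b (y m) (F z)" if "z \<in> L" for z
    using even_F ym that by simp
  show "y m \<in> F ` L" if "\<And>u. u \<in> L \<Longrightarrow> wp dvd b (y m) u"
    using even_nondeg[OF _ that] ym by simp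
qed

text \<open>The residual symplectic form provides a partner \<open>y\<^sub>j\<close> of \<open>y\<^sub>k\<close>, which is moved to position \<open>k + 1\<close>;
  the normalised pair then splits off.  The coefficients at \<open>F e1\<close> and \<open>F e2\<close> are integral
  because \<open>b(L, F L) \<subseteq> p W\<close>.\<close>

lemma even_step:
  assumes y: "reduced even_G even_H k y" and k: "k < g" "even k"
  shows "\<exists>y'. reduced even_G even_H (k + 2) y'"
proof -
  obtain j where j: "j < g" "\<not> wp dvd b (y k) (y j)"
    using even_pairing[OF reducedD(1)[OF y] k(1)] by blast
  have "k \<le> j"
  proof (rule ccontr)
    assume "\<not> k \<le> j"
    hence "y j \<in> perp (y k)" using reduced_perp_sym[OF y, of j k] k by simp
    thus False using j by (simp add: perpD)
  qed
  moreover have "j \<noteq> k" using j frameD(1)[OF reducedD(1)[OF y] k(1)] by auto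
  ultimately have kj: "Suc k \<le> j" by simp
  define z where "z = (\<lambda>n. y (transpose (Suc k) j n))"
  have z: "reduced even_G even_H k z"
    unfolding z_def by (rule reduced_swap[OF y]) (use kj j in auto)
  have zkj: "\<not> wp dvd b (z k) (z (Suc k))"
    using j kj by (simp add: z_def transpose_def)
  have k1: "Suc k < g" using kj j by simp
  note zS = frameD(1)[OF reducedD(1)[OF z]]
  have "\<exists>e1\<in>complement k z. \<exists>e2\<in>complement k z. \<exists>c. c dvd 1 \<and> e1 - z k \<in> F ` L \<and>
      e2 - c *s z (Suc k) \<in> F ` L \<and>
      b e1 e2 = 1 \<and> b e1 (F e1) = 0 \<and> b e1 (F e2) = 0 \<and> b e2 (F e2) = 0"
    by (rule even_pair[OF _ complement_closed[OF z] reducedD(6)[OF z] reducedD(6)[OF z] zkj])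
      (use k k1 in \<open>auto simp: complement_skeleton\<close>)
  then obtain e1 e2 c where eT: "e1 \<in> complement k z" "e2 \<in> complement k z" and c: "c dvd 1"
    and ez: "e1 - z k \<in> F ` L" "e2 - c *s z (Suc k) \<in> F ` L"
    and e12: "b e1 e2 = 1" "b e1 (F e1) = 0" "b e1 (F e2) = 0" "b e2 (F e2) = 0" by blast
  have eS: "e1 \<in> skeleton" "e2 \<in> skeleton" using eT by (auto simp: complement_skeleton)
  have e21: "b e2 e1 = - 1" "b e2 (F e1) = 0"
    using b_skew[of e2 e1] skew_herm[of e2 e1] eS e12 by auto
  have "\<exists>q1 q2. b e1 (F (z j)) = wp * q1 \<and> b e2 (F (z j)) = wp * q2 \<and> frob2_fixed q1 \<and> frob2_fixed q2"
    if "j < g" for j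
    using even_quotient[OF eS(1) zS[OF that]] even_quotient[OF eS(2) zS[OF that]] by blast
  then obtain q1 q2 where q: "\<And>j. j < g \<Longrightarrow> b e1 (F (z j)) = wp * q1 j"
      "\<And>j. j < g \<Longrightarrow> b e2 (F (z j)) = wp * q2 j"
      "\<And>j. j < g \<Longrightarrow> frob2_fixed (q1 j)" "\<And>j. j < g \<Longrightarrow> frob2_fixed (q2 j)"
    by metis
  define \<alpha> where "\<alpha> = (\<lambda>j. - b e2 (z j))"
  define \<beta> where "\<beta> = (\<lambda>j. - witt_frob (q2 j))"
  define \<gamma> where "\<gamma> = (\<lambda>j. b e1 (z j))"
  define \<delta> where "\<delta> = (\<lambda>j. witt_frob (q1 j))"
  have fixed: "frob2_fixed (\<alpha> j)" "frob2_fixed (\<beta> j)" "frob2_fixed (\<gamma> j)" "frob2_fixed (\<delta> j)"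
    if "j < g" for j
    using eS zS[OF that] q(3,4)[OF that] by (auto simp: \<alpha>_def \<beta>_def \<gamma>_def \<delta>_def)
  \<comment> \<open>\<open>z3\<close> projects the later vectors to the complement of the pair; it is reached from \<open>z\<close> by
    residual changes of basis with one pivot each\<close>
  define z1 where "z1 = z(k := e1, Suc k := e2)"
  define z2 where "z2 = (\<lambda>j. if j < k + 2 then z1 j else z1 j - \<alpha> j *s e1)"
  define z3 where "z3 = (\<lambda>j. if j < k + 2 then z1 j
    else z j - (\<alpha> j *s e1 + \<beta> j *s F e1 + \<gamma> j *s e2 + \<delta> j *s F e2))"
  have z1S: "z1 i \<in> skeleton" if "i < g" for i using zS[OF that] eS by (simp add: z1_def)
  have "frame z1"
  proof (rule frame_change[OF reducedD(1)[OF z] k(1), where c = "\<lambda>i. if i = Suc k then c else 1"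
        and d = "\<lambda>_. 0"])
    show "z1 i - ((if i = Suc k then c else 1) *s z i + 0 *s z k) \<in> F ` L" for i
      using ez F_L_closed(1) by (simp add: z1_def)
  qed (use c z1S in auto)
  hence "frame z2"
  proof (rule frame_change[where m = k and c = "\<lambda>_. 1" and d = "\<lambda>i. if i < k + 2 then 0 else - \<alpha> i"])
    show "z2 i \<in> skeleton" if "i < g" for i
      using z1S[OF that] eS fixed[OF that] by (simp add: z2_def)
    show "z2 i - (1 *s z1 i + (if i < k + 2 then 0 else - \<alpha> i) *s z1 k) \<in> F ` L" for i
      using F_L_closed(1) by (simp add: z2_def z1_def)
  qed (use k in auto)
  hence "frame z3"
  proof (rule frame_change[where m = "Suc k" and c = "\<lambda>_. 1" and d = "\<lambda>i. if i < k + 2 then 0 else - \<gamma> i"])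
    show "z3 i \<in> skeleton" if "i < g" for i
      using z1S[OF that] zS[OF that] eS fixed[OF that] by (simp add: z3_def)
    show "z3 i - (1 *s z2 i + (if i < k + 2 then 0 else - \<gamma> i) *s z2 (Suc k)) \<in> F ` L" for i
    proof (cases "i < k + 2")
      case True
      thus ?thesis using F_L_closed(1) by (simp add: z2_def z3_def)
    next
      case False
      hence "z3 i - (1 *s z2 i + (if i < k + 2 then 0 else - \<gamma> i) *s z2 (Suc k)) =
          - (\<beta> i *s F e1 + \<delta> i *s F e2)"
        by (simp add: z2_def z3_def z1_def)
      also have "\<dots> \<in> F ` L" using eS by (intro F_L_closed imageI) auto
      finally show ?thesis .
    qed
  qed (use k1 in auto)
  hence "reduced even_G even_H (k + 2) z3"
  proof (rule reduced_extend[OF z])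
    show "z3 j \<in> complement k z" if j: "k \<le> j" "j < g" for j
    proof -
      have "\<alpha> j *s e1 + \<beta> j *s F e1 + \<gamma> j *s e2 + \<delta> j *s F e2 \<in> complement k z"
        using eT fixed[OF j(2)] by (intro complement_closed[OF z])
      thus ?thesis using j eT reducedD(6)[OF z j]
        by (auto simp: z3_def z1_def intro: complement_diff[OF z])
    qed
    show "z3 j \<in> perp (z3 i)" if i: "i \<in> {k..<k + 2}" and j: "j \<in> {k + 2..<g}" for i j
    proof -
      have jg: "j < g" using j by simp
      let ?x = "z j - (\<alpha> j *s e1 + \<beta> j *s F e1 + \<gamma> j *s e2 + \<delta> j *s F e2)"
      have xS: "?x \<in> skeleton" using zS[OF jg] eS fixed[OF jg] by simp
      have "b e1 ?x = 0" "b e2 ?x = 0"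
        using eS zS[OF jg] by (simp_all add: b_simps e12 e21 \<alpha>_def \<gamma>_def)
      moreover have "b e1 (F ?x) = 0" "b e2 (F ?x) = 0"
        using eS zS[OF jg] q[OF jg]
        by (simp_all add: b_simps F_diff F_add F_scale F_F_even e12 e21 \<beta>_def \<delta>_def frob2_fixed_frob)
      ultimately have "?x \<in> perp e1" "?x \<in> perp e2" using xS by (simp_all add: perp_def)
      moreover have "z3 j = ?x" using j by (simp add: z3_def)
      moreover have "z3 i = e1 \<or> z3 i = e2" using i by (auto simp: z3_def z1_def)
      ultimately show ?thesis by auto
    qed
    show "b (z3 i) (z3 j) = even_G i j \<and> b (z3 i) (F (z3 j)) = even_H i j"
      if i: "i \<in> {k..<k + 2}" and j: "j \<in> {k..<k + 2}" for i j
    proof -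
      have "i = k \<or> i = Suc k" "j = k \<or> j = Suc k" using i j by auto
      thus ?thesis using eS e12 e21 k(2) by (auto simp: z3_def z1_def)
    qed
    show "even_G i j = 0 \<and> even_H i j = 0 \<and> even_G j i = 0 \<and> even_H j i = 0" if "i < k" "k \<le> j" for i j
      using that k(2) by (auto simp: less_Suc_eq_le dest: le_antisym)
  qed (use k k1 in \<open>auto simp: z3_def z1_def\<close>)
  thus ?thesis by blast
qed

lemma even_normal_form:
  assumes "frame y" "even g"
  shows "\<exists>y. reduced even_G even_H g y"
proof -
  have "\<exists>y. reduced even_G even_H (2 * k) y" if "2 * k \<le> g" for k
    using that
  proof (induction k)
    case 0
    show ?case using assms by (auto simp: reduced_def)
  next
    case (Suc k)
    then obtain y where "reduced even_G even_H (2 * k) y" by auto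
    from even_step[OF this] Suc.prems show ?case by auto
  qed
  from this[of "g div 2"] show ?thesis using assms by simp
qed

end

section \<open>Bases with a monomial Gram matrix\<close>

lemma digits_eq_iff:
  assumes "k < d" "j < d"
  shows "d * a + k = d * c + j \<longleftrightarrow> a = c \<and> k = (j::nat)"
proof
  assume *: "d * a + k = d * c + j"
  have "(d * a + k) div d = a" "(d * c + j) div d = c" using assms by simp_all
  with * show "a = c \<and> k = j" by simp
qed simp

lemma index_diag_block_replicate:
  assumes "A \<in> carrier_mat d d" "d > 0"
  shows "diag_block_mat (replicate n A) =
    mat (n * d) (n * d) (\<lambda>(i, j). if i div d = j div d then A $$ (i mod d, j mod d) else 0)"
proof (induction n)
  case 0
  show ?case by (rule eq_matI) simp_all
next
  case (Suc n)
  show ?case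
  proof (rule eq_matI)
    fix i j
    assume "i < dim_row (mat (Suc n * d) (Suc n * d)
        (\<lambda>(i, j). if i div d = j div d then A $$ (i mod d, j mod d) else 0))"
      and "j < dim_col (mat (Suc n * d) (Suc n * d)
        (\<lambda>(i, j). if i div d = j div d then A $$ (i mod d, j mod d) else 0))"
    hence ij: "i < Suc n * d" "j < Suc n * d" by auto
    thus "diag_block_mat (replicate (Suc n) A) $$ (i, j) = mat (Suc n * d) (Suc n * d)
        (\<lambda>(i, j). if i div d = j div d then A $$ (i mod d, j mod d) else 0) $$ (i, j)"
      using assms
      by (auto simp: Suc Let_def le_div_geq le_mod_geq not_less)
  qed (use assms in \<open>auto simp: Suc Let_def\<close>)
qed

context dieudonne_module
begin

lemma dual_zero: "d \<in> dual L \<Longrightarrow> subspace L \<Longrightarrow> d 0 = 0"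
proof -
  assume d: "d \<in> dual L" and L: "subspace L"
  have "d (0 *s 0) = 0 * d 0" using d subspace_0[OF L] unfolding dual_def by blast
  thus ?thesis by simp
qed

lemma dual_basis_eq:
  assumes bs: "list_basis bs L" and d: "d \<in> dual L"
    and dr: "\<And>s. s < length bs \<Longrightarrow> d (bs ! s) = (if s = r then 1 else 0)"
  shows "dual_basis L bs r = d"
  unfolding dual_basis_def
proof (rule the_equality)
  show "d \<in> dual L \<and> (\<forall>s<length bs. d (bs ! s) = (if s = r then 1 else 0))" using d dr by blast
  fix d' assume d': "d' \<in> dual L \<and> (\<forall>s<length bs. d' (bs ! s) = (if s = r then 1 else 0))"
  have L: "span (set bs) = L" using bs by (simp add: list_basis_def)
  hence sub: "subspace L" using subspace_span by blast
  have add: "c (x + y) = c x + c y" if "c \<in> dual L" "x \<in> L" "y \<in> L" for c x y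
    using that by (simp add: dual_def)
  have scale: "c (w *s x) = w * c x" if "c \<in> dual L" "x \<in> L" for c x w
    using that by (simp add: dual_def)
  have "subspace {x \<in> L. d' x = d x}"
    by (rule subspaceI)
      (use d d' sub in \<open>auto simp: dual_zero add scale subspace_0 subspace_add subspace_scale\<close>)
  moreover have "set bs \<subseteq> {x \<in> L. d' x = d x}"
    using d' dr L span_superset[of "set bs"] by (auto simp: in_set_conv_nth)
  ultimately have "span (set bs) \<subseteq> {x \<in> L. d' x = d x}" by (intro span_minimal)
  hence eq: "d' x = d x" if "x \<in> L" for x using L that by blast
  have "d' x = 0" "d x = 0" if "x \<notin> L" for x using d d' that by (auto simp: dual_def)
  thus "d' = d" using eq by (metis ext)
qed

end

context alternating_dieudonne
begin

lemma F_sum: "F (sum h A) = (\<Sum>i\<in>A. F (h i))"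
  by (induction A rule: infinite_finite_induct) (auto simp: F_add)

definition frame_basis :: "(nat \<Rightarrow> 'm) \<Rightarrow> nat \<Rightarrow> 'm" where
  "frame_basis y r = (if even r then y (r div 2) else F (y (r div 2)))"

lemma frame_basis_L: "frame y \<Longrightarrow> r < 2 * g \<Longrightarrow> frame_basis y r \<in> L"
  using frameD(1)[of y "r div 2"] by (auto simp: frame_basis_def)

text \<open>Expand \<open>x\<close> modulo \<open>F L\<close>, then the error term once more, and use \<open>F\<^sup>2 L = F V L = p L\<close>.\<close>

lemma frame_span:
  assumes y: "frame y" and x: "x \<in> L"
  shows "\<exists>z\<in>L. x - wp *s z \<in> span (frame_basis y ` {..<2 * g})"
proof -
  obtain a z1 where 1: "x - (\<Sum>i<g. a i *s y i) = F z1" "z1 \<in> L" using frameD(2)[OF y x] by blast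
  obtain a' z2 where 2: "z1 - (\<Sum>i<g. a' i *s y i) = F z2" "z2 \<in> L"
    using frameD(2)[OF y 1(2)] by blast
  obtain z3 where 3: "F z2 = V z3" "z3 \<in> L" using F_V_L 2(2) by blast
  have "z1 = (\<Sum>i<g. a' i *s y i) + F z2" using 2(1) by (simp add: algebra_simps)
  hence "F z1 = (\<Sum>i<g. witt_frob (a' i) *s F (y i)) + wp *s z3"
    by (simp add: F_add F_sum F_scale 3 F_V)
  hence "x - wp *s z3 = (\<Sum>i<g. a i *s y i) + (\<Sum>i<g. witt_frob (a' i) *s F (y i))"
    using 1(1) by (simp add: algebra_simps)
  also have "\<dots> \<in> span (frame_basis y ` {..<2 * g})"
  proof (intro span_add span_sum span_scale span_base)
    fix i assume "i \<in> {..<g}"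
    thus "y i \<in> frame_basis y ` {..<2 * g}" "F (y i) \<in> frame_basis y ` {..<2 * g}"
      using image_eqI[of "y i" "frame_basis y" "2 * i" "{..<2 * g}"]
        image_eqI[of "F (y i)" "frame_basis y" "Suc (2 * i)" "{..<2 * g}"]
      by (auto simp: frame_basis_def)
  qed
  finally show ?thesis using 3 by blast
qed

text \<open>Each \<open>v r\<close> pairs with exactly one vector, \<open>v (\<pi> r)\<close>, and the value \<open>\<kappa> r\<close> divides all values of
  \<open>b (v r)\<close>.  So every \<open>x\<close> has an integral orthogonal projection to the span of the \<open>v r\<close>.  The
  difference \<open>x'\<close> is orthogonal to the span, hence \<open>b(x', L) \<subseteq> p b(x', L)\<close> because the span is all of
  \<open>L\<close> modulo \<open>p\<close>, and \<open>x' = 0\<close> by non-degeneracy.  This replaces Nakayama's lemma.\<close>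

lemma monomial_gram_basis:
  assumes v: "\<And>r. r < n \<Longrightarrow> v r \<in> L"
    and \<pi>: "\<And>r. r < n \<Longrightarrow> \<pi> r < n \<and> \<pi> (\<pi> r) = r"
    and gram: "\<And>r s. r < n \<Longrightarrow> s < n \<Longrightarrow> b (v r) (v s) = (if s = \<pi> r then \<kappa> r else 0)"
    and \<kappa>0: "\<And>r. r < n \<Longrightarrow> \<kappa> r \<noteq> 0"
    and \<kappa>_dvd: "\<And>x r. x \<in> L \<Longrightarrow> r < n \<Longrightarrow> \<kappa> r dvd b (v r) x"
    and span_p: "\<And>x. x \<in> L \<Longrightarrow> \<exists>z\<in>L. x - wp *s z \<in> span (v ` {..<n})"
  shows "list_basis (map v [0..<n]) L"
proof -
  have \<pi>_eq: "\<pi> r = \<pi> s \<longleftrightarrow> r = s" if "r < n" "s < n" for r s using \<pi> that by metis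
  have inj: "inj_on v {..<n}"
  proof (rule inj_onI)
    fix r s assume rs: "r \<in> {..<n}" "s \<in> {..<n}" "v r = v s"
    have "\<kappa> r = b (v r) (v (\<pi> r))" using gram[of r "\<pi> r"] \<pi>[of r] rs by simp
    also have "\<dots> = (if \<pi> r = \<pi> s then \<kappa> s else 0)" using gram[of s "\<pi> r"] \<pi>[of r] rs by simp
    finally have "\<pi> r = \<pi> s" using \<kappa>0[of r] rs by (metis lessThan_iff)
    thus "r = s" using \<pi>_eq[of r s] rs by simp
  qed
  have sub: "span (v ` {..<n}) \<subseteq> L" using v L_subspace by (intro span_minimal) auto
  have "x \<in> span (v ` {..<n})" if x: "x \<in> L" for x
  proof -
    have "\<exists>q. b (v r) x = \<kappa> r * q" if "r < n" for r using \<kappa>_dvd[OF x that] by (auto elim: dvdE)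
    then obtain q where q: "\<And>r. r < n \<Longrightarrow> b (v r) x = \<kappa> r * q r" by metis
    define x' where "x' = x - (\<Sum>r<n. q r *s v (\<pi> r))"
    have in_span: "(\<Sum>r<n. q r *s v (\<pi> r)) \<in> span (v ` {..<n})"
      using \<pi> by (intro span_sum span_scale span_base) auto
    hence x'L: "x' \<in> L" using x sub by (auto simp: x'_def)
    have "b (v s) x' = 0" if s: "s < n" for s
    proof -
      have "b (v s) (\<Sum>r<n. q r *s v (\<pi> r)) = (\<Sum>r<n. q r * b (v s) (v (\<pi> r)))"
        using v s \<pi> by (subst b_sum_right) (auto simp: b_simps)
      also have "\<dots> = (\<Sum>r<n. if r = s then q s * \<kappa> s else 0)"
        using s \<pi> by (intro sum.cong) (auto simp: gram \<pi>_eq)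
      also have "\<dots> = q s * \<kappa> s" using s by simp
      finally have "b (v s) (\<Sum>r<n. q r *s v (\<pi> r)) = q s * \<kappa> s" .
      thus ?thesis using q[OF s] s v x in_span sub by (auto simp: x'_def b_simps mult.commute)
    qed
    hence bv: "b x' (v s) = 0" if "s < n" for s using b_skew[OF x'L v[OF that]] that by simp
    have "subspace {u \<in> L. b x' u = 0}"
      by (rule subspaceI) (use x'L in \<open>auto simp: b_simps\<close>)
    hence "span (v ` {..<n}) \<subseteq> {u \<in> L. b x' u = 0}" using v bv by (intro span_minimal) auto
    hence bspan: "b x' u = 0" if "u \<in> span (v ` {..<n})" for u using that by blast
    have "wp ^ m dvd b x' u" if "u \<in> L" for m u
      using that
    proof (induction m arbitrary: u)
      case (Suc m)
      obtain z where z: "z \<in> L" "u - wp *s z \<in> span (v ` {..<n})" using span_p[OF Suc.prems] by blast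
      have "b x' u = b x' (u - wp *s z) + wp * b x' z"
        using x'L z Suc.prems by (simp add: b_simps)
      also have "\<dots> = wp * b x' z" using bspan[OF z(2)] by simp
      finally show ?case using Suc.IH[OF z(1)] by (simp add: mult_dvd_mono)
    qed simp
    hence "x' = 0" using x'L by (intro b_nondeg witt_eq_0_if_dvd)
    thus ?thesis using in_span by (simp add: x'_def)
  qed
  hence span_eq: "span (v ` {..<n}) = L" using sub by blast
  have "independent (v ` {..<n})"
    unfolding dependent_explicit
  proof (rule notI, elim exE conjE)
    fix t u assume t: "finite t" "t \<subseteq> v ` {..<n}" and 0: "(\<Sum>a\<in>t. u a *s a) = 0" and nz: "\<exists>a\<in>t. u a \<noteq> 0"
    then obtain a where a: "a \<in> t" "u a \<noteq> 0" by blast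
    then obtain r where r: "a = v r" "r < n" using t by blast
    have tL: "c \<in> L" if "c \<in> t" for c using that t v by auto
    have "0 = b (v (\<pi> r)) (\<Sum>a\<in>t. u a *s a)" using 0 v \<pi> r by simp
    also have "\<dots> = (\<Sum>c\<in>t. u c * b (v (\<pi> r)) c)"
      using tL v \<pi> r by (subst b_sum_right) (auto simp: b_simps)
    also have "\<dots> = (\<Sum>c\<in>t. if c = a then u a * \<kappa> (\<pi> r) else 0)"
    proof (rule sum.cong)
      fix c assume "c \<in> t"
      then obtain s where s: "c = v s" "s < n" using t by blast
      have "v s = v r \<longleftrightarrow> s = r" using inj s r by (auto simp: inj_on_def)
      thus "u c * b (v (\<pi> r)) c = (if c = a then u a * \<kappa> (\<pi> r) else 0)"
        using s r \<pi> by (auto simp: gram)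
    qed simp
    also have "\<dots> = u a * \<kappa> (\<pi> r)" using a t by simp
    finally show False using a \<kappa>0 \<pi> r by simp
  qed
  thus ?thesis using span_eq inj
    by (simp add: list_basis_def distinct_map atLeast0LessThan)
qed

text \<open>The functional dual to \<open>v r\<close> is \<open>x \<mapsto> b(x, v (\<pi> r)) / \<kappa> r\<close>.  Since \<open>b = p\<^sup>h B\<close>, it is represented with
  respect to \<open>B\<close> by the vector \<open>(p\<^sup>h / \<kappa> r) v (\<pi> r) = \<mu> r v (\<pi> r)\<close>.\<close>

lemma monomial_dual_gram:
  fixes B :: "'m \<Rightarrow> 'm \<Rightarrow> 'k witt fract"
  assumes basis: "list_basis (map v [0..<n]) L"
    and v: "\<And>r. r < n \<Longrightarrow> v r \<in> L"
    and \<pi>: "\<And>r. r < n \<Longrightarrow> \<pi> r < n \<and> \<pi> (\<pi> r) = r"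
    and gram: "\<And>r s. r < n \<Longrightarrow> s < n \<Longrightarrow> b (v r) (v s) = (if s = \<pi> r then \<kappa> r else 0)"
    and \<kappa>0: "\<And>r. r < n \<Longrightarrow> \<kappa> r \<noteq> 0"
    and \<kappa>_dvd: "\<And>x r. x \<in> L \<Longrightarrow> r < n \<Longrightarrow> \<kappa> r dvd b (v r) x"
    and \<kappa>\<mu>: "\<And>r. r < n \<Longrightarrow> \<kappa> r * \<mu> r = wp ^ h"
    and B: "\<And>x y. x \<in> L \<Longrightarrow> y \<in> L \<Longrightarrow> to_fract (b x y) = to_fract (wp ^ h) * B x y"
  shows "dual_gram_matrix B L (map v [0..<n]) = mat n n (\<lambda>(r, s). if s = \<pi> r then \<mu> r else 0)"
proof -
  have \<pi>_eq: "\<pi> r = \<pi> s \<longleftrightarrow> r = s" if "r < n" "s < n" for r s using \<pi> that by metis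
  have "\<exists>q. b x (v (\<pi> r)) = \<kappa> r * q" if "x \<in> L" "r < n" for x r
  proof -
    have "\<kappa> (\<pi> r) = - \<kappa> r"
      using gram[of r "\<pi> r"] gram[of "\<pi> r" r] \<pi>[of r] that b_skew[of "v (\<pi> r)" "v r"] v by simp
    hence "\<kappa> r dvd b (v (\<pi> r)) x" using \<kappa>_dvd[of x "\<pi> r"] \<pi>[of r] that by simp
    hence "\<kappa> r dvd b x (v (\<pi> r))" using b_skew[of x "v (\<pi> r)"] that v \<pi>[of r] by simp
    thus ?thesis by (auto elim: dvdE)
  qed
  then obtain q where q: "\<And>x r. x \<in> L \<Longrightarrow> r < n \<Longrightarrow> b x (v (\<pi> r)) = \<kappa> r * q x r" by metis
  define d where "d = (\<lambda>r x. if x \<in> L then q x r else 0)"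
  have qI: "q x r = w" if "x \<in> L" "r < n" "b x (v (\<pi> r)) = \<kappa> r * w" for x r w
    using q[OF that(1,2)] \<kappa>0[OF that(2)] that(3) by simp
  have d_dual: "d r \<in> dual L" if r: "r < n" for r
  proof -
    have \<pi>r: "v (\<pi> r) \<in> L" using v \<pi> r by simp
    have "q (x + y) r = q x r + q y r" if "x \<in> L" "y \<in> L" for x y
      by (rule qI) (use that r \<pi>r q[OF that(1) r] q[OF that(2) r] in \<open>simp_all add: b_simps distrib_left\<close>)
    moreover have "q (w *s x) r = w * q x r" if "x \<in> L" for x w
      by (rule qI) (use that r \<pi>r q[OF that r] in \<open>simp_all add: b_simps\<close>)
    ultimately show ?thesis by (simp add: dual_def d_def)
  qed
  have d_v: "d r (v s) = (if s = r then 1 else 0)" if "r < n" "s < n" for r s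
  proof -
    have "q (v s) r = (if s = r then 1 else 0)"
      by (rule qI) (use that v \<pi> in \<open>auto simp: gram \<pi>_eq\<close>)
    thus ?thesis using v that by (simp add: d_def)
  qed
  have db: "dual_basis L (map v [0..<n]) r = d r" if "r < n" for r
    by (rule dual_basis_eq[OF basis d_dual[OF that]]) (use that d_v in simp)
  have dv: "dual_vec B L (d r) = \<mu> r *s v (\<pi> r)" if r: "r < n" for r
    unfolding dual_vec_def
  proof (rule the_equality)
    have \<pi>r: "v (\<pi> r) \<in> L" using v \<pi> r by simp
    have eq: "to_fract (wp ^ h) * B m (\<mu> r *s v (\<pi> r)) = to_fract (wp ^ h) * to_fract (d r m)"
      if m: "m \<in> L" for m
    proof -
      have "to_fract (wp ^ h) * B m (\<mu> r *s v (\<pi> r)) = to_fract (\<mu> r * b m (v (\<pi> r)))"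
        using B[OF m, of "\<mu> r *s v (\<pi> r)"] m \<pi>r by (simp add: b_simps)
      also have "\<mu> r * b m (v (\<pi> r)) = wp ^ h * d r m"
        using q[OF m r] m by (simp add: d_def mult_ac flip: \<kappa>\<mu>[OF r])
      finally show ?thesis by simp
    qed
    have p0: "to_fract (wp ^ h :: 'k witt) \<noteq> 0" by (simp only: to_fract_eq_0_iff) simp
    show *: "\<mu> r *s v (\<pi> r) \<in> L \<and> (\<forall>m\<in>L. to_fract (d r m) = B m (\<mu> r *s v (\<pi> r)))"
      using eq p0 \<pi>r by simp
    fix y assume y: "y \<in> L \<and> (\<forall>m\<in>L. to_fract (d r m) = B m y)"
    let ?x = "\<mu> r *s v (\<pi> r)"
    have "to_fract (b m y) = to_fract (b m ?x)" if "m \<in> L" for m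
      using B[OF that, of y] B[OF that, of ?x] y * that by simp
    hence "b m y = b m ?x" if "m \<in> L" for m using that by (simp only: to_fract_eq_iff)
    hence "b m (y - ?x) = 0" if "m \<in> L" for m
      using that y \<pi>r b_simps(7)[of m y ?x] by simp
    hence "b (y - ?x) m = 0" if "m \<in> L" for m
      using b_skew[of "y - ?x" m] that y \<pi>r by simp
    hence "y - ?x = 0" using y \<pi>r by (intro b_nondeg) auto
    thus "y = ?x" by simp
  qed
  have df: "dual_form B L (d r) (d s) = (if s = \<pi> r then \<mu> r else 0)" if "r < n" "s < n" for r s
  proof -
    have "d s (\<mu> r *s v (\<pi> r)) = \<mu> r * d s (v (\<pi> r))"
      using d_dual[OF that(2)] v[of "\<pi> r"] \<pi>[OF that(1)] by (simp add: dual_def)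
    thus ?thesis using d_v[OF that(2), of "\<pi> r"] \<pi>[OF that(1)] by (auto simp: dual_form_def dv[OF that(1)])
  qed
  show ?thesis
    by (rule eq_matI) (simp_all add: dual_gram_matrix_def db df)
qed

text \<open>The case of \<open>N\<close> equal blocks of size \<open>d\<close>: the partner of the \<open>k\<close>-th vector of a block is the
  \<open>\<tau> k\<close>-th vector of the same block.\<close>

lemma block_normal_form:
  fixes B :: "'m \<Rightarrow> 'm \<Rightarrow> 'k witt fract" and v :: "nat \<Rightarrow> 'm" and \<kappa> \<mu> :: "nat \<Rightarrow> 'k witt"
  assumes v: "\<And>r. r < N * d \<Longrightarrow> v r \<in> L"
    and \<tau>: "\<And>k. k < d \<Longrightarrow> \<tau> k < d \<and> \<tau> (\<tau> k) = k"
    and gram: "\<And>a c k j. a < N \<Longrightarrow> c < N \<Longrightarrow> k < d \<Longrightarrow> j < d \<Longrightarrow>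
                 b (v (d * a + k)) (v (d * c + j)) = (if a = c \<and> j = \<tau> k then \<kappa> k else 0)"
    and \<kappa>_dvd: "\<And>x a k. x \<in> L \<Longrightarrow> a < N \<Longrightarrow> k < d \<Longrightarrow> \<kappa> k dvd b (v (d * a + k)) x"
    and \<kappa>\<mu>: "\<And>k. k < d \<Longrightarrow> \<kappa> k * \<mu> k = wp ^ h"
    and span_p: "\<And>x. x \<in> L \<Longrightarrow> \<exists>z\<in>L. x - wp *s z \<in> span (v ` {..<N * d})"
    and B: "\<And>x y. x \<in> L \<Longrightarrow> y \<in> L \<Longrightarrow> to_fract (b x y) = to_fract (wp ^ h) * B x y"
    and A: "A \<in> carrier_mat d d" "\<And>k j. k < d \<Longrightarrow> j < d \<Longrightarrow> A $$ (k, j) = (if j = \<tau> k then \<mu> k else 0)"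
  shows "list_basis (map v [0..<N * d]) L"
    and "dual_gram_matrix B L (map v [0..<N * d]) = diag_block_mat (replicate N A)"
proof -
  let ?n = "N * d"
  let ?\<pi> = "\<lambda>r. d * (r div d) + \<tau> (r mod d)"
  have d: "d > 0" if "r < ?n" for r using that by (cases d) auto
  have digits: "r = d * (r div d) + r mod d" "r div d < N" "r mod d < d" if "r < ?n" for r
    using that d[OF that] by (auto simp: less_mult_imp_div_less)
  have \<pi>: "?\<pi> r < ?n \<and> ?\<pi> (?\<pi> r) = r" if r: "r < ?n" for r
  proof -
    have "d * (r div d) + \<tau> (r mod d) < d * Suc (r div d)"
      using \<tau>[OF digits(3)[OF r]] by simp
    also have "\<dots> \<le> d * N" using digits(2)[OF r] by (intro mult_le_mono2) simp
    finally show ?thesis using \<tau>[OF digits(3)[OF r]] by (simp add: mult.commute)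
  qed
  have eq_\<pi>: "s = ?\<pi> r \<longleftrightarrow> r div d = s div d \<and> s mod d = \<tau> (r mod d)" if "r < ?n" "s < ?n" for r s
    using digits_eq_iff[OF digits(3)[OF that(2)] conjunct1[OF \<tau>[OF digits(3)[OF that(1)]]]]
      digits(1)[OF that(2)] by metis
  have gram': "b (v r) (v s) = (if s = ?\<pi> r then \<kappa> (r mod d) else 0)" if "r < ?n" "s < ?n" for r s
    using gram[OF digits(2)[OF that(1)] digits(2)[OF that(2)] digits(3)[OF that(1)] digits(3)[OF that(2)]]
      digits(1)[OF that(1)] digits(1)[OF that(2)] eq_\<pi>[OF that] by metis
  have \<kappa>0: "\<kappa> (r mod d) \<noteq> 0" if "r < ?n" for r
    using \<kappa>\<mu>[OF digits(3)[OF that]] by auto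
  have \<kappa>_dvd': "\<kappa> (r mod d) dvd b (v r) x" if "x \<in> L" "r < ?n" for x r
    using \<kappa>_dvd[OF that(1) digits(2)[OF that(2)] digits(3)[OF that(2)]] digits(1)[OF that(2)] by metis
  show basis: "list_basis (map v [0..<?n]) L"
    by (rule monomial_gram_basis[OF v \<pi> gram' \<kappa>0 \<kappa>_dvd' span_p])
  have "dual_gram_matrix B L (map v [0..<?n]) = mat ?n ?n (\<lambda>(r, s). if s = ?\<pi> r then \<mu> (r mod d) else 0)"
    by (rule monomial_dual_gram[OF basis v \<pi> gram' \<kappa>0 \<kappa>_dvd' \<kappa>\<mu>[OF digits(3)] B])
  also have "\<dots> = mat ?n ?n (\<lambda>(i, j). if i div d = j div d then A $$ (i mod d, j mod d) else 0)"
    by (rule cong_mat) (use eq_\<pi> A(2) digits(3) in auto)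
  also have "\<dots> = diag_block_mat (replicate N A)"
  proof (cases "d = 0")
    case True
    have "diag_block_mat (replicate N A) = mat 0 0 f" for f
      using A(1) unfolding True by (induction N) (auto intro!: eq_matI simp: Let_def)
    thus ?thesis by (simp add: True)
  qed (use A(1) in \<open>simp add: index_diag_block_replicate\<close>)
  finally show "dual_gram_matrix B L (map v [0..<?n]) = diag_block_mat (replicate N A)" .
qed

lemma frame_basis_list:
  "map (frame_basis y) [0..<2 * n] = concat (map (\<lambda>i. [y (i - 1), F (y (i - 1))]) [1..<n + 1])"
proof (induction n)
  case (Suc n)
  have "[0..<2 * Suc n] = [0..<2 * n] @ [2 * n, Suc (2 * n)]" by simp
  hence "map (frame_basis y) [0..<2 * Suc n] =
      map (frame_basis y) [0..<2 * n] @ [y n, F (y n)]"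
    by (simp add: frame_basis_def)
  thus ?case using Suc by simp
qed simp

end

context odd_lattice
begin

lemma odd_frame_basis:
  assumes y: "reduced odd_G odd_H g y"
    and B: "\<And>x y. x \<in> L \<Longrightarrow> y \<in> L \<Longrightarrow> to_fract (b x y) = to_fract (wp ^ h) * B x y"
  shows "list_basis (map (frame_basis y) [0..<2 * g]) L"
    and "dual_gram_matrix B L (map (frame_basis y) [0..<2 * g]) =
      diag_block_mat (replicate g (mat_of_rows_list 2 [[0, wp ^ h], [- (wp ^ h), 0]]))"
proof -
  let ?A = "mat_of_rows_list 2 [[0, wp ^ h], [- (wp ^ h), 0 :: 'a witt]]"
  define \<tau> where "\<tau> = (\<lambda>k. 1 - k :: nat)"
  define \<kappa> where "\<kappa> = (\<lambda>k::nat. if k = 0 then 1 else - 1 :: 'a witt)"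
  define \<mu> where "\<mu> = (\<lambda>k::nat. if k = 0 then wp ^ h else - (wp ^ h) :: 'a witt)"
  note yS = frameD(1)[OF reducedD(1)[OF y]]
  have less2: "k < 2 \<longleftrightarrow> k = 0 \<or> k = 1" for k :: nat by auto
  have "b (frame_basis y (2 * a + k)) (frame_basis y (2 * c + j)) = (if a = c \<and> j = \<tau> k then \<kappa> k else 0)"
    if "a < g" "c < g" and k: "k < 2" and j: "j < 2" for a c k j
  proof -
    note gr = reducedD(3,4)[OF y that(1,2)]
    have "b (F (y a)) (y c) = - witt_frob (odd_H a c)"
      using b_F_left[of "y a" "y c"] yS that gr(2) by (simp add: eps_odd)
    moreover have "b (F (y a)) (F (y c)) = 0"
      using b_F_F[of "y a" "y c"] yS that gr(1) by simp
    ultimately show ?thesis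
      using k j gr unfolding less2 by (elim disjE) (simp_all add: frame_basis_def \<tau>_def \<kappa>_def)
  qed
  note gram = this
  have A: "?A $$ (k, j) = (if j = \<tau> k then \<mu> k else 0)" if "k < 2" "j < 2" for k j
    using that unfolding less2 by (elim disjE) (simp_all add: mat_of_rows_list_def \<tau>_def \<mu>_def)
  have A': "?A \<in> carrier_mat 2 2" by (rule carrier_matI) (simp_all add: mat_of_rows_list_def)
  have \<kappa>: "\<kappa> k * \<mu> k = wp ^ h" "\<kappa> k dvd w" for k w by (simp_all add: \<kappa>_def \<mu>_def)
  have \<tau>: "\<tau> k < 2 \<and> \<tau> (\<tau> k) = k" if "k < 2" for k using that by (auto simp: \<tau>_def)
  have n: "g * 2 = 2 * g" by simp
  note v = frame_basis_L[OF reducedD(1)[OF y]] and sp = frame_span[OF reducedD(1)[OF y]]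
  note nf = block_normal_form[OF v[folded n] \<tau> gram \<kappa>(2) \<kappa>(1) sp[folded n] B A' A, unfolded n]
  show "list_basis (map (frame_basis y) [0..<2 * g]) L"
    by (rule nf(1))
  show "dual_gram_matrix B L (map (frame_basis y) [0..<2 * g]) = diag_block_mat (replicate g ?A)"
    by (rule nf(2))
qed

end

context even_lattice
begin

text \<open>A block consists of \<open>y\<^sub>2\<^sub>a, F y\<^sub>2\<^sub>a, y\<^sub>2\<^sub>a\<^sub>+\<^sub>1, F y\<^sub>2\<^sub>a\<^sub>+\<^sub>1\<close>.  The pivots are
  \<open>b(y\<^sub>2\<^sub>a, y\<^sub>2\<^sub>a\<^sub>+\<^sub>1) = 1\<close> and \<open>b(F y\<^sub>2\<^sub>a, F y\<^sub>2\<^sub>a\<^sub>+\<^sub>1) = p\<close>, which accounts for the two different powers of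
  \<open>p\<close> in the dual Gram matrix.\<close>

lemma even_frame_basis:
  assumes y: "reduced even_G even_H g y" and g: "even g" and h: "h > 0"
    and B: "\<And>x y. x \<in> L \<Longrightarrow> y \<in> L \<Longrightarrow> to_fract (b x y) = to_fract (wp ^ h) * B x y"
  shows "list_basis (map (frame_basis y) [0..<2 * g]) L"
    and "dual_gram_matrix B L (map (frame_basis y) [0..<2 * g]) =
      diag_block_mat (replicate (g div 2) (mat_of_rows_list 4
        [[0, 0, wp ^ h, 0], [0, 0, 0, wp ^ (h - 1)], [- (wp ^ h), 0, 0, 0], [0, - (wp ^ (h - 1)), 0, 0]]))"
proof -
  let ?A = "mat_of_rows_list 4
        [[0, 0, wp ^ h, 0], [0, 0, 0, wp ^ (h - 1)], [- (wp ^ h), 0, 0, 0], [0, - (wp ^ (h - 1)), 0, 0 :: 'a witt]]"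
  define \<tau> where "\<tau> = (\<lambda>k. if k < 2 then k + 2 else k - 2 :: nat)"
  define \<kappa> where "\<kappa> = (\<lambda>k::nat. [1, wp, - 1, - wp :: 'a witt] ! k)"
  define \<mu> where "\<mu> = (\<lambda>k::nat. [wp ^ h, wp ^ (h - 1), - (wp ^ h), - (wp ^ (h - 1)) :: 'a witt] ! k)"
  note yS = frameD(1)[OF reducedD(1)[OF y]]
  have less4: "k < 4 \<longleftrightarrow> k = 0 \<or> k = 1 \<or> k = 2 \<or> k = 3" for k :: nat by auto
  have fb: "frame_basis y (4 * a + 0) = y (2 * a)" "frame_basis y (4 * a + 1) = F (y (2 * a))"
    "frame_basis y (4 * a + 2) = y (Suc (2 * a))" "frame_basis y (4 * a + 3) = F (y (Suc (2 * a)))" for a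
  proof -
    have "(4 * a + 0) div 2 = 2 * a" "(4 * a + 1) div 2 = 2 * a" "(4 * a + 2) div 2 = Suc (2 * a)"
      "(4 * a + 3) div 2 = Suc (2 * a)" by simp_all
    moreover have "even (4 * a + 0)" "odd (4 * a + 1)" "even (4 * a + 2)" "odd (4 * a + 3)" by simp_all
    ultimately show "frame_basis y (4 * a + 0) = y (2 * a)" "frame_basis y (4 * a + 1) = F (y (2 * a))"
      "frame_basis y (4 * a + 2) = y (Suc (2 * a))" "frame_basis y (4 * a + 3) = F (y (Suc (2 * a)))"
      unfolding frame_basis_def by presburger+
  qed
  have gr: "b (y i) (y j) = even_G i j" "b (y i) (F (y j)) = 0" "b (F (y i)) (y j) = 0"
    "b (F (y i)) (F (y j)) = wp * even_G i j" if "i < g" "j < g" for i j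
    using b_F_left[of "y i" "y j"] b_F_F[of "y i" "y j"] yS that reducedD(3,4)[OF y that] by simp_all
  have "b (frame_basis y (4 * a + k)) (frame_basis y (4 * c + j)) = (if a = c \<and> j = \<tau> k then \<kappa> k else 0)"
    if "a < g div 2" "c < g div 2" and k: "k < 4" and j: "j < 4" for a c k j
  proof -
    have ac: "2 * a < g" "Suc (2 * a) < g" "2 * c < g" "Suc (2 * c) < g" using that g by auto
    have parity: "2 * i \<noteq> Suc (2 * j)" for i j :: nat by presburger
    note gr'' = gr[OF ac(1,3)] gr[OF ac(1,4)] gr[OF ac(2,3)] gr[OF ac(2,4)]
    show ?thesis
      using k j unfolding less4 by (elim disjE) (simp_all only: fb gr'', simp_all add: \<tau>_def \<kappa>_def parity)
  qed
  note gram = this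
  have A: "?A $$ (k, j) = (if j = \<tau> k then \<mu> k else 0)" if "k < 4" "j < 4" for k j
    using that unfolding less4 by (elim disjE) (simp_all add: mat_of_rows_list_def \<tau>_def \<mu>_def)
  have A': "?A \<in> carrier_mat 4 4" by (rule carrier_matI) (simp_all add: mat_of_rows_list_def)
  have ph: "wp * (wp ^ (h - 1) :: 'a witt) = wp ^ h" using h by (cases h) auto
  have \<kappa>\<mu>: "\<kappa> k * \<mu> k = wp ^ h" if "k < 4" for k
    using that unfolding less4 by (elim disjE) (simp_all add: \<kappa>_def \<mu>_def ph[simplified])
  have \<tau>: "\<tau> k < 4 \<and> \<tau> (\<tau> k) = k" if "k < 4" for k
    using that unfolding less4 by (elim disjE) (simp_all add: \<tau>_def)
  have n: "g div 2 * 4 = 2 * g" using g by auto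
  have wp_F: "wp dvd b (F (y i)) x" if "x \<in> L" "i < g" for x i
    using even_F[of x "y i"] b_skew[of "F (y i)" x] yS that by simp
  have \<kappa>_dvd: "\<kappa> k dvd b (frame_basis y (4 * a + k)) x" if x: "x \<in> L" and a: "a < g div 2" and k: "k < 4" for x a k
  proof -
    have "2 * a < g" "Suc (2 * a) < g" using a g by auto
    thus ?thesis using k wp_F[OF x] unfolding less4
      by (elim disjE) (simp_all only: fb, simp_all add: \<kappa>_def)
  qed
  note v = frame_basis_L[OF reducedD(1)[OF y]] and sp = frame_span[OF reducedD(1)[OF y]]
  note nf = block_normal_form[OF v[folded n] \<tau> gram \<kappa>_dvd \<kappa>\<mu> sp[folded n] B A' A, unfolded n]
  show "list_basis (map (frame_basis y) [0..<2 * g]) L"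
    by (rule nf(1))
  show "dual_gram_matrix B L (map (frame_basis y) [0..<2 * g]) = diag_block_mat (replicate (g div 2) ?A)"
    by (rule nf(2))
qed

end

section \<open>The top module of a polarised flag type quotient\<close>

lemma fract_frob_mult_to_fract:
  "fract_frob (to_fract c * q) = to_fract (witt_frob c) * fract_frob (q :: 'k::idom_prime_char witt fract)"
proof (cases q)
  case (Fract a d)
  thus ?thesis by (simp add: to_fract_def fract_frob_Fract)
qed

context pftq
begin

definition top_module :: "'m set" where
  "top_module = M (g - 1)"

lemma top_less: "g - 1 < g"
  using genus by simp

lemma top_submodule: "subspace top_module" "F ` top_module \<subseteq> top_module" "V ` top_module \<subseteq> top_module"
proof -
  have "free_dieudonne_submodule (2 * g) top_module"
    using supersingular[OF top_less] unfolding supersingular_def top_module_def by (rule conjunct1)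
  note free = this[unfolded free_dieudonne_submodule_def list_basis_def]
  show "F ` top_module \<subseteq> top_module" "V ` top_module \<subseteq> top_module" using free by simp_all
  obtain bs where "span (set bs) = top_module" using free by (elim conjE exE)
  thus "subspace top_module" using subspace_span[of "set bs"] by simp
qed

lemma top_closed [simp]:
  "0 \<in> top_module" "x \<in> top_module \<Longrightarrow> y \<in> top_module \<Longrightarrow> x + y \<in> top_module" "x \<in> top_module \<Longrightarrow> w *s x \<in> top_module"
  "x \<in> top_module \<Longrightarrow> y \<in> top_module \<Longrightarrow> x - y \<in> top_module" "x \<in> top_module \<Longrightarrow> F x \<in> top_module" "x \<in> top_module \<Longrightarrow> V x \<in> top_module"
  "x \<in> top_module \<Longrightarrow> (F ^^ n) x \<in> top_module"
proof -
  note sub = top_submodule(1)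
  show F: "F x \<in> top_module" if "x \<in> top_module" for x using top_submodule(2) that by blast
  show "(F ^^ n) x \<in> top_module" if "x \<in> top_module" using that by (induction n) (simp_all add: F)
  show "V x \<in> top_module" if "x \<in> top_module" using top_submodule(3) that by blast
  show "0 \<in> top_module" "x \<in> top_module \<Longrightarrow> y \<in> top_module \<Longrightarrow> x + y \<in> top_module" "x \<in> top_module \<Longrightarrow> w *s x \<in> top_module"
    "x \<in> top_module \<Longrightarrow> y \<in> top_module \<Longrightarrow> x - y \<in> top_module"
    by (rule subspace_0[OF sub] subspace_add[OF sub] subspace_scale[OF sub] subspace_diff[OF sub]; assumption?)+
qed

lemma top_coordinates:
  obtains \<phi> where "bij_betw \<phi> top_module (A11_pow g)"
    and "\<And>x y. x \<in> top_module \<Longrightarrow> y \<in> top_module \<Longrightarrow> \<phi> (x + y) = (\<lambda>i. \<phi> x i + \<phi> y i)"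
    and "\<And>x w. x \<in> top_module \<Longrightarrow> \<phi> (w *s x) = (\<lambda>i. A11_scale w (\<phi> x i))"
    and "\<And>x. x \<in> top_module \<Longrightarrow> \<phi> (F x) = (\<lambda>i. A11_F (\<phi> x i))"
    and "\<And>x. x \<in> top_module \<Longrightarrow> \<phi> (V x) = (\<lambda>i. A11_V (\<phi> x i))"
proof -
  obtain \<phi> where \<phi>: "hom_to_A11_pow g top_module \<phi>" and bij: "bij_betw \<phi> top_module (A11_pow g)"
    using top_superspecial unfolding superspecial_def top_module_def by blast
  note hom = \<phi>[unfolded hom_to_A11_pow_def dieudonne_hom_def]
  show thesis
    by (rule that[OF bij]) (use hom in \<open>simp_all add: plus_fun_def\<close>)
qed

text \<open>In \<open>A\<^sub>1\<^sub>,\<^sub>1\<close> the maps \<open>F\<close> and \<open>V\<close> agree up to \<open>\<sigma>\<^sup>2\<close> on the coordinates.\<close>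

lemma top_F_V: "F ` top_module = V ` top_module"
proof -
  obtain \<phi> where bij: "bij_betw \<phi> top_module (A11_pow g)"
    and "\<And>x y. x \<in> top_module \<Longrightarrow> y \<in> top_module \<Longrightarrow> \<phi> (x + y) = (\<lambda>i. \<phi> x i + \<phi> y i)"
    and "\<And>x w. x \<in> top_module \<Longrightarrow> \<phi> (w *s x) = (\<lambda>i. A11_scale w (\<phi> x i))"
    and FV: "\<And>x. x \<in> top_module \<Longrightarrow> \<phi> (F x) = (\<lambda>i. A11_F (\<phi> x i))" "\<And>x. x \<in> top_module \<Longrightarrow> \<phi> (V x) = (\<lambda>i. A11_V (\<phi> x i))"
    by (rule top_coordinates) (rule that)
  have inj: "x = y" if "x \<in> top_module" "y \<in> top_module" "\<phi> x = \<phi> y" for x y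
    using bij that by (auto simp: bij_betw_def inj_on_def)
  have surj: "\<exists>x\<in>top_module. \<phi> x = s" if "s \<in> A11_pow g" for s
    using bij that by (metis bij_betw_def imageE)
  have in_pow: "\<phi> x \<in> A11_pow g" if "x \<in> top_module" for x using bij that by (auto simp: bij_betw_def)
  have inv0: "witt_frob_inv (0 :: 'k witt) = 0" using witt_frob_inv(2)[of "0 :: 'k witt"] by simp
  show ?thesis
  proof (intro equalityI subsetI; elim imageE)
    fix u x assume u: "u = F x" and x: "x \<in> top_module"
    let ?s = "\<lambda>i. (witt_frob (witt_frob (fst (\<phi> x i))), witt_frob (witt_frob (snd (\<phi> x i))))"
    have "?s \<in> A11_pow g" using in_pow[OF x] by (auto simp: A11_pow_def zero_prod_def)
    then obtain z where z: "z \<in> top_module" "\<phi> z = ?s" using surj by blast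
    have "F x = V z"
      by (rule inj) (use x z in \<open>auto simp: FV A11_F_def A11_V_def witt_frob_inv\<close>)
    thus "u \<in> V ` top_module" using u z by blast
  next
    fix u x assume u: "u = V x" and x: "x \<in> top_module"
    let ?s = "\<lambda>i. (witt_frob_inv (witt_frob_inv (fst (\<phi> x i))), witt_frob_inv (witt_frob_inv (snd (\<phi> x i))))"
    have "?s \<in> A11_pow g" using in_pow[OF x] by (auto simp: A11_pow_def zero_prod_def inv0)
    then obtain z where z: "z \<in> top_module" "\<phi> z = ?s" using surj by blast
    have "V x = F z"
      by (rule inj) (use x z in \<open>auto simp: FV A11_F_def A11_V_def witt_frob_inv\<close>)
    thus "u \<in> F ` top_module" using u z by blast
  qed
qed

text \<open>With \<open>\<phi>\<close> an isomorphism to the power of \<open>A\<^sub>1\<^sub>,\<^sub>1\<close>, take the \<open>y i\<close> that correspond to \<open>w\<close> times the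
  standard generators; the condition on \<open>w\<close> turns \<open>V = F\<close> on the generators into \<open>V = \<epsilon> F\<close>.  Modulo \<open>F\<close> only
  the first coordinates remain.\<close>

lemma top_skeleton:
  fixes \<epsilon> w :: "'k witt"
  assumes w: "w dvd 1" and eps: "\<epsilon> * witt_frob (witt_frob w) = w" "witt_frob \<epsilon> = \<epsilon>"
  shows "\<exists>y. (\<forall>i<g. y i \<in> top_module \<and> V (y i) = \<epsilon> *s F (y i)) \<and>
     (\<forall>x\<in>top_module. \<exists>a. x - (\<Sum>i<g. a i *s y i) \<in> F ` top_module) \<and>
     (\<forall>a. (\<Sum>i<g. a i *s y i) \<in> F ` top_module \<longrightarrow> (\<forall>i<g. wp dvd a i))"
proof -
  obtain \<phi> where bij: "bij_betw \<phi> top_module (A11_pow g)"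
    and add: "\<And>x y. x \<in> top_module \<Longrightarrow> y \<in> top_module \<Longrightarrow> \<phi> (x + y) = (\<lambda>i. \<phi> x i + \<phi> y i)"
    and scale: "\<And>x w. x \<in> top_module \<Longrightarrow> \<phi> (w *s x) = (\<lambda>i. A11_scale w (\<phi> x i))"
    and FV: "\<And>x. x \<in> top_module \<Longrightarrow> \<phi> (F x) = (\<lambda>i. A11_F (\<phi> x i))" "\<And>x. x \<in> top_module \<Longrightarrow> \<phi> (V x) = (\<lambda>i. A11_V (\<phi> x i))"
    by (rule top_coordinates) (rule that)
  have inj: "x = y" if "x \<in> top_module" "y \<in> top_module" "\<phi> x = \<phi> y" for x y
    using bij that by (auto simp: bij_betw_def inj_on_def)
  have surj: "\<exists>x\<in>top_module. \<phi> x = s" if "s \<in> A11_pow g" for s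
    using bij that by (metis bij_betw_def imageE)
  have in_pow: "\<phi> x i = 0" if "x \<in> top_module" "\<not> i < g" for x i
    using bij_betwE[OF bij] that by (simp add: A11_pow_def)
  have \<phi>0: "\<phi> 0 = (\<lambda>i. 0)"
    using scale[of 0 0] by (simp add: A11_scale_def zero_prod_def)
  have inv0: "witt_frob_inv (0 :: 'k witt) = 0" using witt_frob_inv(2)[of "0 :: 'k witt"] by simp
  have "\<exists>y\<in>top_module. \<phi> y = (\<lambda>j. if j = i then (w, 0) else 0)" if "i < g" for i
    by (rule surj) (use that in \<open>auto simp: A11_pow_def\<close>)
  then obtain y where y: "\<And>i. i < g \<Longrightarrow> y i \<in> top_module"
    "\<And>i. i < g \<Longrightarrow> \<phi> (y i) = (\<lambda>j. if j = i then (w, 0) else 0)" by metis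
  have w_inv: "witt_frob_inv w = \<epsilon> * witt_frob w"
    using witt_frob_inv(2)[of "\<epsilon> * witt_frob w"] by (simp add: eps)
  have V_y: "V (y i) = \<epsilon> *s F (y i)" if i: "i < g" for i
    by (rule inj)
      (use y[OF i] in \<open>auto simp: FV scale A11_F_def A11_V_def A11_scale_def w_inv inv0 zero_prod_def\<close>)
  have sum: "(\<Sum>i<n. a i *s y i) \<in> top_module \<and>
      \<phi> (\<Sum>i<n. a i *s y i) = (\<lambda>j. if j < n then (a j * w, 0) else 0)" if "n \<le> g" for n a
    using that
  proof (induction n)
    case 0
    show ?case by (simp add: \<phi>0)
  next
    case (Suc n)
    hence "y n \<in> top_module" "\<phi> (y n) = (\<lambda>j. if j = n then (w, 0) else 0)" using y by auto
    thus ?case using Suc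
      by (auto simp: add scale A11_scale_def zero_prod_def fun_eq_iff less_Suc_eq)
  qed
  show ?thesis
  proof (rule exI[of _ y], intro conjI allI impI ballI)
    show "y i \<in> top_module" "V (y i) = \<epsilon> *s F (y i)" if "i < g" for i using y V_y that by auto
  next
    fix x assume x: "x \<in> top_module"
    obtain v where v: "w * v = 1" using w by (metis dvdE)
    define a where "a = (\<lambda>i. fst (\<phi> x i) * v)"
    have "(\<lambda>i. (witt_frob_inv (snd (\<phi> x i)), 0)) \<in> A11_pow g"
      using in_pow[OF x] by (auto simp: A11_pow_def zero_prod_def inv0)
    then obtain z where z: "z \<in> top_module" "\<phi> z = (\<lambda>i. (witt_frob_inv (snd (\<phi> x i)), 0))" using surj by blast
    have "x = (\<Sum>i<g. a i *s y i) + F z"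
    proof (rule inj)
      have "fst (\<phi> x i) * v * w = fst (\<phi> x i)" for i using v by (simp add: mult_ac)
      thus "\<phi> x = \<phi> ((\<Sum>i<g. a i *s y i) + F z)"
        using x z sum[of g a] in_pow[OF x]
        by (auto simp: add FV A11_F_def a_def witt_frob_inv fun_eq_iff zero_prod_def prod_eq_iff)
    qed (use x z sum in auto)
    hence "x - (\<Sum>i<g. a i *s y i) = F z" by simp
    thus "\<exists>a. x - (\<Sum>i<g. a i *s y i) \<in> F ` top_module" using z by blast
  next
    fix a i assume "(\<Sum>i<g. a i *s y i) \<in> F ` top_module" and i: "i < g"
    then obtain z where z: "(\<Sum>i<g. a i *s y i) = F z" "z \<in> top_module" by blast
    have "(a i * w, 0) = A11_F (\<phi> z i)" using sum[of g a] FV(1)[OF z(2)] i by (metis order_refl z(1))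
    hence "wp dvd a i * w" by (simp add: A11_F_def)
    thus "wp dvd a i" using w by (simp add: wp_dvd_mult_iff witt_unit_iff)
  qed
qed

lemma F_wp_power: "F (wp ^ n *s x) = wp ^ n *s F x"
  by (simp add: F_scale)

lemma F_pow_wp: "(F ^^ n) (wp ^ m *s x) = wp ^ m *s (F ^^ n) x"
  by (induction n) (simp_all add: F_wp_power)

lemma top_wp_F_F:
  assumes "x \<in> top_module"
  shows "\<exists>z\<in>top_module. F (F z) = wp *s x" "\<exists>z\<in>top_module. F (F x) = wp *s z"
proof -
  obtain z where "V x = F z" "z \<in> top_module" using assms top_F_V by blast
  thus "\<exists>z\<in>top_module. F (F z) = wp *s x" using F_V[of x] by auto
  obtain z where "F x = V z" "z \<in> top_module" using assms top_F_V by blast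
  thus "\<exists>z\<in>top_module. F (F x) = wp *s z" using F_V[of z] by auto
qed

text \<open>On the top module \<open>F\<^sup>2\<close> is not multiplication by \<open>p\<close>, but it has the same image.\<close>

lemma top_F_even_power:
  "x \<in> top_module \<Longrightarrow> \<exists>z\<in>top_module. (F ^^ (2 * m)) z = wp ^ m *s x"
  "x \<in> top_module \<Longrightarrow> \<exists>z\<in>top_module. (F ^^ (2 * m)) x = wp ^ m *s z"
proof -
  show "x \<in> top_module \<Longrightarrow> \<exists>z\<in>top_module. (F ^^ (2 * m)) z = wp ^ m *s x" for x
  proof (induction m arbitrary: x)
    case (Suc m)
    obtain z where z: "z \<in> top_module" "(F ^^ (2 * m)) z = wp ^ m *s x" using Suc by blast
    obtain u where u: "u \<in> top_module" "F (F u) = wp *s z" using top_wp_F_F(1)[OF z(1)] by blast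
    have "(F ^^ (2 * Suc m)) u = (F ^^ (2 * m)) (F (F u))" by (simp add: funpow_swap1)
    also have "\<dots> = wp *s (F ^^ (2 * m)) z" using F_pow_wp[of "2 * m" 1 z] u by simp
    finally show ?case using u z by auto
  qed auto
  show "x \<in> top_module \<Longrightarrow> \<exists>z\<in>top_module. (F ^^ (2 * m)) x = wp ^ m *s z" for x
  proof (induction m arbitrary: x)
    case (Suc m)
    obtain z where z: "z \<in> top_module" "F (F x) = wp *s z" using top_wp_F_F(2)[OF Suc.prems] by blast
    obtain u where u: "u \<in> top_module" "(F ^^ (2 * m)) z = wp ^ m *s u" using Suc.IH z by blast
    have "(F ^^ (2 * Suc m)) x = (F ^^ (2 * m)) (F (F x))" by (simp add: funpow_swap1)
    also have "\<dots> = wp *s (F ^^ (2 * m)) z" using F_pow_wp[of "2 * m" 1 z] z by simp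
    finally show ?case using u by auto
  qed auto
qed

lemma top_B:
  shows "x \<in> top_module \<Longrightarrow> y \<in> top_module \<Longrightarrow> z \<in> top_module \<Longrightarrow> B x (y + z) = B x y + B x z"
    "x \<in> top_module \<Longrightarrow> y \<in> top_module \<Longrightarrow> B x (w *s y) = to_fract w * B x y"
    "x \<in> top_module \<Longrightarrow> B x x = 0"
    "x \<in> top_module \<Longrightarrow> y \<in> top_module \<Longrightarrow> B x y = - B y x"
    "x \<in> top_module \<Longrightarrow> (\<And>y. y \<in> top_module \<Longrightarrow> B x y = 0) \<Longrightarrow> x = 0"
    "x \<in> top_module \<Longrightarrow> y \<in> top_module \<Longrightarrow> B (F x) y = fract_frob (B x (V y))"
proof -
  note qp = quasi_polarisation[OF top_less, folded top_module_def, unfolded quasi_polarisation_def]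
  show add: "B x (y + z) = B x y + B x z" if "x \<in> top_module" "y \<in> top_module" "z \<in> top_module" for x y z
    using qp that by blast
  have add': "B (x + y) z = B x z + B y z" if "x \<in> top_module" "y \<in> top_module" "z \<in> top_module" for x y z
    using qp that by blast
  show "B x (w *s y) = to_fract w * B x y" if "x \<in> top_module" "y \<in> top_module" using qp that by blast
  show alt: "B x x = 0" if "x \<in> top_module" for x using qp that by blast
  show "B x y = - B y x" if "x \<in> top_module" "y \<in> top_module"
  proof -
    have "B (x + y) (x + y) = (B x x + B x y) + (B y x + B y y)"
      using that by (simp add: add add' ac_simps)
    thus ?thesis using that by (simp add: alt eq_neg_iff_add_eq_0)
  qed
  show "x = 0" if "x \<in> top_module" "\<And>y. y \<in> top_module \<Longrightarrow> B x y = 0" using qp that by blast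
  show "B (F x) y = fract_frob (B x (V y))" if "x \<in> top_module" "y \<in> top_module" using qp that by blast
qed

text \<open>The two inclusions of \<open>M\<^sup>t = F\<^sup>g\<^sup>-\<^sup>1 M\<close> in terms of the form.\<close>

lemma top_dual_functional:
  assumes "z \<in> top_module"
  shows "\<exists>d. \<forall>m\<in>top_module. B m ((F ^^ (g - 1)) z) = to_fract (d m)"
proof -
  have "form_functional B top_module ((F ^^ (g - 1)) z) \<in> dual_lattice top_module"
    using top_dual assms unfolding top_module_def by blast
  then obtain d where "form_functional B top_module ((F ^^ (g - 1)) z) = (\<lambda>m. to_fract (d m))"
    by (auto simp: dual_lattice_def)
  thus ?thesis by (intro exI[of _ d]) (auto simp: form_functional_def fun_eq_iff split: if_splits)
qed

lemma top_dual_represent: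
  assumes "d \<in> dual top_module"
  shows "\<exists>z\<in>top_module. \<forall>m\<in>top_module. B m ((F ^^ (g - 1)) z) = to_fract (d m)"
proof -
  have "(\<lambda>m. to_fract (d m)) \<in> dual_lattice top_module" using assms by (auto simp: dual_lattice_def)
  then obtain z where z: "z \<in> top_module" "(\<lambda>m. to_fract (d m)) = form_functional B top_module ((F ^^ (g - 1)) z)"
    using top_dual unfolding top_module_def by blast
  thus ?thesis by (intro bexI[of _ z]) (auto simp: form_functional_def fun_eq_iff)
qed

definition eps :: "'k witt" where
  "eps = (if odd g then - 1 else 1)"

text \<open>The rescaled form, which is integral by \<open>top_dual_functional\<close> since \<open>p\<^sup>h M \<subseteq> F\<^sup>g\<^sup>-\<^sup>1 M\<close> for
  \<open>h = \<lfloor>g / 2\<rfloor>\<close>.\<close>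

definition int_form :: "'m \<Rightarrow> 'm \<Rightarrow> 'k witt" where
  "int_form x y = (SOME w. to_fract w = to_fract (wp ^ (g div 2)) * B x y)"

lemma int_form:
  assumes "x \<in> top_module" "y \<in> top_module"
  shows "to_fract (int_form x y) = to_fract (wp ^ (g div 2)) * B x y"
proof -
  let ?h = "g div 2"
  obtain z where z: "z \<in> top_module" "(F ^^ (2 * ?h)) z = wp ^ ?h *s y"
    using top_F_even_power(1)[OF assms(2)] by blast
  have "g - 1 \<le> 2 * ?h" by presburger
  then obtain k where k: "2 * ?h = (g - 1) + k" using le_Suc_ex by blast
  define u where "u = (F ^^ k) z"
  have u: "u \<in> top_module" using z by (simp add: u_def)
  have "(F ^^ (2 * ?h)) z = (F ^^ (g - 1)) u" by (simp only: k u_def funpow_add o_apply)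
  moreover obtain d where "\<forall>m\<in>top_module. B m ((F ^^ (g - 1)) u) = to_fract (d m)"
    using top_dual_functional[OF u] by blast
  ultimately have "to_fract (d x) = B x (wp ^ ?h *s y)" using assms z by simp
  also have "\<dots> = to_fract (wp ^ ?h) * B x y" using assms by (rule top_B(2))
  finally show ?thesis unfolding int_form_def by (rule someI)
qed

lemma int_form_eqI:
  assumes "x \<in> top_module" "y \<in> top_module" "to_fract (wp ^ (g div 2)) * B x y = to_fract w"
  shows "int_form x y = w"
  using int_form[OF assms(1,2)] assms(3) by (simp only: to_fract_eq_iff)

lemma p_power_nz: "to_fract (wp ^ n :: 'k witt) \<noteq> 0"
  by (simp only: to_fract_eq_0_iff) simp

sublocale top_module: alternating_dieudonne scale F V top_module g int_form eps
proof unfold_locales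
  show "subspace top_module" "F ` top_module \<subseteq> top_module" "F ` top_module = V ` top_module" using top_submodule top_F_V by auto
  show "int_form x (y + z) = int_form x y + int_form x z" if "x \<in> top_module" "y \<in> top_module" "z \<in> top_module" for x y z
    by (rule int_form_eqI) (use that in \<open>simp_all add: top_B(1) int_form distrib_left\<close>)
  show "int_form x (w *s y) = w * int_form x y" if "x \<in> top_module" "y \<in> top_module" for x y w
    by (rule int_form_eqI) (use that in \<open>simp_all add: top_B(2) int_form mult_ac\<close>)
  show "int_form x x = 0" if "x \<in> top_module" for x
    by (rule int_form_eqI) (use that in \<open>simp_all add: top_B(3)\<close>)
  show "int_form x y = - int_form y x" if "x \<in> top_module" "y \<in> top_module" for x y
    by (rule int_form_eqI) (use that top_B(4)[of x y] in \<open>simp_all add: int_form\<close>)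
  show "int_form (F x) y = witt_frob (int_form x (V y))" if "x \<in> top_module" "y \<in> top_module" for x y
  proof (rule int_form_eqI)
    have "to_fract (witt_frob (int_form x (V y))) = fract_frob (to_fract (wp ^ (g div 2)) * B x (V y))"
      using that by (simp only: fract_frob_to_fract[symmetric] int_form top_closed)
    thus "to_fract (wp ^ (g div 2)) * B (F x) y = to_fract (witt_frob (int_form x (V y)))"
      using that by (simp only: fract_frob_mult_to_fract witt_frob_wp_power top_B(6))
  qed (use that in auto)
  show "x = 0" if x: "x \<in> top_module" and 0: "\<And>y. y \<in> top_module \<Longrightarrow> int_form x y = 0" for x
  proof (rule top_B(5)[OF x])
    fix y assume "y \<in> top_module"
    hence "to_fract (wp ^ (g div 2)) * B x y = 0" using int_form[OF x, of y] 0 by simp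
    thus "B x y = 0" using p_power_nz by (simp only: mult_eq_0_iff) blast
  qed
  show "eps = 1 \<or> eps = - 1" by (simp add: eps_def)
qed

lemma top_frame: "\<exists>y. top_module.frame y"
proof -
  obtain w :: "'k witt" where w: "w dvd 1" "witt_frob (witt_frob w) = - w"
    using witt_frob_twice_eq_minus by blast
  have "\<exists>w :: 'k witt. w dvd 1 \<and> eps * witt_frob (witt_frob w) = w"
  proof (cases "odd g")
    case True
    thus ?thesis using w by (intro exI[of _ w]) (simp add: eps_def)
  next
    case False
    thus ?thesis by (intro exI[of _ 1]) (simp add: eps_def)
  qed
  then obtain w :: "'k witt" where w: "w dvd 1" "eps * witt_frob (witt_frob w) = w" by blast
  show ?thesis
    using top_skeleton[OF w top_module.eps_simps(3)] unfolding top_module.frame_def top_module.skeleton_def by blast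
qed

text \<open>If \<open>b(x, -)\<close> is divisible by \<open>p\<close>, then \<open>b(-, x) / p\<close> is an integral functional, hence
  represented by an element \<open>F\<^sup>g\<^sup>-\<^sup>1 z\<close> of \<open>M\<^sup>t\<close>.\<close>

lemma int_form_dvd_all:
  assumes x: "x \<in> top_module" and dvd: "\<And>m. m \<in> top_module \<Longrightarrow> wp dvd int_form x m"
  shows "\<exists>z\<in>top_module. wp *s (F ^^ (g - 1)) z = wp ^ (g div 2) *s x"
proof -
  have "\<exists>q. int_form m x = wp * q" if "m \<in> top_module" for m
    using dvd[OF that] top_module.b_skew[OF that x] by (auto elim!: dvdE intro: exI[of _ "- _"])
  then obtain q where q: "\<And>m. m \<in> top_module \<Longrightarrow> int_form m x = wp * q m" by metis
  have qI: "q m = w" if "m \<in> top_module" "int_form m x = wp * w" for m w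
    using q[OF that(1)] that(2) by simp
  define d where "d = (\<lambda>m. if m \<in> top_module then q m else 0)"
  have "q (m + n) = q m + q n" if "m \<in> top_module" "n \<in> top_module" for m n
    by (rule qI) (use that x q[OF that(1)] q[OF that(2)] in \<open>simp_all add: top_module.b_simps distrib_left\<close>)
  moreover have "q (w *s m) = w * q m" if "m \<in> top_module" for m w
    by (rule qI) (use that x q[OF that] in \<open>simp_all add: top_module.b_simps\<close>)
  ultimately have "d \<in> dual top_module" by (simp add: dual_def d_def)
  then obtain z where z: "z \<in> top_module" "\<And>m. m \<in> top_module \<Longrightarrow> B m ((F ^^ (g - 1)) z) = to_fract (d m)"
    using top_dual_represent by blast
  let ?u = "wp *s (F ^^ (g - 1)) z" and ?v = "wp ^ (g div 2) *s x"
  have "int_form m (?u - ?v) = 0" if m: "m \<in> top_module" for m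
  proof -
    have "B m ?u = to_fract (wp * q m)" using z m by (simp add: top_B(2) d_def)
    also have "\<dots> = to_fract (wp ^ (g div 2)) * B m x" using q[OF m] int_form[OF m x] by simp
    also have "\<dots> = B m ?v" using m x by (simp add: top_B(2))
    finally have "int_form m ?u = int_form m ?v"
      using m z x by (intro int_form_eqI) (simp_all add: int_form)
    thus ?thesis using m z x by (simp add: top_module.b_simps)
  qed
  hence "int_form (?u - ?v) m = 0" if "m \<in> top_module" for m
    using top_module.b_skew[of "?u - ?v" m] that z x by simp
  hence "?u - ?v = 0" using z x by (intro top_module.b_nondeg) auto
  thus ?thesis using z by (intro bexI[of _ z]) auto
qed

lemma odd_lattice_top: "odd g \<Longrightarrow> odd_lattice scale F V top_module int_form eps"
proof unfold_locales
  assume g: "odd g"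
  show "eps = - 1" using g by (simp add: eps_def)
  fix x assume x: "x \<in> top_module" and dvd: "\<And>m. m \<in> top_module \<Longrightarrow> wp dvd int_form x m"
  have g1: "g - 1 = 2 * (g div 2)" using g by presburger
  obtain z where z: "z \<in> top_module" "wp *s (F ^^ (g - 1)) z = wp ^ (g div 2) *s x"
    using int_form_dvd_all[OF x dvd] by blast
  obtain u where u: "u \<in> top_module" "(F ^^ (g - 1)) z = wp ^ (g div 2) *s u"
    unfolding g1 using top_F_even_power(2)[OF z(1)] by blast
  have "wp ^ (g div 2) *s (x - wp *s u) = 0" using z u by (simp add: scale_right_diff_distrib mult.commute)
  hence "x - wp *s u = 0" using top_module.torsion_free[of "x - wp *s u" "wp ^ (g div 2)"] x u by simp
  thus "\<exists>z\<in>top_module. x = wp *s z" using u by auto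
qed

lemma even_lattice_top: "even g \<Longrightarrow> even_lattice scale F V top_module int_form eps"
proof unfold_locales
  assume g: "even g"
  show "eps = 1" using g by (simp add: eps_def)
  define h where "h = g div 2 - 1"
  have gh: "g - 1 = Suc (2 * h)" "g div 2 = Suc h" using g genus by (auto simp: h_def elim!: evenE)
  show "wp dvd int_form x (F z)" if x: "x \<in> top_module" and z: "z \<in> top_module" for x z
  proof -
    obtain u where u: "u \<in> top_module" "(F ^^ (2 * h)) u = wp ^ h *s z" using top_F_even_power(1)[OF z] by blast
    hence "(F ^^ (g - 1)) u = wp ^ h *s F z" unfolding gh by (simp add: F_wp_power)
    then obtain d where "B x (wp ^ h *s F z) = to_fract (d x)"
      using top_dual_functional[OF u(1)] x by metis
    hence "to_fract (wp ^ (g div 2)) * B x (F z) = to_fract (wp * d x)"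
      using x z by (simp add: gh top_B(2))
    hence "int_form x (F z) = wp * d x" using x z by (intro int_form_eqI) auto
    thus ?thesis by simp
  qed
  fix x assume x: "x \<in> top_module" and dvd: "\<And>m. m \<in> top_module \<Longrightarrow> wp dvd int_form x m"
  obtain z where z: "z \<in> top_module" "wp *s (F ^^ (g - 1)) z = wp ^ (g div 2) *s x"
    using int_form_dvd_all[OF x dvd] by blast
  obtain u where u: "u \<in> top_module" "(F ^^ (2 * h)) z = wp ^ h *s u"
    using top_F_even_power(2)[OF z(1)] by blast
  hence "(F ^^ (g - 1)) z = wp ^ h *s F u" unfolding gh by (simp add: F_wp_power)
  hence "wp ^ Suc h *s (x - F u) = 0" using z by (simp add: scale_right_diff_distrib gh)
  hence "x - F u = 0" using top_module.torsion_free[of "x - F u" "wp ^ Suc h"] x u by simp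
  thus "x \<in> F ` top_module" using u by auto
qed

lemma odd_genus:
  assumes g: "odd g"
  shows "\<exists>e f. let bs = concat (map (\<lambda>i. [e i, f i]) [1..<g + 1]); q = wp ^ ((g - 1) div 2) in
     list_basis bs (M (g - 1)) \<and>
     (\<forall>i\<in>{1..g}. F (e i) = f i \<and> V (e i) = - f i \<and> F (f i) = - (wp *s e i) \<and> V (f i) = wp *s e i) \<and>
     dual_gram_matrix B (M (g - 1)) bs =
       diag_block_mat (replicate g (mat_of_rows_list 2 [[0, q], [- q, 0]]))"
proof -
  interpret odd: odd_lattice scale F V top_module g int_form eps by (rule odd_lattice_top[OF g])
  obtain y where y: "top_module.reduced (\<lambda>i j. 0) (\<lambda>i j. if i = j then 1 else 0) g y"
    using top_frame odd.odd_normal_form by blast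
  have q: "(g - 1) div 2 = g div 2" using g by presburger
  note res = odd.odd_frame_basis[OF y int_form]
  have "F (F (y (i - 1))) = - (wp *s y (i - 1))" "V (y (i - 1)) = - F (y (i - 1))"
    if "i \<in> {1..g}" for i
  proof -
    have "y (i - 1) \<in> top_module.skeleton" using top_module.frameD(1)[OF top_module.reducedD(1)[OF y]] that by auto
    thus "F (F (y (i - 1))) = - (wp *s y (i - 1))" "V (y (i - 1)) = - F (y (i - 1))"
      using top_module.F_F_skeleton[of "y (i - 1)"] top_module.V_skeleton[of "y (i - 1)"] g by (simp_all add: eps_def)
  qed
  thus ?thesis
    using res unfolding q top_module.frame_basis_list
    by (intro exI[of _ "\<lambda>i. y (i - 1)"] exI[of _ "\<lambda>i. F (y (i - 1))"])
      (simp add: Let_def V_F top_module_def)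
qed

lemma even_genus:
  assumes g: "even g"
  shows "\<exists>e f. let bs = concat (map (\<lambda>i. [e i, f i]) [1..<g + 1]); q = wp ^ (g div 2); r = wp ^ (g div 2 - 1) in
     list_basis bs (M (g - 1)) \<and>
     (\<forall>i\<in>{1..g}. F (e i) = f i \<and> V (e i) = f i \<and> F (f i) = wp *s e i \<and> V (f i) = wp *s e i) \<and>
     dual_gram_matrix B (M (g - 1)) bs =
       diag_block_mat (replicate (g div 2) (mat_of_rows_list 4
         [[0, 0, q, 0], [0, 0, 0, r], [- q, 0, 0, 0], [0, - r, 0, 0]]))"
proof -
  interpret even: even_lattice scale F V top_module g int_form eps by (rule even_lattice_top[OF g])
  obtain y where y: "top_module.reduced (\<lambda>i j. if even i \<and> j = Suc i then 1
      else if even j \<and> i = Suc j then - 1 else 0) (\<lambda>i j. 0) g y"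
    using top_frame even.even_normal_form g by blast
  have "g div 2 > 0" using g genus by (auto elim!: evenE)
  note res = even.even_frame_basis[OF y g this int_form]
  have "F (F (y (i - 1))) = wp *s y (i - 1)" "V (y (i - 1)) = F (y (i - 1))"
    if "i \<in> {1..g}" for i
  proof -
    have "y (i - 1) \<in> top_module.skeleton" using top_module.frameD(1)[OF top_module.reducedD(1)[OF y]] that by auto
    thus "F (F (y (i - 1))) = wp *s y (i - 1)" "V (y (i - 1)) = F (y (i - 1))"
      using top_module.F_F_skeleton[of "y (i - 1)"] top_module.V_skeleton[of "y (i - 1)"] g by (simp_all add: eps_def)
  qed
  thus ?thesis
    using res unfolding top_module.frame_basis_list
    by (intro exI[of _ "\<lambda>i. y (i - 1)"] exI[of _ "\<lambda>i. F (y (i - 1))"])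
      (simp add: Let_def V_F top_module_def)
qed

end

theorem theorem4p1:
  fixes scale :: "'k::{alg_closed_field, field_prime_char} witt \<Rightarrow> 'm::ab_group_add \<Rightarrow> 'm"
    and F V :: "'m \<Rightarrow> 'm"
    and g :: nat
    and M :: "nat \<Rightarrow> 'm set"
    and B :: "'m \<Rightarrow> 'm \<Rightarrow> 'k witt fract"
  assumes "pftq scale F V g M B"
  shows
    "(odd g \<longrightarrow>
       (\<exists>e f.
          (let bs = concat (map (\<lambda>i. [e i, f i]) [1..<g + 1]); q = of_nat CHAR('k) ^ ((g - 1) div 2) in
             dieudonne_module.list_basis scale bs (M (g - 1)) \<and>
             (\<forall>i\<in>{1..g}. F (e i) = f i \<and> V (e i) = - f i \<and>
                F (f i) = - scale (of_nat CHAR('k)) (e i) \<and> V (f i) = scale (of_nat CHAR('k)) (e i)) \<and>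
             dieudonne_module.dual_gram_matrix scale B (M (g - 1)) bs =
               diag_block_mat (replicate g (mat_of_rows_list 2
                 [[0, q],
                  [- q, 0]]))))) \<and>
     (even g \<longrightarrow>
       (\<exists>e f.
          (let bs = concat (map (\<lambda>i. [e i, f i]) [1..<g + 1]); q = of_nat CHAR('k) ^ (g div 2);
               r = of_nat CHAR('k) ^ (g div 2 - 1) in
             dieudonne_module.list_basis scale bs (M (g - 1)) \<and>
             (\<forall>i\<in>{1..g}. F (e i) = f i \<and> V (e i) = f i \<and>
                F (f i) = scale (of_nat CHAR('k)) (e i) \<and> V (f i) = scale (of_nat CHAR('k)) (e i)) \<and>
             dieudonne_module.dual_gram_matrix scale B (M (g - 1)) bs =
               diag_block_mat (replicate (g div 2) (mat_of_rows_list 4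
                 [[0, 0, q, 0],
                  [0, 0, 0, r],
                  [- q, 0, 0, 0],
                  [0, - r, 0, 0]])))))"
proof -
  interpret pftq scale F V g M B by (rule assms)
  show ?thesis using odd_genus even_genus by blast
qed

end
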